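(* For each $s>-1$, the space $\widetilde{\mathcal{R}}(\mathbb{C}_+):=\big\{a_0+\sum_{k=1}^n a_k(\lambda_k+z)^{-1}: n\in\mathbb{N},\ a_k\in\mathbb{C},\ \lambda_k\in\mathbb{C}_+\big\}$ is dense in $\mathcal{D}_s$.
   Context: For $s>-1$, $\mathcal{D}_s$ is the Banach space of holomorphic $f$ on $\mathbb{C}_+$ with $\|f\|_{\mathcal{D}_{s,0}}=\int_0^\infty\alpha^s\int_{-\infty}^\infty\frac{|f'(\alpha+i\beta)|}{(\alpha^2+\beta^2)^{(s+1)/2}}d\beta\,d\alpha<\infty$, normed by $\|f\|_{\mathcal{D}_s}=|f(\infty)|+\|f\|_{\mathcal{D}_{s,0}}$, where $f(\infty)=\lim_{|z|\to\infty,|\arg z|<\psi}f(z)$ (exists for all $\psi\in(0,\pi/2)$). *)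

theory Defs
  imports "HOL-Analysis.Analysis"
begin

definition rhp :: "complex set" where
  "rhp = {z. 0 < Re z}"

definition sector :: "real \<Rightarrow> complex set" where
  "sector psi = {z. z \<noteq> 0 \<and> \<bar>Arg z\<bar> < psi}"

definition f_inf :: "(complex \<Rightarrow> complex) \<Rightarrow> complex" where
  "f_inf f = (THE L. \<forall>psi\<in>{0<..<pi/2}. (f \<longlongrightarrow> L) (inf at_infinity (principal (sector psi))))"

definition Ds_integral :: "real \<Rightarrow> (complex \<Rightarrow> complex) \<Rightarrow> ennreal" where
  "Ds_integral s f =
     (\<integral>\<^sup>+ \<alpha>. indicator {0<..} \<alpha> *
        (\<integral>\<^sup>+ \<beta>. ennreal (\<alpha> powr s * norm (deriv f (Complex \<alpha> \<beta>))
                          / (\<alpha>\<^sup>2 + \<beta>\<^sup>2) powr ((s + 1) / 2)) \<partial>lborel) \<partial>lborel)"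

definition Ds :: "real \<Rightarrow> (complex \<Rightarrow> complex) set" where
  "Ds s = {f. f holomorphic_on rhp \<and> Ds_integral s f < \<infinity>}"

definition Ds0_norm :: "real \<Rightarrow> (complex \<Rightarrow> complex) \<Rightarrow> real" where
  "Ds0_norm s f = enn2real (Ds_integral s f)"

definition Ds_norm :: "real \<Rightarrow> (complex \<Rightarrow> complex) \<Rightarrow> real" where
  "Ds_norm s f = norm (f_inf f) + Ds0_norm s f"

definition Rtilde :: "(complex \<Rightarrow> complex) set" where
  "Rtilde = {(\<lambda>z. a0 + (\<Sum>k<(n::nat). a k / (lam k + z))) | a0 n a lam.
               \<forall>k<n. lam k \<in> rhp}"

end

theory Submission
  imports Defs "HOL-Complex_Analysis.Complex_Analysis"
begin

text \<open>
  Write \<open>g = f'\<close> and let \<open>\<mu>\<close> be the measure \<open>a\<^sup>s / \<bar>z\<bar>\<^sup>s\<^sup>+\<^sup>1 da db\<close> on the half-plane,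
  so that the seminorm of \<open>f\<close> is the \<open>L\<^sup>1(\<mu>)\<close>-norm of \<open>g\<close>. The functions
  \<open>G(z) = g(z + \<delta>) (1 + \<delta> z)\<^sup>-\<^sup>m\<close> converge to \<open>g\<close> in \<open>L\<^sup>1(\<mu>)\<close> as \<open>\<delta> \<rightarrow> 0\<close>: by Scheffe's lemma
  it suffices to bound their norms asymptotically by that of \<open>g\<close>. Where \<open>Re z \<ge> 2 \<delta>\<close> the weights at
  \<open>z\<close> and \<open>z + \<delta>\<close> are comparable; on the strip \<open>Re z < 2 \<delta>\<close>, where they are not, \<open>\<bar>g(z + \<delta>)\<bar>\<close> is at most
  a constant times its mean over a square of size \<open>\<delta>\<close>, and after Fubini's theorem only the \<open>\<mu>\<close>-measure
  of boxes touching the imaginary axis matters.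

  For large \<open>m\<close> the function \<open>(1 + z)\<^sup>2 G(z)\<close> becomes, in the variable \<open>u = (z - 1) / (z + 1)\<close>, an element
  of the disc algebra, hence a uniform limit of polynomials in \<open>u\<close>, and
  \<open>2 (1 + z)\<^sup>-\<^sup>2 (k + 1) u\<^sup>k\<close> is the derivative of \<open>u\<^sup>k\<^sup>+\<^sup>1\<close>. These powers are obtained from the simple poles
  \<open>1 / (1 - \<eta> u)\<close>. As \<open>\<bar>1 + z\<bar>\<^sup>-\<^sup>2\<close> is \<open>\<mu>\<close>-integrable, this yields approximation in \<open>L\<^sup>1(\<mu>)\<close>.
  Finally the constant \<open>a\<^sub>0\<close> is chosen so that the limits at infinity agree; the sub-mean value
  property also shows that these limits exist.
\<close>

section \<open>Approximation in the norm sup |g(z)| |1 + z|^2\<close>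

text \<open>The weight w(z) = a^s / |z|^(s+1) blows up at the origin for every s > -1, and at each
  point of the imaginary axis when s < 0. Hence w(z) / w(z + \<delta>) is unbounded, and the
  translation g(z) -> g(z + \<delta>) is not bounded on all of L^1(\<mu>): the estimate near the
  axis has to use that g is holomorphic.

  Translation makes G regular up to the axis, but at infinity the sub-mean value property gives only
  |g(z + \<delta>)| <= C |1 + z|^(s+1) with C depending on \<delta>. The factor (1 + \<delta> z)^-m
  has modulus at most 1, so it costs nothing in norm estimates, and m >= s + 4 turns the growth into
  |G(z)| <= C' |1 + z|^-3. This is one power more than boundedness of (1 + z)^2 G requires, and it
  provides the boundary value 0 at u = 1, the image of infinity.

  The space contains simple poles only, whereas u^k has a pole of order k at z = -1. The powers are
  therefore reached as limits of combinations of simple poles at -(1 + \<eta>) / (1 - \<eta>), which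
  tend to -1 as \<eta> -> 0.\<close>

lemma open_rhp: "open rhp"
  unfolding rhp_def by (rule open_halfspace_Re_gt)

lemma convex_rhp: "convex rhp"
  unfolding rhp_def by (rule convex_halfspace_Re_gt)

lemma rhp_add_nonzero: "lam \<in> rhp \<Longrightarrow> z \<in> rhp \<Longrightarrow> lam + z \<noteq> 0"
  by (auto simp: rhp_def complex_eq_iff)

lemma rhp_one_add_nonzero: "z \<in> rhp \<Longrightarrow> 1 + z \<noteq> 0"
  by (auto simp: rhp_def complex_eq_iff)

section \<open>The rational functions with simple poles as a vector space\<close>

lemma RtildeI:
  fixes n :: nat
  shows "(\<And>k. k < n \<Longrightarrow> lam k \<in> rhp) \<Longrightarrow> (\<lambda>z. a0 + (\<Sum>k<n. a k / (lam k + z))) \<in> Rtilde"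
  unfolding Rtilde_def by blast

lemma RtildeE:
  assumes "r \<in> Rtilde"
  obtains a0 n a lam where "r = (\<lambda>z. a0 + (\<Sum>k<(n::nat). a k / (lam k + z)))"
    "\<And>k. k < n \<Longrightarrow> lam k \<in> rhp"
  using assms unfolding Rtilde_def by blast

lemma Rtilde_holomorphic:
  assumes "r \<in> Rtilde"
  shows "r holomorphic_on rhp"
proof -
  obtain a0 n a lam where r: "r = (\<lambda>z. a0 + (\<Sum>k<(n::nat). a k / (lam k + z)))"
    and lam: "\<And>k. k < n \<Longrightarrow> lam k \<in> rhp"
    using RtildeE[OF assms] by metis
  show ?thesis
    unfolding r by (intro holomorphic_intros) (use lam rhp_add_nonzero in auto)
qed

lemma Rtilde_differentiable: "r \<in> Rtilde \<Longrightarrow> z \<in> rhp \<Longrightarrow> r field_differentiable at z"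
  using Rtilde_holomorphic open_rhp holomorphic_on_imp_differentiable_at by blast

lemma Rtilde_const: "(\<lambda>z. c) \<in> Rtilde"
  using RtildeI[of 0 "\<lambda>_. 0" c "\<lambda>_. 0"] by simp

lemma Rtilde_pole: "lam \<in> rhp \<Longrightarrow> (\<lambda>z. c / (lam + z)) \<in> Rtilde"
  using RtildeI[of 1 "\<lambda>_. lam" 0 "\<lambda>_. c"] by simp

lemma Rtilde_scale:
  assumes "r \<in> Rtilde"
  shows "(\<lambda>z. c * r z) \<in> Rtilde"
proof -
  obtain a0 n a lam where r: "r = (\<lambda>z. a0 + (\<Sum>k<(n::nat). a k / (lam k + z)))"
    and lam: "\<And>k. k < n \<Longrightarrow> lam k \<in> rhp"
    using RtildeE[OF assms] by metis
  have "(\<lambda>z. c * r z) = (\<lambda>z. c * a0 + (\<Sum>k<n. (c * a k) / (lam k + z)))"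
    unfolding r by (simp add: algebra_simps sum_distrib_left)
  also have "\<dots> \<in> Rtilde"
    using lam by (rule RtildeI)
  finally show ?thesis .
qed

lemma Rtilde_add:
  assumes "r \<in> Rtilde" "t \<in> Rtilde"
  shows "(\<lambda>z. r z + t z) \<in> Rtilde"
proof -
  obtain a0 n a lam where r: "r = (\<lambda>z. a0 + (\<Sum>k<(n::nat). a k / (lam k + z)))"
    and lam: "\<And>k. k < n \<Longrightarrow> lam k \<in> rhp"
    using RtildeE[OF assms(1)] by metis
  obtain b0 m b mu where t: "t = (\<lambda>z. b0 + (\<Sum>k<(m::nat). b k / (mu k + z)))"
    and mu: "\<And>k. k < m \<Longrightarrow> mu k \<in> rhp"
    using RtildeE[OF assms(2)] by metis
  define c where "c k = (if k < n then a k else b (k - n))" for k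
  define nu where "nu k = (if k < n then lam k else mu (k - n))" for k
  have "(\<Sum>k<n + m. c k / (nu k + z)) =
      (\<Sum>k<n. a k / (lam k + z)) + (\<Sum>k<m. b k / (mu k + z))" for z
  proof -
    have "(\<Sum>k<n + m. c k / (nu k + z)) =
        (\<Sum>k<n. c k / (nu k + z)) + (\<Sum>k<m. c (n + k) / (nu (n + k) + z))"
      by (induction m) (simp_all add: add.assoc)
    then show ?thesis
      by (simp add: c_def nu_def)
  qed
  then have "(\<lambda>z. r z + t z) = (\<lambda>z. (a0 + b0) + (\<Sum>k<n + m. c k / (nu k + z)))"
    unfolding r t by (simp add: algebra_simps)
  also have "\<dots> \<in> Rtilde"
    by (rule RtildeI) (use lam mu in \<open>auto simp: nu_def\<close>)
  finally show ?thesis .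
qed

text \<open>For u = (z - 1) / (z + 1) one has du/dz = 2 / (1 + z)^2, so the weight
  \<open>(norm (1 + z))\<^sup>2\<close> makes this, up to a constant, approximation of derivatives
  with respect to u in the sup norm of the disc. Only the derivative of \<open>r\<close> enters, so
  its additive constant stays free.\<close>

definition Rtilde_deriv_approximable :: "(complex \<Rightarrow> complex) \<Rightarrow> bool" where
  "Rtilde_deriv_approximable g \<longleftrightarrow>
     (\<forall>\<epsilon>>0. \<exists>r\<in>Rtilde. \<forall>z\<in>rhp. norm (g z - deriv r z) * (norm (1 + z))\<^sup>2 \<le> \<epsilon>)"

lemma approximable_scale:
  assumes "Rtilde_deriv_approximable g"
  shows "Rtilde_deriv_approximable (\<lambda>z. c * g z)"
  unfolding Rtilde_deriv_approximable_def
proof (intro allI impI)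
  fix \<epsilon> :: real assume e: "\<epsilon> > 0"
  have "\<epsilon> / (norm c + 1) > 0"
    using e by (simp add: add_nonneg_pos)
  then obtain r where r: "r \<in> Rtilde"
    and b: "\<And>z. z \<in> rhp \<Longrightarrow> norm (g z - deriv r z) * (norm (1 + z))\<^sup>2 \<le> \<epsilon> / (norm c + 1)"
    using assms unfolding Rtilde_deriv_approximable_def by meson
  have "norm (c * g z - deriv (\<lambda>z. c * r z) z) * (norm (1 + z))\<^sup>2 \<le> \<epsilon>" if z: "z \<in> rhp" for z
  proof -
    have "deriv (\<lambda>z. c * r z) z = c * deriv r z"
      using Rtilde_differentiable[OF r z] by (rule deriv_cmult)
    then have "norm (c * g z - deriv (\<lambda>z. c * r z) z) * (norm (1 + z))\<^sup>2
        = norm c * (norm (g z - deriv r z) * (norm (1 + z))\<^sup>2)"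
      by (simp add: norm_mult flip: right_diff_distrib)
    also have "\<dots> \<le> norm c * (\<epsilon> / (norm c + 1))"
      using b[OF z] by (rule mult_left_mono) simp
    also have "\<dots> \<le> \<epsilon>"
      using e by (subst times_divide_eq_right, subst pos_divide_le_eq)
        (auto simp: algebra_simps add_pos_nonneg)
    finally show ?thesis .
  qed
  then show "\<exists>r\<in>Rtilde. \<forall>z\<in>rhp. norm (c * g z - deriv r z) * (norm (1 + z))\<^sup>2 \<le> \<epsilon>"
    using Rtilde_scale[OF r, of c] by blast
qed

lemma approximable_add:
  assumes "Rtilde_deriv_approximable g" "Rtilde_deriv_approximable h"
  shows "Rtilde_deriv_approximable (\<lambda>z. g z + h z)"
  unfolding Rtilde_deriv_approximable_def
proof (intro allI impI)
  fix \<epsilon> :: real assume e: "\<epsilon> > 0"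
  then have e2: "\<epsilon> / 2 > 0" by simp
  obtain r where r: "r \<in> Rtilde"
    and br: "\<And>z. z \<in> rhp \<Longrightarrow> norm (g z - deriv r z) * (norm (1 + z))\<^sup>2 \<le> \<epsilon> / 2"
    using assms(1) e2 unfolding Rtilde_deriv_approximable_def by meson
  obtain t where t: "t \<in> Rtilde"
    and bt: "\<And>z. z \<in> rhp \<Longrightarrow> norm (h z - deriv t z) * (norm (1 + z))\<^sup>2 \<le> \<epsilon> / 2"
    using assms(2) e2 unfolding Rtilde_deriv_approximable_def by meson
  have "norm (g z + h z - deriv (\<lambda>z. r z + t z) z) * (norm (1 + z))\<^sup>2 \<le> \<epsilon>" if z: "z \<in> rhp" for z
  proof -
    have "deriv (\<lambda>z. r z + t z) z = deriv r z + deriv t z"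
      using Rtilde_differentiable[OF r z] Rtilde_differentiable[OF t z] by (rule deriv_add)
    then have "norm (g z + h z - deriv (\<lambda>z. r z + t z) z)
        \<le> norm (g z - deriv r z) + norm (h z - deriv t z)"
      by (simp add: norm_diff_triangle_ineq)
    then have "norm (g z + h z - deriv (\<lambda>z. r z + t z) z) * (norm (1 + z))\<^sup>2
        \<le> (norm (g z - deriv r z) + norm (h z - deriv t z)) * (norm (1 + z))\<^sup>2"
      by (rule mult_right_mono) simp
    with br[OF z] bt[OF z] show ?thesis
      by (simp add: distrib_right)
  qed
  then show "\<exists>r\<in>Rtilde. \<forall>z\<in>rhp. norm (g z + h z - deriv r z) * (norm (1 + z))\<^sup>2 \<le> \<epsilon>"
    using Rtilde_add[OF r t] by blast
qed

lemma approximable_zero: "Rtilde_deriv_approximable (\<lambda>z. 0)"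
  unfolding Rtilde_deriv_approximable_def using Rtilde_const[of 0] by force

lemma approximable_sum:
  fixes n :: nat
  assumes "\<And>k. k < n \<Longrightarrow> Rtilde_deriv_approximable (g k)"
  shows "Rtilde_deriv_approximable (\<lambda>z. \<Sum>k<n. g k z)"
  using assms by (induction n) (simp_all add: approximable_zero approximable_add)

text \<open>An \<epsilon>/2 argument. It allows two limits in succession, \<eta> -> 0 for the powers
  of u and then polynomial approximation, without tracking the rational function that
  results.\<close>

lemma approximable_closed:
  assumes "\<And>\<epsilon>. \<epsilon> > 0 \<Longrightarrow>
    \<exists>h. Rtilde_deriv_approximable h \<and> (\<forall>z\<in>rhp. norm (g z - h z) * (norm (1 + z))\<^sup>2 \<le> \<epsilon>)"
  shows "Rtilde_deriv_approximable g"
  unfolding Rtilde_deriv_approximable_def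
proof (intro allI impI)
  fix \<epsilon> :: real assume e: "\<epsilon> > 0"
  then have e2: "\<epsilon> / 2 > 0" by simp
  obtain h where h: "Rtilde_deriv_approximable h"
    and gh: "\<And>z. z \<in> rhp \<Longrightarrow> norm (g z - h z) * (norm (1 + z))\<^sup>2 \<le> \<epsilon> / 2"
    using assms[OF e2] by blast
  obtain r where r: "r \<in> Rtilde"
    and br: "\<And>z. z \<in> rhp \<Longrightarrow> norm (h z - deriv r z) * (norm (1 + z))\<^sup>2 \<le> \<epsilon> / 2"
    using h e2 unfolding Rtilde_deriv_approximable_def by meson
  have "norm (g z - deriv r z) * (norm (1 + z))\<^sup>2 \<le> \<epsilon>" if z: "z \<in> rhp" for z
  proof -
    have "norm (g z - deriv r z) \<le> norm (g z - h z) + norm (h z - deriv r z)"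
      using norm_triangle_ineq[of "g z - h z" "h z - deriv r z"] by simp
    then have "norm (g z - deriv r z) * (norm (1 + z))\<^sup>2
        \<le> (norm (g z - h z) + norm (h z - deriv r z)) * (norm (1 + z))\<^sup>2"
      by (rule mult_right_mono) simp
    with gh[OF z] br[OF z] show ?thesis
      by (simp add: distrib_right)
  qed
  with r show "\<exists>r\<in>Rtilde. \<forall>z\<in>rhp. norm (g z - deriv r z) * (norm (1 + z))\<^sup>2 \<le> \<epsilon>"
    by blast
qed

section \<open>The Cayley transform: from simple poles to powers of u\<close>

definition cayley :: "complex \<Rightarrow> complex" where
  "cayley z = (z - 1) / (z + 1)"

lemma norm_cayley_less_1:
  assumes "z \<in> rhp"
  shows "norm (cayley z) < 1"
proof -
  have "norm (z - 1) < norm (z + 1)"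
    unfolding cmod_def using assms by (simp add: rhp_def power2_eq_square algebra_simps)
  then show ?thesis
    unfolding cayley_def norm_divide by (subst divide_less_eq_1_pos) (auto intro: le_less_trans[OF norm_ge_zero])
qed

text \<open>As a function of z, 1 / (1 - \<eta> u) is a constant plus one simple pole, because (1 -
  \<eta>) (lam + z) = (1 + z) (1 - \<eta> u). The function in question is its z-derivative, so it is
  matched with error 0.\<close>

lemma approximable_cayley_pole:
  fixes \<eta> :: real
  assumes "0 < \<eta>" "\<eta> < 1"
  shows "Rtilde_deriv_approximable (\<lambda>z. 2 / (1 + z)\<^sup>2 * (\<eta> / (1 - \<eta> * cayley z)\<^sup>2))"
proof -
  \<comment> \<open>The point \<open>- lam\<close> solves \<eta> u = 1, and \<open>c\<close> is the
    residue of 1 / (1 - \<eta> u) there.\<close>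
  define lam :: complex where "lam = of_real ((1 + \<eta>) / (1 - \<eta>))"
  define c :: complex where "c = - (2 * \<eta>) / (1 - of_real \<eta>)\<^sup>2"
  have lam: "lam \<in> rhp"
    using assms by (simp add: lam_def rhp_def)
  have eq: "deriv (\<lambda>z. c / (lam + z)) z = 2 / (1 + z)\<^sup>2 * (\<eta> / (1 - \<eta> * cayley z)\<^sup>2)"
    if z: "z \<in> rhp" for z
  proof -
    have nz: "lam + z \<noteq> 0" "1 + z \<noteq> 0" "z + 1 \<noteq> 0"
      using rhp_add_nonzero[OF lam z] rhp_one_add_nonzero[OF z] by (auto simp: add.commute)
    have e1: "(1 - of_real \<eta>) * (lam + z) = (1 + z) * (1 - \<eta> * cayley z)"
    proof -
      have "(1 - of_real \<eta>) * lam = of_real ((1 - \<eta>) * ((1 + \<eta>) / (1 - \<eta>)))"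
        unfolding lam_def by (simp only: of_real_mult of_real_diff of_real_1)
      then have A: "(1 - of_real \<eta>) * lam = 1 + of_real \<eta>"
        using assms by simp
      have B: "(1 + z) * (1 - \<eta> * cayley z) = (1 + z) - \<eta> * (z - 1)"
        using nz by (simp add: cayley_def field_simps)
      show ?thesis
        unfolding B distrib_left A by (simp add: algebra_simps)
    qed
    have "deriv (\<lambda>z. c / (lam + z)) z = - c / (lam + z)\<^sup>2"
      using nz by (intro DERIV_imp_deriv)
        (auto intro!: derivative_eq_intros simp: power2_eq_square)
    also have "\<dots> = 2 * \<eta> / ((1 - of_real \<eta>) * (lam + z))\<^sup>2"
      by (simp add: c_def power_mult_distrib)
    finally show ?thesis
      by (simp add: e1 power_mult_distrib)
  qed
  show ?thesis
    unfolding Rtilde_deriv_approximable_def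
    by (intro allI impI bexI[OF _ Rtilde_pole[OF lam, of c]]) (use eq in auto)
qed

text \<open>This is the u-derivative of 1 / (1 - \<eta> u) = (sum of (\<eta> u)^k over k < m) +
  (\<eta> u)^m / (1 - \<eta> u), proved as an algebraic identity. The truncated exponents
  \<open>k - 1\<close> and \<open>m - 1\<close> do no harm at 0, where the factor
  \<open>of_nat 0\<close> vanishes.\<close>

lemma geometric_deriv_remainder:
  fixes u \<eta> :: "'a::field"
  assumes "1 - \<eta> * u \<noteq> 0"
  shows "\<eta> / (1 - \<eta> * u)\<^sup>2 = (\<Sum>k<m. of_nat k * \<eta> ^ k * u ^ (k - 1))
    + \<eta> ^ m * (of_nat m * u ^ (m - 1) / (1 - \<eta> * u) + u ^ m * \<eta> / (1 - \<eta> * u)\<^sup>2)"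
proof (induction m)
  case 0
  show ?case by simp
next
  case (Suc m)
  let ?x = "1 - \<eta> * u"
  have "\<eta> ^ m * (of_nat m * u ^ (m - 1) / ?x + u ^ m * \<eta> / ?x\<^sup>2) =
      of_nat m * \<eta> ^ m * u ^ (m - 1) +
      \<eta> ^ Suc m * (of_nat (Suc m) * u ^ m / ?x + u ^ Suc m * \<eta> / ?x\<^sup>2)"
  proof (cases m)
    case 0
    then show ?thesis using assms by (simp add: divide_simps power2_eq_square)
  next
    case (Suc l)
    then show ?thesis using assms by (simp add: divide_simps power2_eq_square) (simp add: algebra_simps)
  qed
  then show ?case
    using Suc.IH by (simp add: algebra_simps)
qed

text \<open>The \<open>m\<close>-th coefficient of the geometric series \<open>1 / (1 - \<eta> u)\<close> is isolated by
  subtracting the lower ones, rescaling by \<open>\<eta>\<^sup>-\<^sup>m\<close> and letting \<open>\<eta>\<close> tend to \<open>0\<close>.\<close>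

lemma approximable_cayley_power:
  "Rtilde_deriv_approximable (\<lambda>z. 2 / (1 + z)\<^sup>2 * (of_nat m * cayley z ^ (m - 1)))"
proof (induction m rule: less_induct)
  case (less m)
  show ?case
  proof (rule approximable_closed)
    fix \<epsilon> :: real assume e: "\<epsilon> > 0"
    \<comment> \<open>The final error is at most 2 \<eta> (2 m + 4), and \<eta> <= 1/2 keeps |1 -
      \<eta> u| >= 1/2.\<close>
    define \<eta> where "\<eta> = min (1/2) (\<epsilon> / (2 * (2 * real m + 4)))"
    have eta: "0 < \<eta>" "\<eta> \<le> 1/2" "\<eta> \<le> \<epsilon> / (2 * (2 * real m + 4))"
      using e unfolding \<eta>_def by - (simp, rule min.cobounded1, rule min.cobounded2)
    define h where "h z = of_real (1 / \<eta> ^ m) * (2 / (1 + z)\<^sup>2 * (\<eta> / (1 - \<eta> * cayley z)\<^sup>2)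
      + (\<Sum>k<m. - (of_real (\<eta> ^ k)) * (2 / (1 + z)\<^sup>2 * (of_nat k * cayley z ^ (k - 1)))))" for z
    have "Rtilde_deriv_approximable h"
      unfolding h_def using eta
      by (intro approximable_scale approximable_add approximable_sum approximable_cayley_pole less) auto
    moreover have "norm (2 / (1 + z)\<^sup>2 * (of_nat m * cayley z ^ (m - 1)) - h z) * (norm (1 + z))\<^sup>2 \<le> \<epsilon>"
      if z: "z \<in> rhp" for z
    proof -
      define u where "u = cayley z"
      have u: "norm u < 1" using norm_cayley_less_1[OF z] by (simp add: u_def)
      have nz: "1 + z \<noteq> 0" by (rule rhp_one_add_nonzero[OF z])
      have hu: "norm (\<eta> * u) \<le> 1/2"
        using eta u mult_mono[of \<eta> "1/2" "norm u" 1] by (simp add: norm_mult)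
      then have x: "norm (1 - \<eta> * u) \<ge> 1/2"
        using norm_triangle_ineq2[of 1 "\<eta> * u"] by simp
      then have x0: "1 - \<eta> * u \<noteq> 0" by auto
      have "h z = 2 / (1 + z)\<^sup>2 * (of_real (1 / \<eta> ^ m) * (\<eta> / (1 - \<eta> * u)\<^sup>2
          - (\<Sum>k<m. of_nat k * \<eta> ^ k * u ^ (k - 1))))"
        unfolding h_def u_def[symmetric] 
        by (simp add: right_diff_distrib distrib_left sum_negf sum_distrib_left mult_ac)
      also have "\<dots> = 2 / (1 + z)\<^sup>2 * (of_nat m * u ^ (m - 1) / (1 - \<eta> * u)
          + u ^ m * \<eta> / (1 - \<eta> * u)\<^sup>2)"
        using eta by (subst geometric_deriv_remainder[OF x0, of m]) simp
      finally have h: "h z = \<dots>" .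
      \<comment> \<open>The terms of order 0 in \<eta> cancel: m u^(m-1) (1 - 1 / (1 - \<eta> u)) =
        - \<eta> m u^m / (1 - \<eta> u). What remains is \<eta> times a bounded quantity.\<close>
      have "of_nat m * u ^ (m - 1) - (of_nat m * u ^ (m - 1) / (1 - \<eta> * u)
          + u ^ m * \<eta> / (1 - \<eta> * u)\<^sup>2)
          = - (\<eta> * (of_nat m * u ^ m / (1 - \<eta> * u) + u ^ m / (1 - \<eta> * u)\<^sup>2))" 
        using x0 by (cases m) (simp_all add: divide_simps, simp_all add: algebra_simps)
      then have "2 / (1 + z)\<^sup>2 * (of_nat m * cayley z ^ (m - 1)) - h z
          = - (2 / (1 + z)\<^sup>2 * (\<eta> * (of_nat m * u ^ m / (1 - \<eta> * u) + u ^ m / (1 - \<eta> * u)\<^sup>2)))"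
        unfolding h u_def[symmetric] right_diff_distrib[symmetric] by simp
      then have "norm (2 / (1 + z)\<^sup>2 * (of_nat m * cayley z ^ (m - 1)) - h z) * (norm (1 + z))\<^sup>2
          = 2 * \<eta> * norm (of_nat m * u ^ m / (1 - \<eta> * u) + u ^ m / (1 - \<eta> * u)\<^sup>2)"
        using nz eta by (simp add: norm_mult norm_divide norm_power)
      also have "norm (of_nat m * u ^ m / (1 - \<eta> * u) + u ^ m / (1 - \<eta> * u)\<^sup>2)
          \<le> 2 * real m + 4"
      proof (rule norm_triangle_mono)
        have um: "norm u ^ m \<le> 1" using u by (simp add: power_le_one)
        have "norm (of_nat m * u ^ m / (1 - \<eta> * u)) = m * norm u ^ m / norm (1 - \<eta> * u)"
          by (simp add: norm_mult norm_divide norm_power)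
        also have "\<dots> \<le> (m * 1) / (1/2)"
          using um x by (intro frac_le) (auto intro: mult_left_le)
        finally show "norm (of_nat m * u ^ m / (1 - \<eta> * u)) \<le> 2 * real m" by simp
        have "norm (u ^ m / (1 - \<eta> * u)\<^sup>2) = norm u ^ m / (norm (1 - \<eta> * u))\<^sup>2"
          by (simp add: norm_divide norm_power)
        also have "\<dots> \<le> 1 / (1/2)\<^sup>2"
          using um x by (intro frac_le power_mono) auto
        finally show "norm (u ^ m / (1 - \<eta> * u)\<^sup>2) \<le> 4" by (simp add: power2_eq_square)
      qed
      also have "2 * \<eta> * (2 * real m + 4) \<le> \<epsilon>"
        using eta(3) by (simp add: field_simps)
      finally show ?thesis using eta by simp
    qed
    ultimately show "\<exists>h. Rtilde_deriv_approximable h \<and> (\<forall>z\<in>rhp.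
        norm (2 / (1 + z)\<^sup>2 * (of_nat m * cayley z ^ (m - 1)) - h z) * (norm (1 + z))\<^sup>2 \<le> \<epsilon>)"
      by blast
  qed
qed


section \<open>Polynomial approximation on the disc, transported to the half-plane\<close>

lemma Re_inverse_cayley_nonneg:
  assumes "norm u \<le> 1"
  shows "0 \<le> Re ((1 + u) / (1 - u))"
proof -
  have "Re ((1 + u) * cnj (1 - u)) = 1 - (norm u)\<^sup>2"
    unfolding cmod_power2 by (simp add: algebra_simps power2_eq_square)
  also have "\<dots> \<ge> 0"
    using assms by (simp add: power_le_one)
  finally show ?thesis
    by (simp only: Re_complex_div_ge_0)
qed

lemma Re_inverse_cayley_pos:
  assumes "norm u < 1"
  shows "0 < Re ((1 + u) / (1 - u))"
proof -
  have "Re ((1 + u) * cnj (1 - u)) = 1 - (norm u)\<^sup>2"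
    unfolding cmod_power2 by (simp add: algebra_simps power2_eq_square)
  also have "\<dots> > 0"
    using assms by (simp add: power_less_one_iff abs_square_less_1)
  finally show ?thesis
    by (simp only: Re_complex_div_gt_0)
qed

text \<open>The Taylor series of P need not converge on the closed disc, so P is replaced by the
  dilate P(\<rho> u) with \<rho> < 1. Uniform continuity makes this close to P, and its Taylor
  polynomials, with coefficients a_i \<rho>^i, converge uniformly.\<close>

lemma disc_algebra_polynomial_approx:
  fixes P :: "complex \<Rightarrow> complex"
  assumes cont: "continuous_on (cball 0 1) P" and hol: "P holomorphic_on ball 0 1" and "\<epsilon> > 0"
  shows "\<exists>a N. \<forall>u\<in>cball 0 1. norm (P u - (\<Sum>i<(N::nat). a i * u ^ i)) \<le> \<epsilon>"
proof -
  have "uniformly_continuous_on (cball 0 1) P"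
    by (rule compact_uniformly_continuous[OF cont compact_cball])
  then obtain d where d: "d > 0" and
    dP: "\<And>u v. u \<in> cball 0 1 \<Longrightarrow> v \<in> cball 0 1 \<Longrightarrow> dist v u < d \<Longrightarrow> dist (P v) (P u) < \<epsilon> / 2"
    unfolding uniformly_continuous_on_def using \<open>\<epsilon> > 0\<close> by (metis half_gt_zero)
  define \<rho> where "\<rho> = max (1/2) (1 - d / 2)"
  have rho: "0 < \<rho>" "\<rho> < 1" "1 - \<rho> < d"
    using d by (auto simp: \<rho>_def)
  define a where "a n = (deriv ^^ n) P 0 / fact n" for n
  have sums: "(\<lambda>n. a n * w ^ n) sums P w" if "w \<in> ball 0 1" for w
    using holomorphic_power_series[OF hol that] by (simp add: a_def)
  \<comment> \<open>Convergence at a point strictly between \<rho> and 1 shows that the radius of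
    convergence exceeds \<rho>.\<close>
  have "of_real ((1 + \<rho>) / 2) \<in> ball (0::complex) 1"
    using rho by (simp del: of_real_divide of_real_add)
  then have "summable (\<lambda>n. a n * of_real ((1 + \<rho>) / 2) ^ n)"
    using sums sums_summable by blast
  then have "conv_radius a \<ge> norm (of_real ((1 + \<rho>) / 2) :: complex)"
    by (rule conv_radius_geI)
  then have "ereal \<rho> < conv_radius a"
    using rho by (intro less_le_trans[OF _ \<open>_ \<le> conv_radius a\<close>]) (simp del: of_real_divide of_real_add)
  then have "uniform_limit (cball 0 \<rho>) (\<lambda>n x. \<Sum>i<n. a i * (x - 0) ^ i)
      (\<lambda>x. \<Sum>i. a i * (x - 0) ^ i) sequentially"
    by (rule powser_uniform_limit)
  then have "\<forall>\<^sub>F n in sequentially. \<forall>x\<in>cball 0 \<rho>.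
      dist (\<Sum>i<n. a i * (x - 0) ^ i) (\<Sum>i. a i * (x - 0) ^ i) < \<epsilon> / 2"
    using \<open>\<epsilon> > 0\<close> by (intro uniform_limitD) simp_all
  then obtain N where N: "\<And>x. x \<in> cball 0 \<rho> \<Longrightarrow>
      dist (\<Sum>i<N. a i * x ^ i) (\<Sum>i. a i * x ^ i) < \<epsilon> / 2"
    unfolding eventually_sequentially diff_zero by blast
  have "norm (P u - (\<Sum>i<N. (a i * \<rho> ^ i) * u ^ i)) \<le> \<epsilon>" if u: "u \<in> cball 0 1" for u
  proof -
    have 1: "norm (\<rho> * u) \<le> \<rho>"
      using rho u by (simp add: norm_mult)
    have "norm (of_real \<rho> * u - u) = norm (of_real (\<rho> - 1) * u)"
      by (simp add: algebra_simps)
    also have "\<dots> = (1 - \<rho>) * norm u"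
      using rho by (simp add: norm_mult del: of_real_diff)
    also have "\<dots> \<le> (1 - \<rho>) * 1"
      using rho u by (intro mult_left_mono) auto
    finally have "dist (\<rho> * u) u < d"
      using rho by (simp add: dist_norm)
    then have A: "dist (P (\<rho> * u)) (P u) < \<epsilon> / 2"
      using 1 rho u by (intro dP) auto
    have "(\<Sum>i. a i * (\<rho> * u) ^ i) = P (\<rho> * u)"
      using 1 rho by (intro sums_unique[symmetric] sums) auto
    then have B: "dist (\<Sum>i<N. a i * (\<rho> * u) ^ i) (P (\<rho> * u)) < \<epsilon> / 2"
      using N[of "\<rho> * u"] 1 by simp
    have "dist (\<Sum>i<N. a i * (\<rho> * u) ^ i) (P u) < \<epsilon>"
      using dist_triangle_less_add[OF B A[unfolded dist_commute[of "P (\<rho> * u)"]]]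
      by (simp add: dist_commute)
    then show ?thesis
      by (simp add: dist_norm norm_minus_commute power_mult_distrib mult_ac)
  qed
  then show ?thesis
    by (intro exI[of _ "\<lambda>i. a i * \<rho> ^ i"] exI[of _ N]) auto
qed

text \<open>Since 1 + z = 2 / (1 - u), the function P below is (1 + z)^2 G(z) in the variable u.
  Cubic decay of G gives |P(u)| <= C / |1 + z| = C |1 - u| / 2, hence continuity at u = 1. At the
  other boundary points it comes from continuity of G on the closed half-plane.\<close>

lemma approximable_of_decay:
  assumes cont: "continuous_on {z. 0 \<le> Re z} G" and hol: "G holomorphic_on rhp"
    and decay: "\<And>z. 0 \<le> Re z \<Longrightarrow> norm (G z) * norm (1 + z) ^ 3 \<le> C"
  shows "Rtilde_deriv_approximable G"
proof (rule approximable_closed)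
  fix \<epsilon> :: real assume e: "\<epsilon> > 0"
  define P where "P u = (if u = 1 then 0 else 4 / (1 - u)\<^sup>2 * G ((1 + u) / (1 - u)))" for u
  have bound: "norm (P u) \<le> C / 2 * norm (u - 1)" if u: "u \<in> cball 0 1" for u
  proof (cases "u = 1")
    case False
    then have nz: "1 - u \<noteq> 0" by simp
    then have "1 + (1 + u) / (1 - u) = 2 / (1 - u)"
      by (simp add: field_simps)
    then have "norm (G ((1 + u) / (1 - u))) * norm (2 / (1 - u)) ^ 3 \<le> C"
      using decay[of "(1 + u) / (1 - u)"] Re_inverse_cayley_nonneg[of u] u by simp
    then have "norm (G ((1 + u) / (1 - u))) * 8 \<le> C * norm (1 - u) ^ 3"
      using nz by (simp add: norm_divide power_divide field_simps)
    then have "norm (G ((1 + u) / (1 - u))) * 4 \<le> (C / 2 * norm (1 - u)) * (norm (1 - u))\<^sup>2"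
      by (simp add: power2_eq_square power3_eq_cube)
    then show ?thesis
      using False nz by (simp add: P_def norm_mult norm_divide norm_power norm_minus_commute[of u]
          pos_divide_le_eq mult_ac)
  qed (simp add: P_def)
  have contP: "continuous_on (cball 0 1) P"
    unfolding continuous_on_eq_continuous_within
  proof
    fix x :: complex assume x: "x \<in> cball 0 1"
    show "continuous (at x within cball 0 1) P"
    proof (cases "x = 1")
      case True
      have "(P \<longlongrightarrow> 0) (at 1 within cball 0 1)"
      proof (rule tendsto_0_le[where K = 1])
        show "((\<lambda>u. C / 2 * norm (u - 1)) \<longlongrightarrow> 0) (at 1 within cball (0::complex) 1)"
          by (rule tendsto_eq_intros refl | simp)+
        show "\<forall>\<^sub>F u in at 1 within cball 0 1. norm (P u) \<le> norm (C / 2 * norm (u - 1)) * 1"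
          unfolding eventually_at_filter
          by (intro always_eventually) (use bound in \<open>force intro: order_trans[OF _ abs_ge_self]\<close>)
      qed
      then show ?thesis
        using True by (simp add: continuous_within P_def)
    next
      case False
      have "continuous_on (cball 0 1 - {1}) (\<lambda>u. 4 / (1 - u)\<^sup>2 * G ((1 + u) / (1 - u)))"
        by (intro continuous_intros continuous_on_compose2[OF cont])
          (use Re_inverse_cayley_nonneg in auto)
      then have "continuous_on (cball 0 1 - {1}) P"
        by (rule continuous_on_eq) (auto simp: P_def)
      then have "continuous (at x within cball 0 1 - {1}) P"
        using x False by (simp add: continuous_on_eq_continuous_within)
      moreover have "at x within cball 0 1 - {1} = at x within cball 0 1"
        using False by (intro at_within_nhd[of _ "- {1}"]) auto
      ultimately show ?thesis by simp
    qed
  qed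
  have "(\<lambda>u. 4 / (1 - u)\<^sup>2 * G ((1 + u) / (1 - u))) holomorphic_on ball 0 1"
    by (intro holomorphic_intros holomorphic_on_compose_gen[OF _ hol, unfolded o_def])
      (use Re_inverse_cayley_pos in \<open>auto simp: rhp_def\<close>)
  then have "P holomorphic_on ball 0 1"
    by (rule holomorphic_transform) (auto simp: P_def)
  with contP e obtain a N where
    aN: "\<And>u. u \<in> cball 0 1 \<Longrightarrow> norm (P u - (\<Sum>i<(N::nat). a i * u ^ i)) \<le> \<epsilon>"
    using disc_algebra_polynomial_approx by meson
  \<comment> \<open>Dividing the derivative of u^(i+1) by 2 (i + 1) leaves u^i / (1 + z)^2, so
    \<open>h\<close> is the polynomial in u divided by (1 + z)^2.\<close>
  define h where "h z = (\<Sum>i<N. a i / (2 * of_nat (Suc i)) *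
    (2 / (1 + z)\<^sup>2 * (of_nat (Suc i) * cayley z ^ (Suc i - 1))))" for z
  have "Rtilde_deriv_approximable h"
    unfolding h_def by (intro approximable_sum approximable_scale approximable_cayley_power)
  moreover have "norm (G z - h z) * (norm (1 + z))\<^sup>2 \<le> \<epsilon>" if z: "z \<in> rhp" for z
  proof -
    define u where "u = cayley z"
    have nz: "1 + z \<noteq> 0" "z + 1 \<noteq> 0"
      using rhp_one_add_nonzero[OF z] by (auto simp: add.commute)
    have 1: "1 - u = 2 / (1 + z)" "1 + u = 2 * z / (1 + z)"
      using nz by (simp_all add: u_def cayley_def field_simps)
    then have 2: "u \<noteq> 1" "(1 + u) / (1 - u) = z"
      using nz by auto
    then have "P u = (1 + z)\<^sup>2 * G z"
      unfolding P_def 2 1 by (simp add: power_divide)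
    moreover have "h z * (1 + z)\<^sup>2 = (\<Sum>i<N. a i * u ^ i)"
      unfolding h_def sum_distrib_right u_def[symmetric]
      by (rule sum.cong[OF refl]) (use nz in \<open>simp add: field_simps del: of_nat_Suc\<close>)
    ultimately have "(G z - h z) * (1 + z)\<^sup>2 = P u - (\<Sum>i<N. a i * u ^ i)"
      by (simp add: algebra_simps)
    then have "norm (G z - h z) * (norm (1 + z))\<^sup>2 = norm (P u - (\<Sum>i<N. a i * u ^ i))"
      by (metis norm_mult norm_power)
    then show ?thesis
      using aN[of u] norm_cayley_less_1[OF z] by (simp add: u_def)
  qed
  ultimately show "\<exists>h. Rtilde_deriv_approximable h \<and>
      (\<forall>z\<in>rhp. norm (G z - h z) * (norm (1 + z))\<^sup>2 \<le> \<epsilon>)"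
    by blast
qed

section \<open>The measure defining the norm\<close>

definition Ds_weight :: "real \<Rightarrow> real \<Rightarrow> real \<Rightarrow> real" where
  "Ds_weight s a b = a powr s / (a\<^sup>2 + b\<^sup>2) powr ((s + 1) / 2)"

text \<open>\<open>powr\<close> is positive also at negative bases, so it is the indicator that
  confines the measure to the half-plane. A measure on pairs makes dominated convergence, Scheffe's
  lemma and Fubini's theorem available for the seminorm.\<close>

definition Ds_measure :: "real \<Rightarrow> (real \<times> real) measure" where
  "Ds_measure s = density lborel (\<lambda>x. indicator {0<..} (fst x) * ennreal (Ds_weight s (fst x) (snd x)))"

text \<open>Off the half-plane nothing is known about \<open>g\<close>, which will be a derivative
  there without meaning. Extension by 0 makes it Borel measurable as soon as \<open>g\<close> is
  continuous on the half-plane.\<close>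

definition on_rhp :: "(complex \<Rightarrow> complex) \<Rightarrow> real \<times> real \<Rightarrow> complex" where
  "on_rhp g x = (if 0 < fst x then g (Complex (fst x) (snd x)) else 0)"

lemma borel_measurable_fst_snd [measurable]:
  "fst \<in> borel_measurable (borel :: (real \<times> real) measure)"
  "snd \<in> borel_measurable (borel :: (real \<times> real) measure)"
  by (auto intro!: borel_measurable_continuous_onI continuous_intros)

lemma Ds_weight_nonneg [simp]: "0 \<le> Ds_weight s a b"
  by (simp add: Ds_weight_def)

lemma Ds_weight_measurable [measurable]:
  assumes [measurable]: "f \<in> borel_measurable M" "g \<in> borel_measurable M"
  shows "(\<lambda>x. Ds_weight s (f x) (g x)) \<in> borel_measurable M"
  unfolding Ds_weight_def by measurable

lemma sets_Ds_measure [simp, measurable_cong]: "sets (Ds_measure s) = sets borel"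
  by (simp add: Ds_measure_def)

lemma space_Ds_measure [simp]: "space (Ds_measure s) = UNIV"
  by (simp add: Ds_measure_def)

lemma on_rhp_measurable:
  assumes "continuous_on rhp g"
  shows "on_rhp g \<in> borel_measurable borel"
proof -
  have "(\<lambda>x. if x \<in> {x :: real \<times> real. 0 < fst x} then g (Complex (fst x) (snd x)) else 0)
      \<in> borel_measurable borel"
  proof (rule borel_measurable_continuous_on_if)
    show "{x :: real \<times> real. 0 < fst x} \<in> sets borel"
      by measurable
    show "continuous_on {x :: real \<times> real. 0 < fst x} (\<lambda>x. g (Complex (fst x) (snd x)))"
      by (intro continuous_on_compose2[OF assms] continuous_intros) (auto simp: rhp_def)
  qed auto
  then show ?thesis
    by (simp add: on_rhp_def[abs_def])
qed

lemma nn_integral_lborel_pair: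
  fixes f :: "real \<times> real \<Rightarrow> ennreal"
  assumes [measurable]: "f \<in> borel_measurable borel"
  shows "(\<integral>\<^sup>+x. f x \<partial>lborel) = (\<integral>\<^sup>+a. \<integral>\<^sup>+b. f (a, b) \<partial>lborel \<partial>lborel)"
proof -
  have "f \<in> borel_measurable (lborel \<Otimes>\<^sub>M lborel)"
    by (simp add: lborel_prod)
  then show ?thesis
    using lborel.nn_integral_fst[of f lborel] by (simp add: lborel_prod)
qed

lemma nn_integral_Ds_measure:
  assumes [measurable]: "f \<in> borel_measurable borel"
  shows "(\<integral>\<^sup>+x. f x \<partial>Ds_measure s) =
    (\<integral>\<^sup>+x. indicator {0<..} (fst x) * ennreal (Ds_weight s (fst x) (snd x)) * f x \<partial>lborel)"
  unfolding Ds_measure_def by (subst nn_integral_density) auto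

lemma deriv_continuous_on_rhp: "f holomorphic_on rhp \<Longrightarrow> continuous_on rhp (deriv f)"
  by (intro holomorphic_on_imp_continuous_on holomorphic_deriv open_rhp)

lemma Ds_integral_eq:
  assumes "f holomorphic_on rhp"
  shows "Ds_integral s f = (\<integral>\<^sup>+x. norm (on_rhp (deriv f) x) \<partial>Ds_measure s)"
proof -
  note [measurable] = on_rhp_measurable[OF deriv_continuous_on_rhp[OF assms]]
  have "(\<integral>\<^sup>+x. norm (on_rhp (deriv f) x) \<partial>Ds_measure s) =
      (\<integral>\<^sup>+a. \<integral>\<^sup>+b. indicator {0<..} a * ennreal (Ds_weight s a b) * norm (on_rhp (deriv f) (a, b))
        \<partial>lborel \<partial>lborel)"
    by (subst nn_integral_Ds_measure, measurable, subst nn_integral_lborel_pair) simp_all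
  also have "\<dots> = Ds_integral s f"
    unfolding Ds_integral_def
  proof (rule nn_integral_cong)
    fix a :: real
    show "(\<integral>\<^sup>+b. indicator {0<..} a * ennreal (Ds_weight s a b) * norm (on_rhp (deriv f) (a, b)) \<partial>lborel) =
      indicator {0<..} a * (\<integral>\<^sup>+b. ennreal (a powr s * norm (deriv f (Complex a b))
                          / (a\<^sup>2 + b\<^sup>2) powr ((s + 1) / 2)) \<partial>lborel)"
      by (cases "0 < a") (auto simp: on_rhp_def Ds_weight_def ennreal_mult'[symmetric] mult_ac
          intro!: nn_integral_cong)
  qed
  finally show ?thesis ..
qed

section \<open>Integrability of |1 + z|^-2 against the weight\<close>

lemma power2_powr_half: "0 < x \<Longrightarrow> (x\<^sup>2) powr (c / 2) = x powr c" for x c :: real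
  by (simp add: powr_powr flip: powr_numeral)

text \<open>Split |z|^(s+1) = |z|^(s+1-q) |z|^q and use |z| >= a in the first factor and |z| >= |b|
  in the second. For 0 < q < 1 both resulting powers are integrable at 0, although the weight itself
  is singular at the origin.\<close>

lemma Ds_weight_le_product:
  assumes "0 < a" "b \<noteq> 0" "0 < q" "q \<le> s + 1"
  shows "Ds_weight s a b \<le> a powr (q - 1) * \<bar>b\<bar> powr (- q)"
proof -
  have pos: "a\<^sup>2 + b\<^sup>2 > 0" using assms by (simp add: sum_power2_gt_zero_iff)
  have "a powr (s + 1 - q) = (a\<^sup>2) powr ((s + 1 - q) / 2)"
    using assms by (simp only: power2_powr_half)
  also have "\<dots> \<le> (a\<^sup>2 + b\<^sup>2) powr ((s + 1 - q) / 2)"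
    using assms by (intro powr_mono2) auto
  finally have 1: "a powr (s + 1 - q) \<le> (a\<^sup>2 + b\<^sup>2) powr ((s + 1 - q) / 2)" .
  have "\<bar>b\<bar> powr q = (\<bar>b\<bar>\<^sup>2) powr (q / 2)"
    using power2_powr_half[of "\<bar>b\<bar>" q] assms by (simp del: power2_abs)
  also have "\<dots> \<le> (a\<^sup>2 + b\<^sup>2) powr (q / 2)"
    using assms by (intro powr_mono2) auto
  finally have 2: "\<bar>b\<bar> powr q \<le> (a\<^sup>2 + b\<^sup>2) powr (q / 2)" .
  have "a powr (s + 1 - q) * \<bar>b\<bar> powr q \<le> (a\<^sup>2 + b\<^sup>2) powr ((s + 1 - q) / 2) * (a\<^sup>2 + b\<^sup>2) powr (q / 2)"
    using 1 2 by (intro mult_mono) auto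
  also have "\<dots> = (a\<^sup>2 + b\<^sup>2) powr ((s + 1) / 2)"
    unfolding powr_add[symmetric] by (simp add: diff_divide_distrib)
  finally have "Ds_weight s a b \<le> a powr s / (a powr (s + 1 - q) * \<bar>b\<bar> powr q)"
    unfolding Ds_weight_def using assms pos by (intro divide_left_mono mult_pos_pos) auto
  also have "\<dots> = a powr s / a powr (s + 1 - q) * (1 / \<bar>b\<bar> powr q)"
    by simp
  also have "\<dots> = a powr (q - 1) * \<bar>b\<bar> powr (- q)"
    using assms by (simp add: powr_diff[symmetric] powr_minus_divide)
  finally show ?thesis .
qed

text \<open>Tonelli for a majorant with separated variables. The majorant is required only off the
  null line b = 0, where a bound containing |b| powr (- q) would fail because
  \<open>0 powr x = 0\<close>.\<close>

lemma nn_integral_Ds_measure_le_product: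
  fixes F G :: "real \<Rightarrow> real"
  assumes [measurable]: "F \<in> borel_measurable borel" "G \<in> borel_measurable borel"
    "H \<in> borel_measurable borel"
  assumes nonneg: "\<And>a. 0 \<le> F a" "\<And>b. 0 \<le> G b"
  assumes le: "\<And>a b. 0 < a \<Longrightarrow> b \<noteq> 0 \<Longrightarrow> Ds_weight s a b * H (a, b) \<le> F a * G b"
  shows "(\<integral>\<^sup>+x. ennreal (H x) \<partial>Ds_measure s)
    \<le> (\<integral>\<^sup>+a. indicator {0<..} a * ennreal (F a) \<partial>lborel) * (\<integral>\<^sup>+b. ennreal (G b) \<partial>lborel)"
proof -
  have "(\<integral>\<^sup>+x. ennreal (H x) \<partial>Ds_measure s) =
      (\<integral>\<^sup>+a. \<integral>\<^sup>+b. indicator {0<..} a * ennreal (Ds_weight s a b) * ennreal (H (a, b)) \<partial>lborel \<partial>lborel)"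
    by (subst nn_integral_Ds_measure, measurable, subst nn_integral_lborel_pair) simp_all
  also have "\<dots> \<le> (\<integral>\<^sup>+a. indicator {0<..} a * ennreal (F a) * (\<integral>\<^sup>+b. ennreal (G b) \<partial>lborel) \<partial>lborel)"
  proof (rule nn_integral_mono)
    fix a :: real
    have "AE b in lborel. indicator {0<..} a * ennreal (Ds_weight s a b) * ennreal (H (a, b))
        \<le> indicator {0<..} a * ennreal (F a) * ennreal (G b)"
      using AE_lborel_singleton[of 0]
      by eventually_elim (use le nonneg in \<open>auto simp: indicator_def ennreal_mult'[symmetric] intro!: ennreal_leI\<close>)
    then show "(\<integral>\<^sup>+b. indicator {0<..} a * ennreal (Ds_weight s a b) * ennreal (H (a, b)) \<partial>lborel)
        \<le> indicator {0<..} a * ennreal (F a) * (\<integral>\<^sup>+b. ennreal (G b) \<partial>lborel)"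
      by (subst nn_integral_cmult[symmetric]) (auto intro: nn_integral_mono_AE)
  qed
  also have "\<dots> = (\<integral>\<^sup>+a. indicator {0<..} a * ennreal (F a) \<partial>lborel) * (\<integral>\<^sup>+b. ennreal (G b) \<partial>lborel)"
    by (rule nn_integral_multc) measurable
  finally show ?thesis .
qed

lemma nn_integral_even_le:
  fixes f :: "real \<Rightarrow> ennreal"
  assumes [measurable]: "f \<in> borel_measurable borel"
  shows "(\<integral>\<^sup>+b. f \<bar>b\<bar> \<partial>lborel) \<le> 2 * (\<integral>\<^sup>+b. indicator {0..} b * f b \<partial>lborel)"
proof -
  let ?g = "\<lambda>b. indicator {0..} b * f b"
  have "(\<integral>\<^sup>+b. f \<bar>b\<bar> \<partial>lborel) \<le> (\<integral>\<^sup>+b. ?g b + ?g (- b) \<partial>lborel)"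
    by (intro nn_integral_mono) (auto simp: indicator_def abs_if)
  also have "\<dots> = (\<integral>\<^sup>+b. ?g b \<partial>lborel) + (\<integral>\<^sup>+b. ?g (- b) \<partial>lborel)"
    by (rule nn_integral_add) auto
  also have "(\<integral>\<^sup>+b. ?g (- b) \<partial>lborel) = (\<integral>\<^sup>+b. ?g b \<partial>lborel)"
    using nn_integral_real_affine[of ?g "-1" 0] by simp
  finally show ?thesis
    by (simp add: mult_2)
qed

lemma nn_integral_powr_from_0:
  assumes "0 < c" "0 \<le> d"
  shows "(\<integral>\<^sup>+x. indicator {0..d} x * ennreal (x powr (c - 1)) \<partial>lborel) = ennreal (d powr c / c)"
proof -
  have "((\<lambda>x. x powr (c - 1)) has_integral (d powr c / c)) {0..d}"
    using has_integral_powr_from_0[of "c - 1" d] assms by simp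
  then have "(\<integral>\<^sup>+x\<in>{0..d}. ennreal (x powr (c - 1)) \<partial>lborel) = ennreal (d powr c / c)"
    by (intro nn_integral_has_integral_lebesgue') auto
  then show ?thesis
    by (simp add: mult.commute)
qed


lemma nn_integral_powr_over_one_add_finite:
  assumes "0 < c" "c < (1::real)"
  shows "(\<integral>\<^sup>+x. indicator {0..} x * ennreal (x powr (c - 1) / (1 + x)) \<partial>lborel) < \<infinity>"
proof -
  have "((\<lambda>x. x powr (c - 2)) has_integral - (1 powr (c - 2 + 1)) / (c - 2 + 1)) {1..}"
    using assms by (intro has_integral_powr_to_inf) auto
  then have 1: "(\<integral>\<^sup>+x\<in>{1..}. ennreal (x powr (c - 2)) \<partial>lborel)
      = ennreal (- (1 powr (c - 2 + 1)) / (c - 2 + 1))"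
    by (intro nn_integral_has_integral_lebesgue') auto
  have "(\<integral>\<^sup>+x. indicator {0..} x * ennreal (x powr (c - 1) / (1 + x)) \<partial>lborel)
      \<le> (\<integral>\<^sup>+x. indicator {0..1} x * ennreal (x powr (c - 1)) +
            ennreal (x powr (c - 2)) * indicator {1..} x \<partial>lborel)"
  proof (rule nn_integral_mono)
    fix x :: real
    consider "x < 0" | "0 \<le> x" "x < 1" | "1 \<le> x" by linarith
    then show "indicator {0..} x * ennreal (x powr (c - 1) / (1 + x))
      \<le> indicator {0..1} x * ennreal (x powr (c - 1)) + ennreal (x powr (c - 2)) * indicator {1..} x"
    proof cases
      case 2
      then have "x powr (c - 1) / (1 + x) \<le> x powr (c - 1) / 1"
        by (intro divide_left_mono) auto
      then have "ennreal (x powr (c - 1) / (1 + x)) \<le> ennreal (x powr (c - 1))"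
        by (intro ennreal_leI) simp
      with 2 show ?thesis
        by (auto simp: indicator_def intro: order_trans)
    next
      case 3
      have "x powr (c - 1) / (1 + x) \<le> x powr (c - 1) / x"
        using 3 by (intro divide_left_mono) auto
      also have "\<dots> = x powr (c - 2)"
        using 3 powr_diff[of x "c - 1" 1] by simp
      finally show ?thesis
        using 3 by (intro add_increasing) (auto simp: indicator_def intro: ennreal_leI)
    qed (simp add: indicator_def)
  qed
  also have "\<dots> = (\<integral>\<^sup>+x. indicator {0..1} x * ennreal (x powr (c - 1)) \<partial>lborel)
      + (\<integral>\<^sup>+x\<in>{1..}. ennreal (x powr (c - 2)) \<partial>lborel)"
    by (rule nn_integral_add) auto
  also have "\<dots> < \<infinity>"
    unfolding 1 using nn_integral_powr_from_0[of c 1] assms by (simp add: less_top)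
  finally show ?thesis .
qed

text \<open>The bound 1 / |1 + z|^2 <= 2 / ((1 + a) (1 + |b|)) separates the variables. Together
  with the product bound for the weight it leaves the integrals of a^(q-1) / (1 + a) and |b|^-q / (1
  + |b|), which converge both at 0 and at infinity when 0 < q < 1.\<close>

lemma nn_integral_inverse_square_finite:
  assumes "s > -1"
  shows "(\<integral>\<^sup>+x. ennreal (1 / (norm (1 + Complex (fst x) (snd x)))\<^sup>2) \<partial>Ds_measure s) < \<infinity>"
proof -
  \<comment> \<open>The exponent must lie strictly between 0 and 1 and not exceed s + 1; such a q
    exists because s > -1.\<close>
  define q where "q = min (1/2) (s + 1)"
  have q: "0 < q" "q < 1" "q \<le> s + 1"
    using assms by (auto simp: q_def)
  \<comment> \<open>The absolute value keeps \<open>?F\<close> nonnegative on the whole line, as the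
    product estimate demands.\<close>
  let ?F = "\<lambda>a::real. a powr (q - 1) / (1 + \<bar>a\<bar>)"
  let ?G = "\<lambda>b::real. 2 * (\<bar>b\<bar> powr (- q) / (1 + \<bar>b\<bar>))"
  let ?H = "\<lambda>x::real \<times> real. 1 / (norm (1 + Complex (fst x) (snd x)))\<^sup>2"
  have nsq: "(norm (1 + Complex a b))\<^sup>2 = (1 + a)\<^sup>2 + b\<^sup>2" for a b
    by (simp add: cmod_power2)
  have "(\<integral>\<^sup>+x. ennreal (?H x) \<partial>Ds_measure s)
    \<le> (\<integral>\<^sup>+a. indicator {0<..} a * ennreal (?F a) \<partial>lborel) * (\<integral>\<^sup>+b. ennreal (?G b) \<partial>lborel)"
  proof (rule nn_integral_Ds_measure_le_product)
    show "?H \<in> borel_measurable borel"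
      unfolding nsq by measurable
    fix a b :: real assume ab: "0 < a" "b \<noteq> 0"
    have "(1 + a) * (1 + \<bar>b\<bar>) \<le> 2 * ((1 + a)\<^sup>2 + b\<^sup>2)"
    proof -
      have "0 \<le> ((1 + a) - \<bar>b\<bar>)\<^sup>2" by simp
      then have 1: "2 * ((1 + a) * \<bar>b\<bar>) \<le> (1 + a)\<^sup>2 + b\<^sup>2"
        by (simp add: power2_eq_square algebra_simps)
      have 2: "1 + a \<le> (1 + a)\<^sup>2"
        using ab by (simp add: power2_eq_square)
      have 3: "A + X \<le> 2 * P + 2 * Q" if "2 * X \<le> P + Q" "A \<le> P" "0 \<le> Q" "0 \<le> A" for A X P Q :: real
        using that by argo
      have "(1 + a) + (1 + a) * \<bar>b\<bar> \<le> 2 * (1 + a)\<^sup>2 + 2 * b\<^sup>2"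
        using ab by (intro 3[OF 1 2]) auto
      then show ?thesis
        by (simp add: distrib_left)
    qed
    then have "?H (a, b) \<le> 2 / ((1 + a) * (1 + \<bar>b\<bar>))"
      using ab by (simp add: nsq field_simps add_pos_nonneg)
    then have "Ds_weight s a b * ?H (a, b)
        \<le> (a powr (q - 1) * \<bar>b\<bar> powr (- q)) * (2 / ((1 + a) * (1 + \<bar>b\<bar>)))"
      using q ab by (intro mult_mono Ds_weight_le_product) auto
    also have "\<dots> = ?F a * ?G b"
      using ab by simp
    finally show "Ds_weight s a b * ?H (a, b) \<le> ?F a * ?G b" .
  qed auto
  also have "\<dots> < \<infinity>"
  proof -
    have "(\<integral>\<^sup>+a. indicator {0<..} a * ennreal (?F a) \<partial>lborel)
        \<le> (\<integral>\<^sup>+x. indicator {0..} x * ennreal (x powr (q - 1) / (1 + x)) \<partial>lborel)"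
      by (intro nn_integral_mono) (auto simp: indicator_def)
    also have "\<dots> < \<infinity>"
      using q by (intro nn_integral_powr_over_one_add_finite) auto
    finally have 1: "(\<integral>\<^sup>+a. indicator {0<..} a * ennreal (?F a) \<partial>lborel) < \<infinity>" .
    have "(\<integral>\<^sup>+b. ennreal (\<bar>b\<bar> powr (- q) / (1 + \<bar>b\<bar>)) \<partial>lborel)
        \<le> 2 * (\<integral>\<^sup>+x. indicator {0..} x * ennreal (x powr (- q) / (1 + x)) \<partial>lborel)"
      by (rule nn_integral_even_le) measurable
    also have "\<dots> < \<infinity>"
      using nn_integral_powr_over_one_add_finite[of "1 - q"] q by (simp add: ennreal_mult_less_top)
    finally have "(\<integral>\<^sup>+b. ennreal (?G b) \<partial>lborel) < \<infinity>"
      by (subst ennreal_mult'[of 2]) (simp_all add: nn_integral_cmult ennreal_mult_less_top)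
    with 1 show ?thesis
      by (simp add: ennreal_mult_less_top)
  qed
  finally show ?thesis .
qed

text \<open>The passage from the weighted sup norm to L^1(\<mu>): the integral on the right is
  finite, so a uniform error C costs a fixed multiple of C in the seminorm.\<close>

lemma nn_integral_on_rhp_le:
  assumes "\<And>z. z \<in> rhp \<Longrightarrow> norm (g z) * (norm (1 + z))\<^sup>2 \<le> C"
  shows "(\<integral>\<^sup>+x. norm (on_rhp g x) \<partial>Ds_measure s)
    \<le> ennreal C * (\<integral>\<^sup>+x. ennreal (1 / (norm (1 + Complex (fst x) (snd x)))\<^sup>2) \<partial>Ds_measure s)"
proof -
  \<comment> \<open>Evaluation at one point of the half-plane shows C >= 0, so that
    \<open>ennreal C\<close> does not truncate.\<close>
  have "norm (g 1) * (norm (1 + 1 :: complex))\<^sup>2 \<le> C"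
    by (rule assms) (simp add: rhp_def)
  then have C: "0 \<le> C"
    by (rule order_trans[rotated]) simp
  have [measurable]: "(\<lambda>x::real \<times> real. 1 / (norm (1 + Complex (fst x) (snd x)))\<^sup>2) \<in> borel_measurable borel"
    unfolding cmod_power2 by simp
  have "(\<integral>\<^sup>+x. norm (on_rhp g x) \<partial>Ds_measure s)
      \<le> (\<integral>\<^sup>+x. ennreal C * ennreal (1 / (norm (1 + Complex (fst x) (snd x)))\<^sup>2) \<partial>Ds_measure s)"
  proof (rule nn_integral_mono)
    fix x :: "real \<times> real"
    show "ennreal (norm (on_rhp g x)) \<le> ennreal C * ennreal (1 / (norm (1 + Complex (fst x) (snd x)))\<^sup>2)"
    proof (cases "0 < fst x")
      case True
      define z where "z = Complex (fst x) (snd x)"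
      have z: "z \<in> rhp" using True by (simp add: z_def rhp_def)
      then have "norm (g z) \<le> C * (1 / (norm (1 + z))\<^sup>2)"
        using assms[OF z] rhp_one_add_nonzero[OF z] by (simp add: field_simps)
      then show ?thesis
        using True C by (simp add: on_rhp_def z_def ennreal_mult'[symmetric] ennreal_leI)
    qed (simp add: on_rhp_def)
  qed
  then show ?thesis
    by (simp add: nn_integral_cmult)
qed

text \<open>Each pole contributes - a_k / (lam_k + z)^2, and |1 + z| / |lam_k + z| <= 1 + |1 -
  lam_k| / Re lam_k because |lam_k + z| >= Re lam_k on the half-plane.\<close>

lemma Rtilde_deriv_bound:
  assumes "r \<in> Rtilde"
  obtains C where "\<And>z. z \<in> rhp \<Longrightarrow> norm (deriv r z) * (norm (1 + z))\<^sup>2 \<le> C"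
proof -
  obtain a0 n a lam where r: "r = (\<lambda>z. a0 + (\<Sum>k<(n::nat). a k / (lam k + z)))"
    and lam: "\<And>k. k < n \<Longrightarrow> lam k \<in> rhp"
    using RtildeE[OF assms] by metis
  define B where "B k = 1 + norm (1 - lam k) / Re (lam k)" for k
  have "norm (deriv r z) * (norm (1 + z))\<^sup>2 \<le> (\<Sum>k<n. norm (a k) * (B k)\<^sup>2)" if z: "z \<in> rhp" for z
  proof -
    have "(r has_field_derivative (\<Sum>k<n. - a k / (lam k + z)\<^sup>2)) (at z)"
      unfolding r using rhp_add_nonzero[OF lam z]
      by (auto intro!: derivative_eq_intros sum.cong simp: power2_eq_square)
    then have "deriv r z = (\<Sum>k<n. - a k / (lam k + z)\<^sup>2)"
      by (rule DERIV_imp_deriv)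
    then have "norm (deriv r z) \<le> (\<Sum>k<n. norm (- a k / (lam k + z)\<^sup>2))"
      by (simp only: norm_sum)
    then have "norm (deriv r z) * (norm (1 + z))\<^sup>2
        \<le> (\<Sum>k<n. norm (- a k / (lam k + z)\<^sup>2)) * (norm (1 + z))\<^sup>2"
      by (rule mult_right_mono) simp
    also have "\<dots> \<le> (\<Sum>k<n. norm (a k) * (B k)\<^sup>2)"
      unfolding sum_distrib_right
    proof (rule sum_mono)
      fix k assume "k \<in> {..<n}"
      then have k: "lam k \<in> rhp" by (simp add: lam)
      have Re: "0 < Re (lam k)" "Re (lam k) \<le> norm (lam k + z)"
        using k z complex_Re_le_cmod[of "lam k + z"] by (auto simp: rhp_def)
      have "norm (1 + z) \<le> norm (lam k + z) + norm (1 - lam k)"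
        using norm_triangle_ineq[of "lam k + z" "1 - lam k"] by (simp add: add.commute)
      also have "norm (1 - lam k) = Re (lam k) * (norm (1 - lam k) / Re (lam k))"
        using Re by simp
      also have "\<dots> \<le> norm (lam k + z) * (norm (1 - lam k) / Re (lam k))"
        using Re by (intro mult_right_mono) auto
      finally have "norm (1 + z) \<le> norm (lam k + z) * B k"
        by (simp add: B_def algebra_simps)
      then have "(norm (1 + z))\<^sup>2 \<le> (norm (lam k + z) * B k)\<^sup>2"
        by (intro power_mono) auto
      then have "norm (a k) * (norm (1 + z))\<^sup>2 \<le> norm (a k) * (norm (lam k + z) * B k)\<^sup>2"
        by (rule mult_left_mono) simp
      moreover have "0 < norm (lam k + z)" using Re by linarith
      ultimately show "norm (- a k / (lam k + z)\<^sup>2) * (norm (1 + z))\<^sup>2 \<le> norm (a k) * (B k)\<^sup>2"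
        by (simp add: norm_divide norm_power power_mult_distrib pos_divide_le_eq mult_ac)
    qed
    finally show ?thesis .
  qed
  then show thesis by (rule that)
qed

lemma Rtilde_subset_Ds:
  assumes "s > -1"
  shows "Rtilde \<subseteq> Ds s"
proof
  fix r assume r: "r \<in> Rtilde"
  obtain C where C: "\<And>z. z \<in> rhp \<Longrightarrow> norm (deriv r z) * (norm (1 + z))\<^sup>2 \<le> C"
    using Rtilde_deriv_bound[OF r] by blast
  have "(\<integral>\<^sup>+x. norm (on_rhp (deriv r) x) \<partial>Ds_measure s) < \<infinity>"
    by (rule le_less_trans[OF nn_integral_on_rhp_le[OF C]])
      (use nn_integral_inverse_square_finite[OF assms] in \<open>auto simp: ennreal_mult_less_top\<close>)
  then show "r \<in> Ds s"
    using Rtilde_holomorphic[OF r] by (simp add: Ds_def Ds_integral_eq)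
qed


section \<open>Lower bounds for the weight and the measure of boxes at the boundary\<close>

lemma powr_ge_of_between:
  fixes c d t x s :: real
  assumes "0 < c" "0 < t" "c * t \<le> x" "x \<le> d * t"
  shows "min (c powr s) (d powr s) * t powr s \<le> x powr s"
proof -
  have pos: "0 < c * t" "0 < x" "0 < d * t"
    using assms mult_pos_pos[of c t] by linarith+
  then have d: "0 < d"
    using assms by (simp add: zero_less_mult_iff)
  show ?thesis
  \<comment> \<open>Both signs of s occur, and x powr s increases in one case and decreases in the
    other; the minimum over the two ends covers both.\<close>
  proof (cases "0 \<le> s")
    case True
    have "min (c powr s) (d powr s) * t powr s \<le> c powr s * t powr s"
      by (intro mult_right_mono) auto
    also have "\<dots> = (c * t) powr s"
      using assms by (simp add: powr_mult)
    also have "\<dots> \<le> x powr s"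
      using assms pos True by (intro powr_mono2) auto
    finally show ?thesis .
  next
    case False
    have "min (c powr s) (d powr s) * t powr s \<le> d powr s * t powr s"
      by (intro mult_right_mono) auto
    also have "\<dots> = (d * t) powr s"
      using assms d by (simp add: powr_mult)
    also have "\<dots> \<le> x powr s"
      using assms pos False by (intro powr_mono2') auto
    finally show ?thesis .
  qed
qed

text \<open>The denominator is at most R^(s+1) since s + 1 > 0. The numerator is left to a free
  lower bound \<open>m\<close>, because the monotonicity of a^s depends on the sign of s.\<close>

lemma Ds_weight_ge:
  assumes "s > -1" "0 \<le> m" "m \<le> a powr s" "a\<^sup>2 + b\<^sup>2 \<le> R\<^sup>2" "0 < R" "0 < a"
  shows "m * R powr (- (s + 1)) \<le> Ds_weight s a b"
proof -
  have "(a\<^sup>2 + b\<^sup>2) powr ((s + 1) / 2) \<le> (R\<^sup>2) powr ((s + 1) / 2)"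
    using assms by (intro powr_mono2) auto
  also have "\<dots> = R powr (s + 1)"
    using assms by (simp only: power2_powr_half)
  finally have "m / R powr (s + 1) \<le> Ds_weight s a b"
    unfolding Ds_weight_def using assms by (intro frac_le) (auto simp: sum_power2_gt_zero_iff)
  then show ?thesis
    unfolding powr_minus_divide by simp
qed

text \<open>The weight is unbounded on a box that touches the axis, but its total mass is no larger
  than area times the weight at a point (x, y) whose distance x from the axis is comparable to the
  size t of the box. This is the estimate that replaces pointwise comparison of weights in the strip
  near the axis.\<close>

lemma Ds_measure_box_le:
  assumes "s > -1"
  obtains C where "\<And>t x y. 0 < t \<Longrightarrow> t / 4 \<le> x \<Longrightarrow> x \<le> 5 * t / 2 \<Longrightarrow>
    emeasure (Ds_measure s) ({0<..<t} \<times> {y - t/2..y + t/2}) \<le> ennreal (C * t\<^sup>2 * Ds_weight s x y)"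
    "0 \<le> C"
proof -
  define q where "q = min (1/2) (s + 1)"
  have q: "0 < q" "q < 1" "q \<le> s + 1"
    using assms by (auto simp: q_def)
  define m where "m = min ((1/4) powr s) ((5/2) powr s)"
  have m: "0 < m" by (simp add: m_def)
  \<comment> \<open>Both constants are fitted so that the lower bound m t^s R^-(s+1) for the weight
    at (x, y), with R = 3 |y| or R = 3 t, reproduces exactly the upper bound found for the box. The
    6 is the quotient of 3 |y| and |y| / 2.\<close>
  define C1 where "C1 = 6 powr (s + 1) / (m * (s + 1))"
  define C2 where "C2 = 2 * 2 powr (1 - q) * 3 powr (s + 1) / (m * q * (1 - q))"
  have C: "0 \<le> C1" "0 \<le> C2"
    using assms m q by (auto simp: C1_def C2_def)
  have "emeasure (Ds_measure s) ({0<..<t} \<times> {y - t/2..y + t/2})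
      \<le> ennreal ((C1 + C2) * t\<^sup>2 * Ds_weight s x y)"
    if t: "0 < t" and x: "t / 4 \<le> x" "x \<le> 5 * t / 2" for t x y
  proof -
    have x0: "0 < x" using t x by linarith
    have mx: "m * t powr s \<le> x powr s"
      using powr_ge_of_between[of "1/4" t x "5/2" s] t x by (simp add: m_def)
    let ?Q = "{0<..<t} \<times> {y - t/2..y + t/2}"
    have [measurable]: "?Q \<in> sets borel"
      by (intro borel_Times) auto
    have em: "emeasure (Ds_measure s) ?Q = (\<integral>\<^sup>+x. ennreal (indicator ?Q x) \<partial>Ds_measure s)"
      by (subst nn_integral_indicator[symmetric]) (auto simp: ennreal_indicator)
    show ?thesis
    proof (cases "t \<le> \<bar>y\<bar>")
      case True
      \<comment> \<open>Box far from the origin relative to its size: |b| >= |y| / 2 on it, so the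
        denominator is bounded below by a constant and only a^s has to be integrated, which needs s
        > -1.\<close>
      let ?F = "\<lambda>a. indicator {0..t} a * a powr s"
      let ?G = "\<lambda>b. indicator {y - t/2..y + t/2} b * (\<bar>y\<bar> / 2) powr (- (s + 1))"
      have "emeasure (Ds_measure s) ?Q \<le> (\<integral>\<^sup>+a. indicator {0<..} a * ennreal (?F a) \<partial>lborel) *
          (\<integral>\<^sup>+b. ennreal (?G b) \<partial>lborel)"
        unfolding em
      proof (rule nn_integral_Ds_measure_le_product)
        fix a b :: real assume ab: "0 < a" "b \<noteq> 0"
        show "Ds_weight s a b * indicator ?Q (a, b) \<le> ?F a * ?G b"
        proof (cases "(a, b) \<in> ?Q")
          case inQ: True
          then have "\<bar>y\<bar> / 2 \<le> \<bar>b\<bar>"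
            using True by (auto simp: abs_if split: if_splits)
          then have "(\<bar>y\<bar> / 2)\<^sup>2 \<le> \<bar>b\<bar>\<^sup>2"
            by (intro power_mono) auto
          then have "(\<bar>y\<bar> / 2)\<^sup>2 \<le> a\<^sup>2 + b\<^sup>2"
            by (simp add: add_increasing)
          then have "((\<bar>y\<bar> / 2)\<^sup>2) powr ((s + 1) / 2) \<le> (a\<^sup>2 + b\<^sup>2) powr ((s + 1) / 2)"
            using assms by (intro powr_mono2) auto
          moreover have "((\<bar>y\<bar> / 2)\<^sup>2) powr ((s + 1) / 2) = (\<bar>y\<bar> / 2) powr (s + 1)"
            using True t by (intro power2_powr_half) auto
          ultimately have "Ds_weight s a b \<le> a powr s / (\<bar>y\<bar> / 2) powr (s + 1)"
            unfolding Ds_weight_def using True t ab by (intro divide_left_mono) (auto simp: sum_power2_gt_zero_iff)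
          then show ?thesis
            unfolding powr_minus_divide using inQ by (auto simp: indicator_def)
        qed (auto simp: indicator_def)
      qed auto
      also have "(\<integral>\<^sup>+a. indicator {0<..} a * ennreal (?F a) \<partial>lborel)
          \<le> (\<integral>\<^sup>+a. indicator {0..t} a * ennreal (a powr ((s + 1) - 1)) \<partial>lborel)"
        by (intro nn_integral_mono) (auto simp: indicator_def)
      also have "\<dots> = ennreal (t powr (s + 1) / (s + 1))"
        using assms t by (intro nn_integral_powr_from_0) auto
      also have "(\<integral>\<^sup>+b. ennreal (?G b) \<partial>lborel)
          = (\<integral>\<^sup>+b. ennreal ((\<bar>y\<bar> / 2) powr (- (s + 1))) * indicator {y - t/2..y + t/2} b \<partial>lborel)"
        by (intro nn_integral_cong) (auto simp: indicator_def)
      also have "\<dots> = ennreal ((\<bar>y\<bar> / 2) powr (- (s + 1)) * t)"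
        using t by (subst nn_integral_cmult_indicator) (auto simp: ennreal_mult')
      also have "ennreal (t powr (s + 1) / (s + 1)) * ennreal ((\<bar>y\<bar> / 2) powr (- (s + 1)) * t)
          = ennreal (t powr (s + 1) / (s + 1) * ((\<bar>y\<bar> / 2) powr (- (s + 1)) * t))"
        using assms t by (subst ennreal_mult) auto
      also have "\<dots> \<le> ennreal ((C1 + C2) * t\<^sup>2 * Ds_weight s x y)"
      proof (rule ennreal_leI)
        have "x\<^sup>2 \<le> (5/2 * \<bar>y\<bar>)\<^sup>2"
          using x x0 True by (intro power_mono) auto
        also have "\<dots> \<le> 8 * y\<^sup>2"
          by (simp add: power_mult_distrib power_divide)
        finally have "x\<^sup>2 + y\<^sup>2 \<le> (3 * \<bar>y\<bar>)\<^sup>2"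
          by (simp add: power_mult_distrib)
        then have "m * t powr s * (3 * \<bar>y\<bar>) powr (- (s + 1)) \<le> Ds_weight s x y"
          using mx m t True x0 assms by (intro Ds_weight_ge) auto
        then have "C1 * t\<^sup>2 * (m * t powr s * (3 * \<bar>y\<bar>) powr (- (s + 1))) \<le> C1 * t\<^sup>2 * Ds_weight s x y"
          using C by (intro mult_left_mono) auto
        also have "\<dots> \<le> (C1 + C2) * t\<^sup>2 * Ds_weight s x y"
          using C by (intro mult_right_mono) auto
        also have "C1 * t\<^sup>2 * (m * t powr s * (3 * \<bar>y\<bar>) powr (- (s + 1)))
            = t powr (s + 1) / (s + 1) * ((\<bar>y\<bar> / 2) powr (- (s + 1)) * t)"
        proof -
          have "6 powr (s + 1) * (3 * \<bar>y\<bar>) powr (- (s + 1)) = (\<bar>y\<bar> / 2) powr (- (s + 1))"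
          proof -
            have "(3 * \<bar>y\<bar>) powr (- (s + 1)) = (6 * (\<bar>y\<bar> / 2)) powr (- (s + 1))"
              by simp
            also have "\<dots> = 6 powr (- (s + 1)) * (\<bar>y\<bar> / 2) powr (- (s + 1))"
              by (subst powr_mult) auto
            finally have "(3 * \<bar>y\<bar>) powr (- (s + 1)) = 6 powr (- (s + 1)) * (\<bar>y\<bar> / 2) powr (- (s + 1))" .
            moreover have "6 powr (s + 1) * 6 powr (- (s + 1)) = (1::real)"
              unfolding powr_add[symmetric] by simp
            ultimately show ?thesis
              by (metis mult.assoc mult_1)
          qed
          then have "C1 * t\<^sup>2 * (m * t powr s * (3 * \<bar>y\<bar>) powr (- (s + 1)))
              = (t\<^sup>2 * t powr s) / (s + 1) * (\<bar>y\<bar> / 2) powr (- (s + 1))"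
            using m by (simp add: C1_def mult_ac)
          also have "t\<^sup>2 * t powr s = t powr (s + 1) * t"
            using t by (simp add: powr_add power2_eq_square)
          finally show ?thesis by simp
        qed
        finally show "t powr (s + 1) / (s + 1) * ((\<bar>y\<bar> / 2) powr (- (s + 1)) * t)
          \<le> (C1 + C2) * t\<^sup>2 * Ds_weight s x y" .
      qed
      finally show ?thesis
        by (simp only: mult_right_mono zero_le)
    next
      case False
      \<comment> \<open>Box near the origin: it lies in |b| <= 2 t, and the product bound gives mass
        at most a constant times t^q t^(1-q) = t. The weight at (x, y) is at least a constant times
        1 / t, so t^2 times it is of the same order.\<close>
      let ?F = "\<lambda>a. indicator {0..t} a * a powr (q - 1)"
      let ?G = "\<lambda>b. indicator {0..2 * t} \<bar>b\<bar> * \<bar>b\<bar> powr (- q)"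
      have "emeasure (Ds_measure s) ?Q \<le> (\<integral>\<^sup>+a. indicator {0<..} a * ennreal (?F a) \<partial>lborel) *
          (\<integral>\<^sup>+b. ennreal (?G b) \<partial>lborel)"
        unfolding em
      proof (rule nn_integral_Ds_measure_le_product)
        fix a b :: real assume ab: "0 < a" "b \<noteq> 0"
        show "Ds_weight s a b * indicator ?Q (a, b) \<le> ?F a * ?G b"
        proof (cases "(a, b) \<in> ?Q")
          case inQ: True
          then have "\<bar>b\<bar> \<le> 2 * t" "a \<le> t"
            using False by auto
          then show ?thesis
            using Ds_weight_le_product[OF ab q(1,3)] ab inQ by simp
        qed (auto simp: indicator_def)
      qed auto
      also have "(\<integral>\<^sup>+a. indicator {0<..} a * ennreal (?F a) \<partial>lborel)
          \<le> (\<integral>\<^sup>+a. indicator {0..t} a * ennreal (a powr (q - 1)) \<partial>lborel)"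
        by (intro nn_integral_mono) (auto simp: indicator_def)
      also have "\<dots> = ennreal (t powr q / q)"
        using q t by (intro nn_integral_powr_from_0) auto
      also have "(\<integral>\<^sup>+b. ennreal (?G b) \<partial>lborel)
          \<le> 2 * (\<integral>\<^sup>+b. indicator {0..} b * ennreal (indicator {0..2 * t} b * b powr (- q)) \<partial>lborel)"
        by (rule nn_integral_even_le) measurable
      also have "(\<integral>\<^sup>+b. indicator {0..} b * ennreal (indicator {0..2 * t} b * b powr (- q)) \<partial>lborel)
          = (\<integral>\<^sup>+b. indicator {0..2 * t} b * ennreal (b powr ((1 - q) - 1)) \<partial>lborel)"
        by (intro nn_integral_cong) (auto simp: indicator_def)
      also have "\<dots> = ennreal ((2 * t) powr (1 - q) / (1 - q))"
        using q t by (intro nn_integral_powr_from_0) auto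
      also have "ennreal (t powr q / q) * (2 * ennreal ((2 * t) powr (1 - q) / (1 - q)))
          = ennreal (t powr q / q * (2 * ((2 * t) powr (1 - q) / (1 - q))))"
        using q by (subst ennreal_mult, simp, simp, subst ennreal_mult[of 2]) simp_all
      also have "\<dots> \<le> ennreal ((C1 + C2) * t\<^sup>2 * Ds_weight s x y)"
      proof (rule ennreal_leI)
        have "x\<^sup>2 \<le> (5/2 * t)\<^sup>2"
          using x x0 by (intro power_mono) auto
        also have "\<dots> \<le> 8 * t\<^sup>2"
          by (simp add: power_mult_distrib power_divide)
        finally have "x\<^sup>2 + y\<^sup>2 \<le> (3 * t)\<^sup>2"
          using False power_mono[of "\<bar>y\<bar>" t 2] by (simp add: power_mult_distrib)
        then have "m * t powr s * (3 * t) powr (- (s + 1)) \<le> Ds_weight s x y"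
          using mx m t x0 assms by (intro Ds_weight_ge) auto
        then have "C2 * t\<^sup>2 * (m * t powr s * (3 * t) powr (- (s + 1))) \<le> C2 * t\<^sup>2 * Ds_weight s x y"
          using C by (intro mult_left_mono) auto
        also have "\<dots> \<le> (C1 + C2) * t\<^sup>2 * Ds_weight s x y"
          using C by (intro mult_right_mono) auto
        also have "C2 * t\<^sup>2 * (m * t powr s * (3 * t) powr (- (s + 1)))
            = t powr q / q * (2 * ((2 * t) powr (1 - q) / (1 - q)))"
        proof -
          have A: "t\<^sup>2 * (t powr s * t powr (- (s + 1))) = t"
            using t unfolding powr_add[symmetric] by (simp add: powr_minus_divide power2_eq_square)
          have B: "t powr q * t powr (1 - q) = t"
            using t unfolding powr_add[symmetric] by simp
          have D: "3 powr (s + 1) * 3 powr (- (s + 1)) = (1::real)"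
            unfolding powr_add[symmetric] by simp
          have "C2 * t\<^sup>2 * (m * t powr s * (3 * t) powr (- (s + 1))) =
             (C2 * m) * 3 powr (- (s + 1)) * (t\<^sup>2 * (t powr s * t powr (- (s + 1))))"
            using t by (simp add: powr_mult mult_ac)
          also have "C2 * m = 2 * 2 powr (1 - q) * 3 powr (s + 1) / (q * (1 - q))"
            using m by (simp add: C2_def)
          also have "\<dots> * 3 powr (- (s + 1)) =
              2 * 2 powr (1 - q) / (q * (1 - q)) * (3 powr (s + 1) * 3 powr (- (s + 1)))"
            by simp
          also have "\<dots> * (t\<^sup>2 * (t powr s * t powr (- (s + 1)))) = 
             2 * 2 powr (1 - q) / (q * (1 - q)) * (t powr q * t powr (1 - q))"
            unfolding A B D by simp
          also have "\<dots> = t powr q / q * (2 * ((2 * t) powr (1 - q) / (1 - q)))"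
            using t by (simp add: powr_mult mult_ac)
          finally show ?thesis .
        qed
        finally show "t powr q / q * (2 * ((2 * t) powr (1 - q) / (1 - q)))
          \<le> (C1 + C2) * t\<^sup>2 * Ds_weight s x y" .
      qed
      finally show ?thesis
        by (simp only: mult_right_mono mult_left_mono zero_le)
    qed
  qed
  with C show thesis
    by (intro that[of "C1 + C2"]) auto
qed

section \<open>The sub-mean value property on squares\<close>

lemma nn_integral_lborel_pair_swap:
  fixes f :: "real \<times> real \<Rightarrow> ennreal"
  assumes [measurable]: "f \<in> borel_measurable borel"
  shows "(\<integral>\<^sup>+x. f x \<partial>lborel) = (\<integral>\<^sup>+b. \<integral>\<^sup>+a. f (a, b) \<partial>lborel \<partial>lborel)"
proof -
  have "f \<in> borel_measurable (lborel \<Otimes>\<^sub>M lborel)"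
    by (simp add: lborel_prod)
  then show ?thesis
    using lborel_pair.nn_integral_snd[of f] by (simp add: lborel_prod)
qed

text \<open>Parametrization by arc length, with the gauge integral replaced by a Lebesgue integral
  on the line. In this form the bounds for the four sides of a square can be integrated once more by
  Tonelli.\<close>

lemma norm_contour_integral_linepath_le:
  fixes p e :: complex and L :: real and k :: "real \<Rightarrow> real"
  assumes cont: "continuous_on (closed_segment p (p + L * e)) F"
    and L: "0 < L" and e: "norm e = 1"
    and [measurable]: "k \<in> borel_measurable borel"
    and k: "\<And>a. 0 \<le> a \<Longrightarrow> a \<le> L \<Longrightarrow> norm (F (p + a * e)) \<le> k a"
  shows "ennreal (norm (contour_integral (linepath p (p + L * e)) F))
    \<le> (\<integral>\<^sup>+a. indicator {0..L} a * ennreal (k a) \<partial>lborel)"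
proof -
  let ?q = "p + L * e"
  have lp: "linepath p ?q x = p + complex_of_real (L * x) * e" for x
    by (simp add: linepath_def scaleR_conv_of_real algebra_simps)
  have contl: "continuous_on {0..1} (\<lambda>x. F (linepath p ?q x))"
    by (intro continuous_on_compose2[OF cont] continuous_intros)
      (auto simp: linepath_image_01[symmetric])
  have ci: "contour_integral (linepath p ?q) F = integral {0..1} (\<lambda>x. F (linepath p ?q x) * (?q - p))"
    by (simp add: contour_integral_integral)
  have "(\<lambda>x. norm (F (linepath p ?q x)) * L) integrable_on {0..1}"
    by (intro integrable_continuous_interval continuous_intros contl)
  then have I: "((\<lambda>x. norm (F (linepath p ?q x)) * L) has_integral
      integral {0..1} (\<lambda>x. norm (F (linepath p ?q x)) * L)) {0..1}"
    by (rule integrable_integral)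
  have "norm (contour_integral (linepath p ?q) F) \<le> integral {0..1} (\<lambda>x. norm (F (linepath p ?q x)) * L)"
    unfolding ci
  proof (rule integral_norm_bound_integral)
    show "(\<lambda>x. F (linepath p ?q x) * (?q - p)) integrable_on {0..1}"
      by (intro integrable_continuous_interval continuous_intros contl)
    show "(\<lambda>x. norm (F (linepath p ?q x)) * L) integrable_on {0..1}" by fact
    show "norm (F (linepath p ?q x) * (?q - p)) \<le> norm (F (linepath p ?q x)) * L" for x
      using L e by (simp add: norm_mult)
  qed
  then have "ennreal (norm (contour_integral (linepath p ?q) F))
      \<le> ennreal (integral {0..1} (\<lambda>x. norm (F (linepath p ?q x)) * L))"
    by (rule ennreal_leI)
  also have "\<dots> = (\<integral>\<^sup>+x\<in>{0..1}. ennreal (norm (F (linepath p ?q x)) * L) \<partial>lborel)"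
    using L by (intro nn_integral_has_integral_lebesgue'[OF _ I, symmetric]) auto
  also have "\<dots> \<le> (\<integral>\<^sup>+x. ennreal L * (indicator {0..L} (L * x) * ennreal (k (L * x))) \<partial>lborel)"
  proof (rule nn_integral_mono)
    fix x :: real
    show "ennreal (norm (F (linepath p ?q x)) * L) * indicator {0..1} x
        \<le> ennreal L * (indicator {0..L} (L * x) * ennreal (k (L * x)))"
    proof (cases "0 \<le> x \<and> x \<le> 1")
      case True
      then have "0 \<le> L * x" "L * x \<le> L"
        using L by auto
      then have "norm (F (linepath p ?q x)) * L \<le> L * k (L * x)" "L * x \<in> {0..L}"
        using k[of "L * x"] L by (auto simp: lp)
      then show ?thesis
        using True L by (simp add: ennreal_mult'[symmetric] ennreal_leI)
    qed auto
  qed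
  also have "\<dots> = ennreal L * (\<integral>\<^sup>+x. indicator {0..L} (L * x) * ennreal (k (L * x)) \<partial>lborel)"
    by (rule nn_integral_cmult) measurable
  also have "\<dots> = (\<integral>\<^sup>+a. indicator {0..L} a * ennreal (k a) \<partial>lborel)"
    using nn_integral_real_affine[of "\<lambda>a. indicator {0..L} a * ennreal (k a)" L 0] L by simp
  finally show ?thesis .
qed

text \<open>Cauchy's formula on the boundary of the square of half-width t, where |w - z| >= t. A
  square rather than a circle keeps all integrals along coordinate lines.\<close>

lemma Cauchy_square_le:
  assumes hol: "g holomorphic_on rhp" and t: "0 < t" "t < x"
  shows "ennreal (2 * pi * norm (g (Complex x y))) \<le> ennreal (1 / t) *
    ((\<integral>\<^sup>+a. indicator {x - t..x + t} a * ennreal (norm (on_rhp g (a, y - t))) \<partial>lborel) +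
     (\<integral>\<^sup>+b. indicator {y - t..y + t} b * ennreal (norm (on_rhp g (x + t, b))) \<partial>lborel) +
     (\<integral>\<^sup>+a. indicator {x - t..x + t} a * ennreal (norm (on_rhp g (a, y + t))) \<partial>lborel) +
     (\<integral>\<^sup>+b. indicator {y - t..y + t} b * ennreal (norm (on_rhp g (x - t, b))) \<partial>lborel))"
proof -
  define z where "z = Complex x y"
  define F where "F w = g w / (w - z)" for w
  define a1 a2 a3 a4 where "a1 = Complex (x - t) (y - t)" "a2 = Complex (x + t) (y - t)"
    "a3 = Complex (x + t) (y + t)" "a4 = Complex (x - t) (y + t)"
  note as = this
  have rp: "rectpath a1 a3 = linepath a1 a2 +++ linepath a2 a3 +++ linepath a3 a4 +++ linepath a4 a1"
    by (simp add: rectpath_def as Let_def)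
  have z: "z \<in> box a1 a3"
    using t by (simp add: z_def as in_box_complex_iff)
  have img: "path_image (rectpath a1 a3) \<subseteq> rhp - {z}"
    using t by (subst path_image_rectpath) (auto simp: as rhp_def z_def)
  have "((\<lambda>w. g w / (w - z)) has_contour_integral
      (2 * pi * \<i> * winding_number (rectpath a1 a3) z * g z)) (rectpath a1 a3)"
    using t by (intro Cauchy_integral_formula_convex_simple[OF convex_rhp hol])
      (use img in \<open>auto simp: interior_open open_rhp, auto simp: z_def rhp_def\<close>)
  then have ci: "(F has_contour_integral (2 * pi * \<i> * g z)) (rectpath a1 a3)"
    using winding_number_rectpath[OF z] by (simp add: F_def[abs_def])
  have segs: "closed_segment a1 a2 \<subseteq> rhp - {z}" "closed_segment a2 a3 \<subseteq> rhp - {z}"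
    "closed_segment a4 a3 \<subseteq> rhp - {z}" "closed_segment a1 a4 \<subseteq> rhp - {z}"
    using img unfolding rp by (auto simp: path_image_join as closed_segment_commute)
  have contF: "continuous_on (rhp - {z}) F"
    unfolding F_def
    by (intro continuous_intros continuous_on_subset[OF holomorphic_on_imp_continuous_on[OF hol]]) auto
  note cs = continuous_on_subset[OF contF]
  have ints: "F contour_integrable_on linepath a1 a2" "F contour_integrable_on linepath a2 a3"
    "F contour_integrable_on linepath a3 a4" "F contour_integrable_on linepath a4 a1"
    using segs by (auto intro!: contour_integrable_continuous_linepath cs simp: closed_segment_commute)
  let ?I = "\<lambda>p q. contour_integral (linepath p q) F"
  have "2 * pi * \<i> * g z = contour_integral (rectpath a1 a3) F"
    using contour_integral_unique[OF ci] by simp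
  also have "\<dots> = ?I a1 a2 + (?I a2 a3 + (?I a3 a4 + ?I a4 a1))"
    unfolding rp using ints by (simp add: contour_integral_join valid_path_join contour_integrable_joinI)
  \<comment> \<open>Top and left side are reversed so that every side runs in the direction of its
    increasing coordinate; only the modulus of each integral matters.\<close>
  also have "?I a3 a4 = - ?I a4 a3"
    using segs by (intro contour_integral_reverse_linepath cs) (auto simp: closed_segment_commute)
  also have "?I a4 a1 = - ?I a1 a4"
    using segs by (intro contour_integral_reverse_linepath cs) (auto simp: closed_segment_commute)
  finally have eq: "2 * pi * \<i> * g z = ?I a1 a2 + (?I a2 a3 + (- ?I a4 a3 + - ?I a1 a4))" .
  have "2 * pi * norm (g z) = norm (2 * pi * \<i> * g z)"
    by (simp add: norm_mult)
  also have "\<dots> \<le> norm (?I a1 a2) + norm (?I a2 a3) + norm (?I a4 a3) + norm (?I a1 a4)"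
    unfolding eq by (smt (verit) norm_triangle_ineq norm_minus_cancel)
  finally have "ennreal (2 * pi * norm (g z)) \<le>
      ennreal (norm (?I a1 a2) + norm (?I a2 a3) + norm (?I a4 a3) + norm (?I a1 a4))"
    by (rule ennreal_leI)
  also have "\<dots> = ennreal (norm (?I a1 a2)) + ennreal (norm (?I a2 a3)) +
      ennreal (norm (?I a4 a3)) + ennreal (norm (?I a1 a4))"
    by simp
  finally have main: "ennreal (2 * pi * norm (g z)) \<le> ennreal (norm (?I a1 a2)) + ennreal (norm (?I a2 a3)) +
      ennreal (norm (?I a4 a3)) + ennreal (norm (?I a1 a4))" .
  have [measurable]: "on_rhp g \<in> borel_measurable borel"
    by (intro on_rhp_measurable holomorphic_on_imp_continuous_on hol)
  have Fle: "norm (F w) \<le> 1 / t * norm (on_rhp g (Re w, Im w))"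
    if "0 < Re w" "t \<le> \<bar>Re w - x\<bar> \<or> t \<le> \<bar>Im w - y\<bar>" for w
  proof -
    have "t \<le> norm (w - z)"
      using that(2) abs_Re_le_cmod[of "w - z"] abs_Im_le_cmod[of "w - z"] by (auto simp: z_def)
    then have "norm (F w) \<le> norm (g w) / t"
      unfolding F_def norm_divide using t by (intro divide_left_mono mult_pos_pos) auto
    then show ?thesis
      using that(1) by (simp add: on_rhp_def)
  qed
  have horiz: "ennreal (norm (?I (Complex (x - t) c) (Complex (x + t) c))) \<le> ennreal (1 / t) *
      (\<integral>\<^sup>+a. indicator {x - t..x + t} a * ennreal (norm (on_rhp g (a, c))) \<partial>lborel)"
    if c: "t \<le> \<bar>c - y\<bar>" and seg: "closed_segment (Complex (x - t) c) (Complex (x + t) c) \<subseteq> rhp - {z}" for c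
  proof -
    have q: "Complex (x + t) c = Complex (x - t) c + complex_of_real (2 * t) * 1"
      by (simp add: complex_eq_iff)
    have "ennreal (norm (?I (Complex (x - t) c) (Complex (x - t) c + complex_of_real (2 * t) * 1)))
      \<le> (\<integral>\<^sup>+a. indicator {0..2 * t} a * ennreal (1 / t * norm (on_rhp g (x - t + a, c))) \<partial>lborel)"
    proof (rule norm_contour_integral_linepath_le)
      show "continuous_on (closed_segment (Complex (x - t) c) (Complex (x - t) c + complex_of_real (2 * t) * 1)) F"
        using seg unfolding q by (rule cs)
      show "norm (F (Complex (x - t) c + complex_of_real a * 1)) \<le> 1 / t * norm (on_rhp g (x - t + a, c))"
        if "0 \<le> a" "a \<le> 2 * t" for a
        using Fle[of "Complex (x - t) c + complex_of_real a * 1"] that t c by simp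
    qed (use t in auto)
    also have "\<dots> = (\<integral>\<^sup>+a. ennreal (1 / t) * (indicator {x - t..x + t} (x - t + a) *
        ennreal (norm (on_rhp g (x - t + a, c)))) \<partial>lborel)"
      using t by (intro nn_integral_cong) (auto simp: indicator_def ennreal_mult'[symmetric])
    also have "\<dots> = ennreal (1 / t) * (\<integral>\<^sup>+a. indicator {x - t..x + t} (x - t + a) *
        ennreal (norm (on_rhp g (x - t + a, c))) \<partial>lborel)"
      by (rule nn_integral_cmult) measurable
    also have "(\<integral>\<^sup>+a. indicator {x - t..x + t} (x - t + a) * ennreal (norm (on_rhp g (x - t + a, c))) \<partial>lborel)
        = (\<integral>\<^sup>+a. indicator {x - t..x + t} a * ennreal (norm (on_rhp g (a, c))) \<partial>lborel)"
      using nn_integral_real_affine[of "\<lambda>a. indicator {x - t..x + t} a * ennreal (norm (on_rhp g (a, c)))" 1 "x - t"]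
      by simp
    finally show ?thesis unfolding q .
  qed
  have vert: "ennreal (norm (?I (Complex c (y - t)) (Complex c (y + t)))) \<le> ennreal (1 / t) *
      (\<integral>\<^sup>+b. indicator {y - t..y + t} b * ennreal (norm (on_rhp g (c, b))) \<partial>lborel)"
    if c: "t \<le> \<bar>c - x\<bar>" "0 < c" and seg: "closed_segment (Complex c (y - t)) (Complex c (y + t)) \<subseteq> rhp - {z}" for c
  proof -
    have q: "Complex c (y + t) = Complex c (y - t) + complex_of_real (2 * t) * \<i>"
      by (simp add: complex_eq_iff)
    have "ennreal (norm (?I (Complex c (y - t)) (Complex c (y - t) + complex_of_real (2 * t) * \<i>)))
      \<le> (\<integral>\<^sup>+b. indicator {0..2 * t} b * ennreal (1 / t * norm (on_rhp g (c, y - t + b))) \<partial>lborel)"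
    proof (rule norm_contour_integral_linepath_le)
      show "continuous_on (closed_segment (Complex c (y - t)) (Complex c (y - t) + complex_of_real (2 * t) * \<i>)) F"
        using seg unfolding q by (rule cs)
      show "norm (F (Complex c (y - t) + complex_of_real b * \<i>)) \<le> 1 / t * norm (on_rhp g (c, y - t + b))"
        if "0 \<le> b" "b \<le> 2 * t" for b
        using Fle[of "Complex c (y - t) + complex_of_real b * \<i>"] that t c by simp
    qed (use t in auto)
    also have "\<dots> = (\<integral>\<^sup>+b. ennreal (1 / t) * (indicator {y - t..y + t} (y - t + b) *
        ennreal (norm (on_rhp g (c, y - t + b)))) \<partial>lborel)"
      using t by (intro nn_integral_cong) (auto simp: indicator_def ennreal_mult'[symmetric])
    also have "\<dots> = ennreal (1 / t) * (\<integral>\<^sup>+b. indicator {y - t..y + t} (y - t + b) *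
        ennreal (norm (on_rhp g (c, y - t + b))) \<partial>lborel)"
      by (rule nn_integral_cmult) measurable
    also have "(\<integral>\<^sup>+b. indicator {y - t..y + t} (y - t + b) * ennreal (norm (on_rhp g (c, y - t + b))) \<partial>lborel)
        = (\<integral>\<^sup>+b. indicator {y - t..y + t} b * ennreal (norm (on_rhp g (c, b))) \<partial>lborel)"
      using nn_integral_real_affine[of "\<lambda>b. indicator {y - t..y + t} b * ennreal (norm (on_rhp g (c, b)))" 1 "y - t"]
      by simp
    finally show ?thesis unfolding q .
  qed
  note main
  also have "ennreal (norm (?I a1 a2)) + ennreal (norm (?I a2 a3)) +
      ennreal (norm (?I a4 a3)) + ennreal (norm (?I a1 a4)) \<le>
     ennreal (1 / t) * (\<integral>\<^sup>+a. indicator {x - t..x + t} a * ennreal (norm (on_rhp g (a, y - t))) \<partial>lborel) +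
     ennreal (1 / t) * (\<integral>\<^sup>+b. indicator {y - t..y + t} b * ennreal (norm (on_rhp g (x + t, b))) \<partial>lborel) +
     ennreal (1 / t) * (\<integral>\<^sup>+a. indicator {x - t..x + t} a * ennreal (norm (on_rhp g (a, y + t))) \<partial>lborel) +
     ennreal (1 / t) * (\<integral>\<^sup>+b. indicator {y - t..y + t} b * ennreal (norm (on_rhp g (x - t, b))) \<partial>lborel)"
    unfolding as by (intro add_mono horiz vert) (use segs t in \<open>auto simp: as\<close>)
  finally show ?thesis
    by (simp add: z_def distrib_left)
qed

text \<open>For c = 1 or c = -1 the substitution a = x + c t is injective and preserves length, so
  the moving side covers a part of the square once.\<close>

lemma nn_integral_strip_le:
  fixes h :: "real \<times> real \<Rightarrow> ennreal"
  assumes [measurable]: "h \<in> borel_measurable borel" and c: "\<bar>c\<bar> = 1" and "0 < \<rho>"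
  shows "(\<integral>\<^sup>+t. indicator {\<rho>/2..\<rho>} t * (\<integral>\<^sup>+b. indicator {y - \<rho>..y + \<rho>} b * h (x + c * t, b) \<partial>lborel) \<partial>lborel)
      \<le> (\<integral>\<^sup>+v. indicator ({x - \<rho>..x + \<rho>} \<times> {y - \<rho>..y + \<rho>}) v * h v \<partial>lborel)"
proof -
  have [measurable]: "{x - \<rho>..x + \<rho>} \<times> {y - \<rho>..y + \<rho>} \<in> sets borel"
    by (intro borel_Times) auto
  let ?k = "\<lambda>a. indicator {x - \<rho>..x + \<rho>} a * (\<integral>\<^sup>+b. indicator {y - \<rho>..y + \<rho>} b * h (a, b) \<partial>lborel)"
  have cc: "c = 1 \<or> c = -1" using c by auto
  have "(\<integral>\<^sup>+t. indicator {\<rho>/2..\<rho>} t * (\<integral>\<^sup>+b. indicator {y - \<rho>..y + \<rho>} b * h (x + c * t, b) \<partial>lborel) \<partial>lborel)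
      \<le> (\<integral>\<^sup>+t. ?k (x + c * t) \<partial>lborel)"
    using \<open>0 < \<rho>\<close> cc by (intro nn_integral_mono) (auto simp: indicator_def)
  also have "\<dots> = (\<integral>\<^sup>+a. ?k a \<partial>lborel)"
    using nn_integral_real_affine[of ?k c x] cc by auto
  also have "\<dots> = (\<integral>\<^sup>+a. \<integral>\<^sup>+b. indicator ({x - \<rho>..x + \<rho>} \<times> {y - \<rho>..y + \<rho>}) (a, b) * h (a, b) \<partial>lborel \<partial>lborel)"
    by (subst nn_integral_cmult[symmetric]) (auto simp: indicator_times mult_ac)
  also have "\<dots> = (\<integral>\<^sup>+v. indicator ({x - \<rho>..x + \<rho>} \<times> {y - \<rho>..y + \<rho>}) v * h v \<partial>lborel)"
    by (rule nn_integral_lborel_pair[symmetric]) measurable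
  finally show ?thesis .
qed


lemma nn_integral_strip_swap_le:
  fixes h :: "real \<times> real \<Rightarrow> ennreal"
  assumes [measurable]: "h \<in> borel_measurable borel" and c: "\<bar>c\<bar> = 1" and "0 < \<rho>"
  shows "(\<integral>\<^sup>+t. indicator {\<rho>/2..\<rho>} t * (\<integral>\<^sup>+a. indicator {x - \<rho>..x + \<rho>} a * h (a, y + c * t) \<partial>lborel) \<partial>lborel)
      \<le> (\<integral>\<^sup>+v. indicator ({x - \<rho>..x + \<rho>} \<times> {y - \<rho>..y + \<rho>}) v * h v \<partial>lborel)"
proof -
  have [measurable]: "{x - \<rho>..x + \<rho>} \<times> {y - \<rho>..y + \<rho>} \<in> sets borel"
    "{y - \<rho>..y + \<rho>} \<times> {x - \<rho>..x + \<rho>} \<in> sets borel"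
    by (auto intro!: borel_Times)
  have "(\<integral>\<^sup>+t. indicator {\<rho>/2..\<rho>} t * (\<integral>\<^sup>+a. indicator {x - \<rho>..x + \<rho>} a * h (a, y + c * t) \<partial>lborel) \<partial>lborel)
      \<le> (\<integral>\<^sup>+v. indicator ({y - \<rho>..y + \<rho>} \<times> {x - \<rho>..x + \<rho>}) v * h (snd v, fst v) \<partial>lborel)"
    using nn_integral_strip_le[of "\<lambda>v. h (snd v, fst v)" c \<rho> x y] c \<open>0 < \<rho>\<close> by simp
  also have "\<dots> = (\<integral>\<^sup>+b. \<integral>\<^sup>+a. indicator ({x - \<rho>..x + \<rho>} \<times> {y - \<rho>..y + \<rho>}) (a, b) * h (a, b) \<partial>lborel \<partial>lborel)"
    by (subst nn_integral_lborel_pair) (auto simp: indicator_times mult_ac)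
  also have "\<dots> = (\<integral>\<^sup>+v. indicator ({x - \<rho>..x + \<rho>} \<times> {y - \<rho>..y + \<rho>}) v * h v \<partial>lborel)"
    by (rule nn_integral_lborel_pair_swap[symmetric]) measurable
  finally show ?thesis .
qed

text \<open>The Cauchy formula on the boundary of the square of half-width \<open>t\<close>, averaged over
  \<open>\<rho> / 2 \<le> t \<le> \<rho>\<close>: each of the four sides then sweeps out a part of the square.\<close>

lemma submean_square:
  assumes hol: "g holomorphic_on rhp" and rho: "0 < \<rho>" "\<rho> < x"
  shows "ennreal (\<rho>\<^sup>2 * norm (g (Complex x y))) \<le>
    4 * (\<integral>\<^sup>+v. indicator ({x - \<rho>..x + \<rho>} \<times> {y - \<rho>..y + \<rho>}) v * ennreal (norm (on_rhp g v)) \<partial>lborel)"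
    (is "_ \<le> 4 * ?I")
proof -
  have [measurable]: "on_rhp g \<in> borel_measurable borel"
    by (intro on_rhp_measurable holomorphic_on_imp_continuous_on hol)
  define h where "h v = ennreal (norm (on_rhp g v))" for v
  have [measurable]: "h \<in> borel_measurable borel"
    unfolding h_def by measurable
  define A where "A = ennreal (2 * pi * norm (g (Complex x y)))"
  define V where "V c t = (\<integral>\<^sup>+b. indicator {y - \<rho>..y + \<rho>} b * h (x + c * t, b) \<partial>lborel)" for c t
  define H where "H c t = (\<integral>\<^sup>+a. indicator {x - \<rho>..x + \<rho>} a * h (a, y + c * t) \<partial>lborel)" for c t
  have [measurable]: "V c \<in> borel_measurable borel" "H c \<in> borel_measurable borel" for c
    unfolding V_def H_def by measurable
  let ?T = "indicator {\<rho>/2..\<rho>} :: real \<Rightarrow> ennreal"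
  \<comment> \<open>Lengthening the sides to half-width \<rho> and using 1 / t <= 2 / \<rho> leaves
    a bound that depends on t only through the position of the sides.\<close>
  have A: "A \<le> ennreal (2 / \<rho>) * (H (-1) t + V 1 t + H 1 t + V (-1) t)" if t: "t \<in> {\<rho>/2..\<rho>}" for t
  proof -
    have tt: "0 < t" "t < x" "t \<le> \<rho>" "\<rho> / 2 \<le> t" using t rho by auto
    have "A \<le> ennreal (1 / t) *
      ((\<integral>\<^sup>+a. indicator {x - t..x + t} a * ennreal (norm (on_rhp g (a, y - t))) \<partial>lborel) +
       (\<integral>\<^sup>+b. indicator {y - t..y + t} b * ennreal (norm (on_rhp g (x + t, b))) \<partial>lborel) +
       (\<integral>\<^sup>+a. indicator {x - t..x + t} a * ennreal (norm (on_rhp g (a, y + t))) \<partial>lborel) +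
       (\<integral>\<^sup>+b. indicator {y - t..y + t} b * ennreal (norm (on_rhp g (x - t, b))) \<partial>lborel))"
      unfolding A_def using tt by (intro Cauchy_square_le hol)
    also have "\<dots> \<le> ennreal (2 / \<rho>) * (H (-1) t + V 1 t + H 1 t + V (-1) t)"
    proof (intro mult_mono add_mono)
      show "ennreal (1 / t) \<le> ennreal (2 / \<rho>)"
        using tt rho by (intro ennreal_leI) (simp add: field_simps)
    qed (use tt in \<open>auto simp: H_def V_def h_def indicator_def intro!: nn_integral_mono\<close>)
    finally show ?thesis .
  qed
  have "A * ennreal (\<rho> / 2) = (\<integral>\<^sup>+t. A * ?T t \<partial>lborel)"
    using rho by (subst nn_integral_cmult_indicator) auto
  also have "\<dots> \<le> (\<integral>\<^sup>+t. ennreal (2 / \<rho>) * (?T t * H (-1) t + ?T t * V 1 t + ?T t * H 1 t + ?T t * V (-1) t) \<partial>lborel)"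
    using A by (intro nn_integral_mono) (auto simp: indicator_def)
  also have "\<dots> = ennreal (2 / \<rho>) * ((\<integral>\<^sup>+t. ?T t * H (-1) t \<partial>lborel) + (\<integral>\<^sup>+t. ?T t * V 1 t \<partial>lborel)
      + (\<integral>\<^sup>+t. ?T t * H 1 t \<partial>lborel) + (\<integral>\<^sup>+t. ?T t * V (-1) t \<partial>lborel))"
    by (simp add: nn_integral_cmult nn_integral_add)
  also have "\<dots> \<le> ennreal (2 / \<rho>) * (?I + ?I + ?I + ?I)"
    unfolding H_def V_def h_def[symmetric]
    by (intro mult_left_mono add_mono nn_integral_strip_le nn_integral_strip_swap_le) (use rho in auto)
  also have "?I + ?I + ?I + ?I = 4 * ?I"
    by (metis (no_types, lifting) add.assoc mult_2 numeral_Bit0 distrib_right numeral_One one_add_one)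
  finally have *: "A * ennreal (\<rho> / 2) \<le> ennreal (2 / \<rho>) * (4 * ?I)" .
  have "ennreal (\<rho>\<^sup>2 * norm (g (Complex x y))) = ennreal (\<rho> / pi) * (A * ennreal (\<rho> / 2))"
    unfolding A_def using rho by (simp add: ennreal_mult'[symmetric] ennreal_mult''[symmetric] power2_eq_square)
  also have "\<dots> \<le> ennreal (\<rho> / pi) * (ennreal (2 / \<rho>) * (4 * ?I))"
    using * by (rule mult_left_mono) simp
  also have "\<dots> = ennreal (2 / pi) * (4 * ?I)"
    using rho by (simp add: ennreal_mult'[symmetric] flip: mult.assoc)
  \<comment> \<open>The averaged inequality has the constant 8 / pi, which is at most 4.\<close>
  also have "\<dots> \<le> 1 * (4 * ?I)"
    using pi_ge_two by (intro mult_right_mono) auto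
  finally show ?thesis by simp
qed

section \<open>The limit at infinity\<close>

text \<open>A point of the square of half-width x / 2 around (x, y) has modulus at most 2 |(x, y)|,
  and its real part lies between x / 2 and 3 x / 2. Besides squares, this also covers a horizontal
  shift by at most x / 2, which is how translations away from the axis are compared.\<close>

lemma Ds_weight_comparable:
  assumes s: "s > -1" and x: "0 < x" and a: "x / 2 \<le> a" "a \<le> 3 * x / 2" and b: "\<bar>b - y\<bar> \<le> x / 2"
  shows "min ((1/2) powr s) ((3/2) powr s) * 2 powr (- (s + 1)) * Ds_weight s x y \<le> Ds_weight s a b"
proof -
  define R where "R = sqrt (x\<^sup>2 + y\<^sup>2)"
  have R: "0 < R" "R\<^sup>2 = x\<^sup>2 + y\<^sup>2"
    using x by (auto simp: R_def sum_power2_gt_zero_iff)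
  have "a\<^sup>2 \<le> (3 * x / 2)\<^sup>2"
    using x a by (intro power_mono) auto
  then have 1: "a\<^sup>2 \<le> 9 / 4 * x\<^sup>2"
    by (simp add: power_mult_distrib power_divide)
  have 2: "b\<^sup>2 \<le> 2 * y\<^sup>2 + x\<^sup>2 / 2"
  proof -
    have "(b - y)\<^sup>2 \<le> (x / 2)\<^sup>2"
      using power_mono[OF b, of 2] by simp
    moreover have "b\<^sup>2 \<le> 2 * y\<^sup>2 + 2 * (b - y)\<^sup>2"
      using zero_le_power2[of "b - 2 * y"] by (simp add: power2_eq_square algebra_simps)
    ultimately show ?thesis
      by (simp add: power_divide)
  qed
  have 3: "A + B \<le> 4 * X + 4 * Y"
    if "A \<le> 9 / 4 * X" "B \<le> 2 * Y + X / 2" "0 \<le> X" "0 \<le> Y" for A B X Y :: real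
    using that by argo
  have "a\<^sup>2 + b\<^sup>2 \<le> 4 * x\<^sup>2 + 4 * y\<^sup>2"
    by (rule 3[OF 1 2]) auto
  then have ab: "a\<^sup>2 + b\<^sup>2 \<le> (2 * R)\<^sup>2"
    by (simp add: power_mult_distrib R(2))
  have "min ((1/2) powr s) ((3/2) powr s) * x powr s \<le> a powr s"
    using x a by (intro powr_ge_of_between) auto
  then have "min ((1/2) powr s) ((3/2) powr s) * x powr s * (2 * R) powr (- (s + 1)) \<le> Ds_weight s a b"
    using s ab R x a by (intro Ds_weight_ge) auto
  moreover have "(2 * R) powr (- (s + 1)) = 2 powr (- (s + 1)) * R powr (- (s + 1))"
    by (rule powr_mult)
  moreover have "Ds_weight s x y = x powr s * R powr (- (s + 1))"
    unfolding Ds_weight_def R(2)[symmetric] power2_powr_half[OF R(1)] powr_minus_divide by simp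
  ultimately show ?thesis
    by (simp add: mult_ac)
qed

text \<open>The L^1(\<mu>)-mass of \<open>g\<close> on the vertical strip over \<open>A\<close>. It
  is a real number rather than an extended one so that the masses of two tails can be
  subtracted.\<close>

definition Ds_mass :: "real \<Rightarrow> (complex \<Rightarrow> complex) \<Rightarrow> real set \<Rightarrow> real" where
  "Ds_mass s g A = (\<integral>v. indicator (A \<times> UNIV) v * norm (on_rhp g v) \<partial>Ds_measure s)"

lemma Ds_mass_integrable:
  assumes "integrable (Ds_measure s) (on_rhp g)" and [measurable]: "A \<in> sets borel"
  shows "integrable (Ds_measure s) (\<lambda>v. indicator (A \<times> UNIV) v * norm (on_rhp g v))"
  using integrable_mult_indicator[of "A \<times> UNIV" "Ds_measure s" "\<lambda>v. norm (on_rhp g v)"] assms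
  by (simp add: borel_Times)

text \<open>The sub-mean value property on the square of half-width x / 2, multiplied by the weight
  at its centre. Comparability moves that weight under the integral, and the square is then enlarged
  to a full vertical strip.\<close>

lemma Ds_weighted_submean:
  assumes s: "s > -1"
  obtains C where "0 \<le> C" and "\<And>g x y. g holomorphic_on rhp \<Longrightarrow>
    integrable (Ds_measure s) (on_rhp g) \<Longrightarrow> 0 < x \<Longrightarrow>
    x\<^sup>2 * Ds_weight s x y * norm (g (Complex x y)) \<le>
      C * (\<integral>v. indicator ({x/2..3*x/2} \<times> UNIV) v * norm (on_rhp g v) \<partial>Ds_measure s)"
proof -
  define \<kappa> where "\<kappa> = min ((1/2) powr s) ((3/2) powr s) * 2 powr (- (s + 1))"
  have kpos: "0 < \<kappa>" by (simp add: \<kappa>_def)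
  have "x\<^sup>2 * Ds_weight s x y * norm (g (Complex x y)) \<le>
      16 / \<kappa> * (\<integral>v. indicator ({x/2..3*x/2} \<times> UNIV) v * norm (on_rhp g v) \<partial>Ds_measure s)"
    if hol: "g holomorphic_on rhp" and int: "integrable (Ds_measure s) (on_rhp g)" and x: "0 < x" for g x y
  proof -
    have [measurable]: "on_rhp g \<in> borel_measurable borel"
      by (intro on_rhp_measurable holomorphic_on_imp_continuous_on hol)
    let ?Q = "{x/2..3*x/2} \<times> {y - x/2..y + x/2}"
    let ?S = "{x/2..3*x/2} \<times> (UNIV :: real set)"
    have [measurable]: "?Q \<in> sets borel" "?S \<in> sets borel"
      by (auto intro!: borel_Times)
    have Qeq: "?Q = {x - x/2..x + x/2} \<times> {y - x/2..y + x/2}"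
      by simp
    let ?J = "\<integral>v. indicator ?S v * norm (on_rhp g v) \<partial>Ds_measure s"
    have intS: "integrable (Ds_measure s) (\<lambda>v. indicator ?S v * norm (on_rhp g v))"
      by (intro Ds_mass_integrable int) auto
    have "ennreal ((x/2)\<^sup>2 * norm (g (Complex x y))) * ennreal (\<kappa> * Ds_weight s x y)
        \<le> 4 * (\<integral>\<^sup>+v. indicator ?Q v * ennreal (norm (on_rhp g v)) \<partial>lborel) * ennreal (\<kappa> * Ds_weight s x y)"
      unfolding Qeq using x by (intro mult_right_mono submean_square hol) auto
    also have "\<dots> = 4 * (\<integral>\<^sup>+v. indicator ?Q v * ennreal (norm (on_rhp g v)) * ennreal (\<kappa> * Ds_weight s x y) \<partial>lborel)"
      by (subst nn_integral_multc) (measurable, simp only: mult.assoc)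
    also have "\<dots> \<le> 4 * (\<integral>\<^sup>+v. indicator {0<..} (fst v) * ennreal (Ds_weight s (fst v) (snd v)) *
        ennreal (indicator ?S v * norm (on_rhp g v)) \<partial>lborel)"
    proof (intro mult_left_mono nn_integral_mono)
      fix v :: "real \<times> real"
      show "indicator ?Q v * ennreal (norm (on_rhp g v)) * ennreal (\<kappa> * Ds_weight s x y)
        \<le> indicator {0<..} (fst v) * ennreal (Ds_weight s (fst v) (snd v)) * ennreal (indicator ?S v * norm (on_rhp g v))"
      proof (cases "v \<in> ?Q")
        case True
        then have v: "x / 2 \<le> fst v" "fst v \<le> 3 * x / 2" "\<bar>snd v - y\<bar> \<le> x / 2"
          by (auto simp: mem_Times_iff abs_if)
        have "\<kappa> * Ds_weight s x y \<le> Ds_weight s (fst v) (snd v)"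
          unfolding \<kappa>_def using s x v by (intro Ds_weight_comparable)
        then have "norm (on_rhp g v) * (\<kappa> * Ds_weight s x y) \<le> Ds_weight s (fst v) (snd v) * norm (on_rhp g v)"
          by (subst mult.commute) (rule mult_right_mono, simp_all)
        moreover have "v \<in> ?S" "0 < fst v" using v x by (auto simp: mem_Times_iff)
        ultimately show ?thesis
          using True kpos by (simp add: ennreal_mult'[symmetric] ennreal_mult''[symmetric] ennreal_leI)
      qed simp
    qed simp
    also have "\<dots> = 4 * (\<integral>\<^sup>+v. ennreal (indicator ?S v * norm (on_rhp g v)) \<partial>Ds_measure s)"
      by (subst nn_integral_Ds_measure) auto
    also have "\<dots> = 4 * ennreal ?J"
      by (subst nn_integral_eq_integral[OF intS]) auto
    also have "\<dots> = ennreal (4 * ?J)"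
      by (subst ennreal_mult) (auto intro!: integral_nonneg_AE)
    finally have "ennreal ((x/2)\<^sup>2 * norm (g (Complex x y)) * (\<kappa> * Ds_weight s x y)) \<le> ennreal (4 * ?J)"
      using kpos by (subst ennreal_mult) auto
    then have "(x/2)\<^sup>2 * norm (g (Complex x y)) * (\<kappa> * Ds_weight s x y) \<le> 4 * ?J"
      by (subst (asm) ennreal_le_iff) (auto intro!: mult_nonneg_nonneg integral_nonneg_AE)
    then show ?thesis
      using kpos by (simp add: power_divide field_simps)
  qed
  then show thesis
    using kpos by (intro that[of "16 / \<kappa>"]) auto
qed

lemma Ds_mass_mono:
  assumes "integrable (Ds_measure s) (on_rhp g)" "A \<in> sets borel" "B \<in> sets borel" "A \<subseteq> B"
  shows "Ds_mass s g A \<le> Ds_mass s g B"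
  unfolding Ds_mass_def using assms(4)
  by (intro integral_mono Ds_mass_integrable assms) (auto simp: indicator_def)

lemma Ds_mass_nonneg: "0 \<le> Ds_mass s g A"
  unfolding Ds_mass_def by (intro integral_nonneg_AE) auto

lemma Ds_mass_Icc_le:
  assumes "integrable (Ds_measure s) (on_rhp g)" "b < c" "a \<le> c"
  shows "Ds_mass s g {a..b} \<le> Ds_mass s g {a..} - Ds_mass s g {c..}"
proof -
  have "Ds_mass s g {a..b} \<le> (\<integral>v. indicator ({a..} \<times> UNIV) v * norm (on_rhp g v) -
      indicator ({c..} \<times> UNIV) v * norm (on_rhp g v) \<partial>Ds_measure s)"
    unfolding Ds_mass_def using assms(2,3)
    by (intro integral_mono Ds_mass_integrable assms Bochner_Integration.integrable_diff)
      (auto simp: indicator_def)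
  also have "\<dots> = Ds_mass s g {a..} - Ds_mass s g {c..}"
    unfolding Ds_mass_def
    by (intro Bochner_Integration.integral_diff Ds_mass_integrable assms) auto
  finally show ?thesis .
qed

lemma Ds_mass_tendsto_0:
  assumes int: "integrable (Ds_measure s) (on_rhp g)"
  shows "((\<lambda>r. Ds_mass s g {r..}) \<longlongrightarrow> 0) at_top"
proof -
  have "((\<lambda>r. \<integral>v. indicator ({r..} \<times> UNIV) v * norm (on_rhp g v) \<partial>Ds_measure s)
      \<longlongrightarrow> (\<integral>v. 0 \<partial>Ds_measure s)) at_top"
  proof (rule integral_dominated_convergence_at_top)
    show "integrable (Ds_measure s) (\<lambda>v. norm (on_rhp g v))"
      by (intro integrable_norm int)
    show "(\<lambda>v. indicator ({r..} \<times> UNIV) v * norm (on_rhp g v)) \<in> borel_measurable (Ds_measure s)" for r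
      using Ds_mass_integrable[OF int] by auto
    show "\<forall>\<^sub>F r in at_top. AE v in Ds_measure s.
        norm (indicator ({r..} \<times> UNIV) v * norm (on_rhp g v)) \<le> norm (on_rhp g v)"
      by (intro always_eventually allI AE_I2) (auto simp: indicator_def)
    show "AE v in Ds_measure s. ((\<lambda>r. indicator ({r..} \<times> UNIV) v * norm (on_rhp g v)) \<longlongrightarrow> 0) at_top"
    proof (intro AE_I2 tendsto_eventually)
      fix v :: "real \<times> real"
      show "\<forall>\<^sub>F r in at_top. indicator ({r..} \<times> UNIV) v * norm (on_rhp g v) = 0"
        using eventually_gt_at_top[of "fst v"] by eventually_elim (auto simp: indicator_def)
    qed
  qed auto
  then show ?thesis
    by (simp add: Ds_mass_def)
qed

text \<open>In the region Re \<xi> >= c \<rho>, |\<xi>| <= 2 \<rho> the quantity x^2 w(x, y) is at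
  least a multiple of \<rho>. The left side controls the oscillation of a primitive along paths of
  length O(\<rho>), and the strips belonging to \<rho> = 2^k overlap only boundedly often.\<close>

lemma Ds_deriv_dyadic_bound:
  assumes s: "s > -1" and c: "0 < c"
  obtains C where "0 \<le> C" and "\<And>g \<xi> \<rho>. g holomorphic_on rhp \<Longrightarrow>
    integrable (Ds_measure s) (on_rhp g) \<Longrightarrow> 0 < \<rho> \<Longrightarrow> c * \<rho> \<le> Re \<xi> \<Longrightarrow> norm \<xi> \<le> 2 * \<rho> \<Longrightarrow>
    \<rho> * norm (g \<xi>) \<le> C * Ds_mass s g {c * \<rho> / 2..3 * \<rho>}"
proof -
  obtain C where C: "0 \<le> C" "\<And>g x y. g holomorphic_on rhp \<Longrightarrow>
    integrable (Ds_measure s) (on_rhp g) \<Longrightarrow> 0 < x \<Longrightarrow>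
    x\<^sup>2 * Ds_weight s x y * norm (g (Complex x y)) \<le>
      C * (\<integral>v. indicator ({x/2..3*x/2} \<times> UNIV) v * norm (on_rhp g v) \<partial>Ds_measure s)"
    using Ds_weighted_submean[OF s] by blast
  define k where "k = c powr (s + 2) * 2 powr (- (s + 1))"
  have k: "0 < k" using c by (simp add: k_def)
  have "\<rho> * norm (g \<xi>) \<le> C / k * Ds_mass s g {c * \<rho> / 2..3 * \<rho>}"
    if hol: "g holomorphic_on rhp" and int: "integrable (Ds_measure s) (on_rhp g)"
      and rho: "0 < \<rho>" and xi: "c * \<rho> \<le> Re \<xi>" "norm \<xi> \<le> 2 * \<rho>" for g \<xi> \<rho>
  proof -
    define x where "x = Re \<xi>"
    define y where "y = Im \<xi>"
    have x: "0 < c * \<rho>" "c * \<rho> \<le> x" "x \<le> 2 * \<rho>" "0 < x"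
      using c rho xi complex_Re_le_cmod[of \<xi>] mult_pos_pos[of c \<rho>] by (auto simp: x_def simp del: mult_pos_pos)
    have "x\<^sup>2 + y\<^sup>2 \<le> (2 * \<rho>)\<^sup>2"
      using power_mono[OF xi(2), of 2] by (simp add: cmod_power2 x_def y_def)
    then have "x powr s * (2 * \<rho>) powr (- (s + 1)) \<le> Ds_weight s x y"
      using s x rho by (intro Ds_weight_ge) auto
    then have "x\<^sup>2 * (x powr s * (2 * \<rho>) powr (- (s + 1))) \<le> x\<^sup>2 * Ds_weight s x y"
      by (rule mult_left_mono) simp
    moreover have "x\<^sup>2 * (x powr s * (2 * \<rho>) powr (- (s + 1))) = x powr (s + 2) * (2 * \<rho>) powr (- (s + 1))"
      using x by (simp add: powr_add)
    moreover have "(c * \<rho>) powr (s + 2) * (2 * \<rho>) powr (- (s + 1)) \<le> x powr (s + 2) * (2 * \<rho>) powr (- (s + 1))"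
      using x s by (intro mult_right_mono powr_mono2) auto
    moreover have "(c * \<rho>) powr (s + 2) * (2 * \<rho>) powr (- (s + 1)) = k * \<rho>"
    proof -
      have "(c * \<rho>) powr (s + 2) * (2 * \<rho>) powr (- (s + 1)) = k * (\<rho> powr (s + 2) * \<rho> powr (- (s + 1)))"
        using c rho by (simp add: powr_mult k_def)
      also have "\<rho> powr (s + 2) * \<rho> powr (- (s + 1)) = \<rho>"
        using rho unfolding powr_add[symmetric] by simp
      finally show ?thesis .
    qed
    ultimately have "k * \<rho> \<le> x\<^sup>2 * Ds_weight s x y"
      by linarith
    then have "k * \<rho> * norm (g (Complex x y)) \<le> x\<^sup>2 * Ds_weight s x y * norm (g (Complex x y))"
      by (rule mult_right_mono) simp
    also have "\<dots> \<le> C * Ds_mass s g {x/2..3*x/2}"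
      unfolding Ds_mass_def by (intro C hol int x)
    also have "\<dots> \<le> C * Ds_mass s g {c * \<rho> / 2..3 * \<rho>}"
      using x C by (intro mult_left_mono Ds_mass_mono int) auto
    finally have "k * (\<rho> * norm (g \<xi>)) \<le> C * Ds_mass s g {c * \<rho> / 2..3 * \<rho>}"
      by (simp add: x_def y_def)
    then show ?thesis
      using k by (simp add: field_simps)
  qed
  then show thesis
    using k C by (intro that[of "C / k"]) auto
qed

section \<open>Oscillation of f on dyadic scales and its limit in sectors\<close>

lemma Ds_integrable:
  assumes "f \<in> Ds s"
  shows "integrable (Ds_measure s) (on_rhp (deriv f))"
proof -
  have hol: "f holomorphic_on rhp" and fin: "Ds_integral s f < \<infinity>"
    using assms by (auto simp: Ds_def)
  have [measurable]: "on_rhp (deriv f) \<in> borel_measurable borel"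
    by (intro on_rhp_measurable deriv_continuous_on_rhp hol)
  show ?thesis
    using fin unfolding Ds_integral_eq[OF hol] by (intro integrableI_bounded) auto
qed

lemma norm_diff_le_on_segment:
  assumes hol: "f holomorphic_on rhp" and seg: "closed_segment p q \<subseteq> rhp"
    and B: "\<And>\<xi>. \<xi> \<in> closed_segment p q \<Longrightarrow> norm (deriv f \<xi>) \<le> B"
  shows "norm (f q - f p) \<le> B * norm (q - p)"
proof (rule field_differentiable_bound[of "closed_segment p q" f "deriv f"])
  fix z assume "z \<in> closed_segment p q"
  then have "z \<in> rhp" using seg by blast
  then show "(f has_field_derivative deriv f z) (at z within closed_segment p q)"
    using hol open_rhp holomorphic_derivI has_field_derivative_at_within by blast
qed (use B in auto)

text \<open>Consecutive differences are bounded by masses of dyadic strips. These masses are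
  differences of tails, so the differences are absolutely summable.\<close>

lemma Ds_dyadic_convergent:
  assumes s: "s > -1" and f: "f \<in> Ds s"
  shows "convergent (\<lambda>k. f (2 ^ k))"
proof -
  have hol: "f holomorphic_on rhp" using f by (simp add: Ds_def)
  have holg: "deriv f holomorphic_on rhp" by (intro holomorphic_deriv hol open_rhp)
  note int = Ds_integrable[OF f]
  obtain C where C: "0 \<le> C" "\<And>g \<xi> \<rho>. g holomorphic_on rhp \<Longrightarrow>
    integrable (Ds_measure s) (on_rhp g) \<Longrightarrow> 0 < \<rho> \<Longrightarrow> 1 * \<rho> \<le> Re \<xi> \<Longrightarrow> norm \<xi> \<le> 2 * \<rho> \<Longrightarrow>
    \<rho> * norm (g \<xi>) \<le> C * Ds_mass s g {1 * \<rho> / 2..3 * \<rho>}"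
    using Ds_deriv_dyadic_bound[OF s zero_less_one] by blast
  define T where "T k = Ds_mass s (deriv f) {2 ^ k..}" for k
  \<comment> \<open>With \<rho> = 2^(k+1) the strip from \<rho> / 2 to 3 \<rho> lies between 2^k and
    2^(k+3); the shift by one makes its left end a power with natural exponent.\<close>
  define u where "u k = f (2 ^ Suc k)" for k
  have step: "norm (u (Suc k) - u k) \<le> C * (T k - T (k + 3))" for k
  proof -
    define \<rho> :: real where "\<rho> = 2 ^ Suc k"
    have rho: "0 < \<rho>" by (simp add: \<rho>_def)
    have seg: "\<rho> \<le> Re \<xi>" "norm \<xi> \<le> 2 * \<rho>" if "\<xi> \<in> closed_segment (of_real \<rho>) (of_real (2 * \<rho>))" for \<xi> :: complex
      using that rho by (auto simp: closed_segment_of_real closed_segment_eq_real_ivl simp del: of_real_mult)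
    have "norm (f (of_real (2 * \<rho>)) - f (of_real \<rho>)) \<le>
        C * Ds_mass s (deriv f) {\<rho> / 2..3 * \<rho>} / \<rho> * norm (of_real (2 * \<rho>) - of_real \<rho> :: complex)"
    proof (rule norm_diff_le_on_segment[OF hol])
      show "closed_segment (of_real \<rho>) (of_real (2 * \<rho>)) \<subseteq> rhp"
        using seg(1) rho by (force simp: rhp_def)
      show "norm (deriv f \<xi>) \<le> C * Ds_mass s (deriv f) {\<rho> / 2..3 * \<rho>} / \<rho>"
        if "\<xi> \<in> closed_segment (of_real \<rho>) (of_real (2 * \<rho>))" for \<xi>
        using C(2)[OF holg int rho, of \<xi>] seg[OF that] rho by (simp add: field_simps)
    qed
    also have "norm (of_real (2 * \<rho>) - of_real \<rho> :: complex) = \<rho>"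
      using rho by (simp flip: of_real_diff del: of_real_mult)
    also have "C * Ds_mass s (deriv f) {\<rho> / 2..3 * \<rho>} / \<rho> * \<rho> = C * Ds_mass s (deriv f) {\<rho> / 2..3 * \<rho>}"
      using rho by simp
    also have "\<dots> \<le> C * (T k - T (k + 3))"
      unfolding T_def \<rho>_def using C(1) Ds_mass_Icc_le[OF int, of "3 * 2 ^ Suc k" "2 ^ (k + 3)" "2 ^ k"]
      by (intro mult_left_mono) (auto simp: power_add)
    finally show ?thesis
      by (simp add: u_def \<rho>_def)
  qed
  have "filterlim (\<lambda>k. 2 ^ k :: real) at_top sequentially"
    by (rule filterlim_at_infinity_imp_filterlim_at_top[OF filterlim_realpow_sequentially_gt1]) auto
  then have "T \<longlonglongrightarrow> 0"
    unfolding T_def by (rule filterlim_compose[OF Ds_mass_tendsto_0[OF int]])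
  then have d: "summable (\<lambda>k. T k - T (Suc k))"
    by (rule telescope_summable')
  \<comment> \<open>T k - T (k + 3) is the sum of three consecutive telescoping differences.\<close>
  have "summable (\<lambda>k. (T k - T (Suc k)) + (T (k + 1) - T (Suc (k + 1))) + (T (k + 2) - T (Suc (k + 2))))"
    by (intro summable_add d summable_ignore_initial_segment[OF d])
  then have "summable (\<lambda>k. C * (T k - T (k + 3)))"
    by (intro summable_mult) (simp add: numeral_3_eq_3)
  then have "summable (\<lambda>k. u (Suc k) - u k)"
    using step by (rule summable_comparison_test'[where N = 0])
  then have "convergent (\<lambda>n. \<Sum>k<n. u (Suc k) - u k)"
    by (simp add: summable_iff_convergent)
  then have "convergent (\<lambda>n. (\<Sum>k<n. u (Suc k) - u k) + u 0)"
    by (intro convergent_add convergent_const)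
  then have "convergent u"
    by (simp add: sum_lessThan_telescope)
  then show ?thesis
    unfolding u_def by (subst (asm) convergent_Suc_iff)
qed

lemma sector_Re_ge:
  assumes "z \<in> sector psi" "psi < pi / 2"
  shows "norm z * cos psi \<le> Re z"
proof -
  have z: "z \<noteq> 0" "\<bar>Arg z\<bar> < psi" using assms by (auto simp: sector_def)
  have "cos psi \<le> cos \<bar>Arg z\<bar>"
    using z assms(2) by (intro cos_monotone_0_pi_le) auto
  then have "norm z * cos psi \<le> norm z * cos (Arg z)"
    by (intro mult_left_mono) auto
  also have "\<dots> = Re z"
    using arg_cong[OF rcis_cmod_Arg[of z], of Re] by (simp add: rcis_def)
  finally show ?thesis .
qed

lemma dyadic_interval_exists:
  fixes r :: real
  assumes "1 \<le> r"
  obtains k :: nat where "2 ^ k \<le> r" "r < 2 ^ Suc k"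
proof -
  have "1 \<le> nat \<lfloor>r\<rfloor>" using assms by (simp add: le_nat_floor)
  then obtain k where k: "2 ^ k \<le> nat \<lfloor>r\<rfloor>" "nat \<lfloor>r\<rfloor> < 2 ^ (k + 1)"
    using ex_power_ivl1[of 2 "nat \<lfloor>r\<rfloor>"] by auto
  have "real (2 ^ k) \<le> real (nat \<lfloor>r\<rfloor>)" using k(1) by (simp only: of_nat_le_iff)
  also have "\<dots> \<le> r" using assms by simp
  finally have 1: "2 ^ k \<le> r" by simp
  have "real (nat \<lfloor>r\<rfloor> + 1) \<le> real (2 ^ (k + 1))" using k(2) by (simp only: of_nat_le_iff)
  moreover have "r < real (nat \<lfloor>r\<rfloor> + 1)" using assms by simp linarith
  ultimately have "r < 2 ^ Suc k" by simp
  with 1 show thesis by (rule that)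
qed

text \<open>The value L is the limit along 2^k and so is common to all sectors. A point z of a
  sector is joined to the power 2^k just below |z|; by convexity the segment stays where |f'| is
  controlled, with c = cos psi, and its length is at most 3 * 2^k.\<close>

lemma Ds_limit_exists:
  assumes s: "s > -1" and f: "f \<in> Ds s"
  shows "\<exists>L. \<forall>psi\<in>{0<..<pi/2}. (f \<longlongrightarrow> L) (inf at_infinity (principal (sector psi)))"
proof -
  have hol: "f holomorphic_on rhp" using f by (simp add: Ds_def)
  have holg: "deriv f holomorphic_on rhp" by (intro holomorphic_deriv hol open_rhp)
  note int = Ds_integrable[OF f]
  obtain L where L: "(\<lambda>k. f (2 ^ k)) \<longlonglongrightarrow> L"
    using Ds_dyadic_convergent[OF s f] by (auto simp: convergent_def)
  have "(f \<longlongrightarrow> L) (inf at_infinity (principal (sector psi)))" if psi: "psi \<in> {0<..<pi/2}" for psi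
  proof (rule tendstoI)
    fix \<epsilon> :: real assume e: "0 < \<epsilon>"
    define c where "c = cos psi"
    have c: "0 < c" "c \<le> 1" using psi by (auto simp: c_def intro: cos_gt_zero)
    obtain C where C: "0 \<le> C" "\<And>g \<xi> \<rho>. g holomorphic_on rhp \<Longrightarrow>
      integrable (Ds_measure s) (on_rhp g) \<Longrightarrow> 0 < \<rho> \<Longrightarrow> c * \<rho> \<le> Re \<xi> \<Longrightarrow> norm \<xi> \<le> 2 * \<rho> \<Longrightarrow>
      \<rho> * norm (g \<xi>) \<le> C * Ds_mass s g {c * \<rho> / 2..3 * \<rho>}"
      using Ds_deriv_dyadic_bound[OF s c(1)] by blast
    have "((\<lambda>r. 3 * C * Ds_mass s (deriv f) {r..}) \<longlongrightarrow> 3 * C * 0) at_top"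
      by (intro tendsto_mult_left Ds_mass_tendsto_0 int)
    then have "\<forall>\<^sub>F r in at_top. 3 * C * Ds_mass s (deriv f) {r..} < \<epsilon> / 2"
      using e by (intro order_tendstoD(2)[where y = 0]) auto
    then obtain R where R: "\<And>r. R \<le> r \<Longrightarrow> 3 * C * Ds_mass s (deriv f) {r..} < \<epsilon> / 2"
      unfolding eventually_at_top_linorder by blast
    have "\<forall>\<^sub>F k in sequentially. dist (f (2 ^ k)) L < \<epsilon> / 2"
      using L e by (intro tendstoD) auto
    then obtain K where K: "\<And>k. K \<le> k \<Longrightarrow> dist (f (2 ^ k)) L < \<epsilon> / 2"
      unfolding eventually_sequentially by blast
    \<comment> \<open>The first threshold forces k >= K. The second gives c |z| / 4 >= R, and since
      \<rho> >= |z| / 2 the strip starting at c \<rho> / 2 lies to the right of R.\<close>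
    have "dist (f z) L < \<epsilon>" if z: "max (2 ^ K) (4 * R / c) \<le> norm z" "z \<in> sector psi" for z
    proof -
      have nz: "1 \<le> norm z" using z(1) one_le_power[of "2::real" K] by linarith
      then obtain k where k: "2 ^ k \<le> norm z" "norm z < 2 ^ Suc k"
        using dyadic_interval_exists by blast
      define \<rho> :: real where "\<rho> = 2 ^ k"
      have rho: "0 < \<rho>" "\<rho> \<le> norm z" "norm z \<le> 2 * \<rho>"
        using k by (auto simp: \<rho>_def)
      have "(2::real) ^ K < 2 ^ Suc k" using z(1) k(2) by simp
      then have "K < Suc k" by (subst (asm) power_strict_increasing_iff) auto
      then have A: "dist (f (of_real \<rho>)) L < \<epsilon> / 2"
        using K[of k] by (simp add: \<rho>_def)
      have Rez: "c * \<rho> \<le> Re z"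
      proof -
        have "c * \<rho> \<le> norm z * c"
          using mult_right_mono[of \<rho> "norm z" c] rho c by (simp add: mult.commute)
        also have "\<dots> \<le> Re z"
          unfolding c_def using sector_Re_ge[OF z(2)] psi by simp
        finally show ?thesis .
      qed
      have seg: "c * \<rho> \<le> Re \<xi>" "norm \<xi> \<le> 2 * \<rho>" if xi: "\<xi> \<in> closed_segment (of_real \<rho>) z" for \<xi>
      proof -
        have "closed_segment (of_real \<rho>) z \<subseteq> {w. Re w \<ge> c * \<rho>}"
          using Rez rho c by (intro closed_segment_subset convex_halfspace_Re_ge) auto
        then show "c * \<rho> \<le> Re \<xi>" using xi by auto
        have "closed_segment (of_real \<rho>) z \<subseteq> cball 0 (2 * \<rho>)"
          using rho by (intro closed_segment_subset convex_cball) auto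
        then show "norm \<xi> \<le> 2 * \<rho>" using xi by auto
      qed
      have cr: "0 < c * \<rho>" using c rho by simp
      have "norm (f z - f (of_real \<rho>)) \<le>
          C * Ds_mass s (deriv f) {c * \<rho> / 2..3 * \<rho>} / \<rho> * norm (z - of_real \<rho>)"
      proof (rule norm_diff_le_on_segment[OF hol])
        show "closed_segment (of_real \<rho>) z \<subseteq> rhp"
          using seg(1) cr by (force simp: rhp_def)
        show "norm (deriv f \<xi>) \<le> C * Ds_mass s (deriv f) {c * \<rho> / 2..3 * \<rho>} / \<rho>"
          if "\<xi> \<in> closed_segment (of_real \<rho>) z" for \<xi>
          using C(2)[OF holg int rho(1), of \<xi>] seg[OF that] rho by (simp add: field_simps)
      qed
      also have "\<dots> \<le> C * Ds_mass s (deriv f) {c * norm z / 4..} / \<rho> * (3 * \<rho>)"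
      proof (intro mult_mono divide_right_mono mult_left_mono Ds_mass_mono int)
        have "c * norm z \<le> c * (2 * \<rho>)" using c rho by (intro mult_left_mono) auto
        then show "{c * \<rho> / 2..3 * \<rho>} \<subseteq> {c * norm z / 4..}" by auto
        show "norm (z - of_real \<rho>) \<le> 3 * \<rho>"
          using norm_triangle_ineq4[of z "of_real \<rho>"] rho by simp
      qed (use C rho Ds_mass_nonneg in auto)
      also have "\<dots> = 3 * C * Ds_mass s (deriv f) {c * norm z / 4..}"
        using rho by simp
      also have "\<dots> < \<epsilon> / 2"
        using z(1) c by (intro R) (simp add: field_simps)
      finally have "dist (f z) (f (of_real \<rho>)) < \<epsilon> / 2"
        by (simp add: dist_norm)
      then show ?thesis
        using A dist_triangle_half_l[of "f z" "f (of_real \<rho>)" \<epsilon> L] 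
        by (meson dist_commute_lessI dist_triangle_half_r)
    qed
    then show "\<forall>\<^sub>F z in inf at_infinity (principal (sector psi)). dist (f z) L < \<epsilon>"
      unfolding eventually_inf_principal eventually_at_infinity by blast
  qed
  then show ?thesis by blast
qed

section \<open>Translations\<close>

lemma on_rhp_shift: "0 < a \<Longrightarrow> 0 \<le> \<delta> \<Longrightarrow> on_rhp (\<lambda>z. g (z + of_real \<delta>)) (a, b) = on_rhp g (a + \<delta>, b)"
  by (simp add: on_rhp_def Complex_add_complex_of_real)

lemma on_rhp_shift_measurable:
  assumes "continuous_on rhp g" "0 \<le> \<delta>"
  shows "on_rhp (\<lambda>z. g (z + of_real \<delta>)) \<in> borel_measurable borel"
  by (intro on_rhp_measurable continuous_on_compose2[OF assms(1)] continuous_intros)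
    (use assms(2) in \<open>auto simp: rhp_def\<close>)

text \<open>For 0 < Re z < 2 \<delta> the square of half-width \<delta>/2 around z + \<delta> stays
  at distance at least \<delta>/2 from the axis. Conversely, all z whose square contains a given v
  lie in one box of size 2 \<delta> touching the axis, and its mass is at most a multiple of
  \<delta>^2 w(v). The strip on the right shrinks to the axis, so the bound tends to 0 with \<delta>
  for fixed integrable g.\<close>

lemma Ds_shift_near_boundary:
  assumes s: "s > -1"
  obtains C where "0 \<le> C" and "\<And>g \<delta>. g holomorphic_on rhp \<Longrightarrow> 0 < \<delta> \<Longrightarrow>
    (\<integral>\<^sup>+v. indicator ({..<2*\<delta>} \<times> UNIV) v * ennreal (norm (on_rhp (\<lambda>z. g (z + of_real \<delta>)) v)) \<partial>Ds_measure s)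
    \<le> ennreal C * (\<integral>\<^sup>+v. indicator ({\<delta>/2..5*\<delta>} \<times> UNIV) v * ennreal (norm (on_rhp g v)) \<partial>Ds_measure s)"
proof -
  obtain C where C0: "0 \<le> C" and C: "\<And>t x y. 0 < t \<Longrightarrow> t / 4 \<le> x \<Longrightarrow> x \<le> 5 * t / 2 \<Longrightarrow>
    emeasure (Ds_measure s) ({0<..<t} \<times> {y - t/2..y + t/2}) \<le> ennreal (C * t\<^sup>2 * Ds_weight s x y)"
    using Ds_measure_box_le[OF s] by metis
  have "(\<integral>\<^sup>+v. indicator ({..<2*\<delta>} \<times> UNIV) v * ennreal (norm (on_rhp (\<lambda>z. g (z + of_real \<delta>)) v)) \<partial>Ds_measure s)
    \<le> ennreal (64 * C) * (\<integral>\<^sup>+v. indicator ({\<delta>/2..5*\<delta>} \<times> UNIV) v * ennreal (norm (on_rhp g v)) \<partial>Ds_measure s)"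
    if hol: "g holomorphic_on rhp" and d: "0 < \<delta>" for g \<delta>
  proof -
    define h where "h v = ennreal (norm (on_rhp g v))" for v
    have cont: "continuous_on rhp g" by (intro holomorphic_on_imp_continuous_on hol)
    note [measurable] = on_rhp_measurable[OF cont] on_rhp_shift_measurable[OF cont less_imp_le[OF d]]
    have [measurable]: "h \<in> borel_measurable borel"
      unfolding h_def by measurable
    let ?S = "{\<delta>/2..5*\<delta>} \<times> (UNIV :: real set)"
    let ?U = "{..<2*\<delta>} \<times> (UNIV :: real set)"
    have [measurable]: "?S \<in> sets borel" "?U \<in> sets borel"
      by (auto intro!: borel_Times)
    define W where "W z = indicator {0<..<2*\<delta>} (fst z) * ennreal (Ds_weight s (fst z) (snd z))" for z :: "real \<times> real"
    have [measurable]: "W \<in> borel_measurable borel"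
      unfolding W_def by measurable
    \<comment> \<open>The relation between z and v is |Im z - Im v| <= \<delta>, wider than the
      square requires and symmetric, so it can be read from either variable when the integrals are
      interchanged.\<close>
    define J where "J z v = W z * (indicator ?S v * indicator {snd v - \<delta>..snd v + \<delta>} (snd z) * h v)"
      for z v :: "real \<times> real"
    have [measurable]: "case_prod J \<in> borel_measurable (borel \<Otimes>\<^sub>M borel)"
    proof -
      have "case_prod J = (\<lambda>p. W (fst p) * (indicator ?S (snd p) *
          indicator {q. \<bar>snd (snd q) - snd (fst q)\<bar> \<le> \<delta>} p * h (snd p)))"
        by (auto simp: J_def fun_eq_iff indicator_def)
      also have "\<dots> \<in> borel_measurable (borel \<Otimes>\<^sub>M borel)"
        by measurable
      finally show ?thesis .
    qed
    have sm: "h (a + \<delta>, b) \<le> ennreal (16 / \<delta>\<^sup>2) *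
        (\<integral>\<^sup>+v. indicator ?S v * indicator {snd v - \<delta>..snd v + \<delta>} b * h v \<partial>lborel)"
      if a: "0 < a" "a < 2 * \<delta>" for a b
    proof -
      let ?Q = "{a + \<delta> - \<delta>/2..a + \<delta> + \<delta>/2} \<times> {b - \<delta>/2..b + \<delta>/2}"
      have "ennreal ((\<delta>/2)\<^sup>2 * norm (g (Complex (a + \<delta>) b))) \<le> 4 * (\<integral>\<^sup>+v. indicator ?Q v * h v \<partial>lborel)"
        unfolding h_def using d a by (intro submean_square hol) auto
      also have "\<dots> \<le> 4 * (\<integral>\<^sup>+v. indicator ?S v * indicator {snd v - \<delta>..snd v + \<delta>} b * h v \<partial>lborel)"
        using a d by (intro mult_left_mono nn_integral_mono) (auto simp: indicator_def)
      finally have *: "ennreal ((\<delta>/2)\<^sup>2 * norm (g (Complex (a + \<delta>) b))) \<le>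
          4 * (\<integral>\<^sup>+v. indicator ?S v * indicator {snd v - \<delta>..snd v + \<delta>} b * h v \<partial>lborel)" .
      have "h (a + \<delta>, b) = ennreal (4 / \<delta>\<^sup>2) * ennreal ((\<delta>/2)\<^sup>2 * norm (g (Complex (a + \<delta>) b)))"
        using a d by (simp add: h_def on_rhp_def ennreal_mult'[symmetric] power_divide)
      also have "\<dots> \<le> ennreal (4 / \<delta>\<^sup>2) * (4 * (\<integral>\<^sup>+v. indicator ?S v * indicator {snd v - \<delta>..snd v + \<delta>} b * h v \<partial>lborel))"
        using * by (rule mult_left_mono) simp
      also have "ennreal (4 / \<delta>\<^sup>2) * (4 * X) = ennreal (16 / \<delta>\<^sup>2) * X" for X
      proof -
        have "ennreal (16 / \<delta>\<^sup>2) = ennreal (4 / \<delta>\<^sup>2) * ennreal 4"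
          using d by (subst ennreal_mult'[symmetric]) auto
        then show ?thesis by (simp add: mult.assoc)
      qed
      finally show ?thesis .
    qed
    \<comment> \<open>The box estimate with t = 2 \<delta>: its range t / 4 <= x <= 5 t / 2 becomes
      \<delta>/2 <= x <= 5 \<delta>.\<close>
    have box: "(\<integral>\<^sup>+z. W z * indicator {y - \<delta>..y + \<delta>} (snd z) \<partial>lborel) \<le> ennreal (C * (2 * \<delta>)\<^sup>2 * Ds_weight s x y)"
      if x: "\<delta>/2 \<le> x" "x \<le> 5 * \<delta>" for x y
    proof -
      let ?B = "{0<..<2 * \<delta>} \<times> {y - \<delta>..y + \<delta>}"
      have B: "?B \<in> sets borel" by (auto intro!: borel_Times)
      have "(\<integral>\<^sup>+z. W z * indicator {y - \<delta>..y + \<delta>} (snd z) \<partial>lborel) = (\<integral>\<^sup>+z. indicator ?B z \<partial>Ds_measure s)"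
        unfolding W_def by (subst nn_integral_Ds_measure)
          (auto intro!: nn_integral_cong borel_measurable_indicator B simp: indicator_def)
      also have "\<dots> = emeasure (Ds_measure s) ?B"
        using B by (intro nn_integral_indicator) auto
      also have "\<dots> \<le> ennreal (C * (2 * \<delta>)\<^sup>2 * Ds_weight s x y)"
        using C[of "2 * \<delta>" x y] d x by simp
      finally show ?thesis .
    qed
    have "(\<integral>\<^sup>+v. indicator ?U v * ennreal (norm (on_rhp (\<lambda>z. g (z + of_real \<delta>)) v)) \<partial>Ds_measure s)
        = (\<integral>\<^sup>+z. W z * ennreal (norm (on_rhp (\<lambda>z. g (z + of_real \<delta>)) z)) \<partial>lborel)"
      by (subst nn_integral_Ds_measure) (auto intro!: nn_integral_cong simp: W_def indicator_def)
    also have "\<dots> \<le> (\<integral>\<^sup>+z. ennreal (16 / \<delta>\<^sup>2) * (\<integral>\<^sup>+v. J z v \<partial>lborel) \<partial>lborel)"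
    proof (rule nn_integral_mono)
      fix z :: "real \<times> real"
      show "W z * ennreal (norm (on_rhp (\<lambda>z. g (z + of_real \<delta>)) z)) \<le> ennreal (16 / \<delta>\<^sup>2) * (\<integral>\<^sup>+v. J z v \<partial>lborel)"
      proof (cases "0 < fst z \<and> fst z < 2 * \<delta>")
        case True
        have "W z * ennreal (norm (on_rhp (\<lambda>z. g (z + of_real \<delta>)) z)) = W z * h (fst z + \<delta>, snd z)"
          using True d on_rhp_shift[of "fst z" \<delta> g "snd z"] by (simp add: h_def)
        also have "\<dots> \<le> W z * (ennreal (16 / \<delta>\<^sup>2) *
            (\<integral>\<^sup>+v. indicator ?S v * indicator {snd v - \<delta>..snd v + \<delta>} (snd z) * h v \<partial>lborel))"
          using True by (intro mult_left_mono sm) auto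
        also have "\<dots> = ennreal (16 / \<delta>\<^sup>2) * (\<integral>\<^sup>+v. J z v \<partial>lborel)"
          unfolding J_def
        proof (subst nn_integral_cmult)
          have "(\<lambda>v. indicator ?S v * indicator {w. \<bar>snd w - snd z\<bar> \<le> \<delta>} v * h v) \<in> borel_measurable borel"
            by measurable
          also have "(\<lambda>v. indicator ?S v * indicator {w. \<bar>snd w - snd z\<bar> \<le> \<delta>} v * h v) =
              (\<lambda>v. indicator ?S v * indicator {snd v - \<delta>..snd v + \<delta>} (snd z) * h v)"
            by (auto simp: fun_eq_iff indicator_def)
          finally show "(\<lambda>v. indicator ?S v * indicator {snd v - \<delta>..snd v + \<delta>} (snd z) * h v) \<in> borel_measurable lborel"
            by simp
        qed (simp add: mult_ac)
        finally show ?thesis .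
      next
        case False
        then show ?thesis by (auto simp: W_def)
      qed
    qed
    also have "\<dots> = ennreal (16 / \<delta>\<^sup>2) * (\<integral>\<^sup>+z. \<integral>\<^sup>+v. J z v \<partial>lborel \<partial>lborel)"
      by (rule nn_integral_cmult) measurable
    also have "(\<integral>\<^sup>+z. \<integral>\<^sup>+v. J z v \<partial>lborel \<partial>lborel) = (\<integral>\<^sup>+v. \<integral>\<^sup>+z. J z v \<partial>lborel \<partial>lborel)"
      by (rule lborel_pair.Fubini'[symmetric]) measurable
    also have "\<dots> \<le> (\<integral>\<^sup>+v. ennreal (4 * C * \<delta>\<^sup>2) * (indicator {0<..} (fst v) *
        ennreal (Ds_weight s (fst v) (snd v)) * (indicator ?S v * h v)) \<partial>lborel)"
    proof (rule nn_integral_mono)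
      fix v :: "real \<times> real"
      have "(\<integral>\<^sup>+z. J z v \<partial>lborel) =
          (\<integral>\<^sup>+z. (indicator ?S v * h v) * (W z * indicator {snd v - \<delta>..snd v + \<delta>} (snd z)) \<partial>lborel)"
        by (simp add: J_def mult_ac)
      also have "\<dots> = (indicator ?S v * h v) * (\<integral>\<^sup>+z. W z * indicator {snd v - \<delta>..snd v + \<delta>} (snd z) \<partial>lborel)"
        by (rule nn_integral_cmult) measurable
      also have "\<dots> \<le> (indicator ?S v * h v) * ennreal (C * (2 * \<delta>)\<^sup>2 * Ds_weight s (fst v) (snd v))"
      proof (cases "v \<in> ?S")
        case True
        then show ?thesis
          by (intro mult_left_mono box) (auto simp: mem_Times_iff)
      qed simp
      also have "\<dots> = ennreal (4 * C * \<delta>\<^sup>2) * (indicator {0<..} (fst v) *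
          ennreal (Ds_weight s (fst v) (snd v)) * (indicator ?S v * h v))"
      proof (cases "v \<in> ?S")
        case True
        then have "0 < fst v" using d by (auto simp: mem_Times_iff)
        moreover have "ennreal (C * (2 * \<delta>)\<^sup>2 * Ds_weight s (fst v) (snd v))
            = ennreal (4 * C * \<delta>\<^sup>2) * ennreal (Ds_weight s (fst v) (snd v))"
          using C0 by (subst ennreal_mult'[symmetric]) (auto simp: power_mult_distrib mult_ac)
        ultimately show ?thesis
          by (simp add: mult_ac)
      qed simp
      finally show "(\<integral>\<^sup>+z. J z v \<partial>lborel) \<le> ennreal (4 * C * \<delta>\<^sup>2) * (indicator {0<..} (fst v) *
        ennreal (Ds_weight s (fst v) (snd v)) * (indicator ?S v * h v))" .
    qed
    also have "\<dots> = ennreal (4 * C * \<delta>\<^sup>2) * (\<integral>\<^sup>+v. indicator {0<..} (fst v) *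
        ennreal (Ds_weight s (fst v) (snd v)) * (indicator ?S v * h v) \<partial>lborel)"
      by (rule nn_integral_cmult) measurable
    also have "(\<integral>\<^sup>+v. indicator {0<..} (fst v) * ennreal (Ds_weight s (fst v) (snd v)) *
        (indicator ?S v * h v) \<partial>lborel) = (\<integral>\<^sup>+v. indicator ?S v * h v \<partial>Ds_measure s)"
      by (rule nn_integral_Ds_measure[symmetric]) measurable
    also have "ennreal (16 / \<delta>\<^sup>2) * (ennreal (4 * C * \<delta>\<^sup>2) * X) = ennreal (64 * C) * X" for X
      using d C0 by (simp add: ennreal_mult'[symmetric] mult.assoc[symmetric])
    finally show ?thesis
      unfolding h_def by (simp only: mult_left_mono zero_le)
  qed
  then show thesis
    using C0 by (intro that[of "64 * C"]) auto
qed

text \<open>A change of variables moves the translation from \<open>g\<close> to the weight. The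
  limit \<delta> -> 0 then concerns only an explicit continuous function.\<close>

lemma Ds_shift_away_from_boundary:
  assumes g: "continuous_on rhp g" and d: "0 < \<delta>"
  shows "(\<integral>\<^sup>+v. indicator ({2*\<delta>..} \<times> UNIV) v * ennreal (norm (on_rhp (\<lambda>z. g (z + of_real \<delta>)) v)) \<partial>Ds_measure s)
    = (\<integral>\<^sup>+v. indicator ({3*\<delta>..} \<times> UNIV) v * ennreal (Ds_weight s (fst v - \<delta>) (snd v)) * ennreal (norm (on_rhp g v)) \<partial>lborel)"
proof -
  note [measurable] = on_rhp_measurable[OF g] on_rhp_shift_measurable[OF g less_imp_le[OF d]]
  have [measurable]: "{2*\<delta>..} \<times> (UNIV :: real set) \<in> sets borel" "{3*\<delta>..} \<times> (UNIV :: real set) \<in> sets borel"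
    by (auto intro!: borel_Times)
  have m1: "(\<lambda>v. indicator {0<..} (fst v) * ennreal (Ds_weight s (fst v) (snd v)) *
          (indicator ({2*\<delta>..} \<times> UNIV) v * ennreal (norm (on_rhp (\<lambda>z. g (z + of_real \<delta>)) v)))) \<in> borel_measurable borel"
    by measurable
  have m2: "(\<lambda>v. indicator ({3*\<delta>..} \<times> UNIV) v * ennreal (Ds_weight s (fst v - \<delta>) (snd v)) *
      ennreal (norm (on_rhp g v))) \<in> borel_measurable borel"
    by measurable
  let ?k = "\<lambda>a. \<integral>\<^sup>+b. indicator {3*\<delta>..} a * ennreal (Ds_weight s (a - \<delta>) b) * ennreal (norm (on_rhp g (a, b))) \<partial>lborel"
  have "(\<integral>\<^sup>+v. indicator ({2*\<delta>..} \<times> UNIV) v * ennreal (norm (on_rhp (\<lambda>z. g (z + of_real \<delta>)) v)) \<partial>Ds_measure s)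
      = (\<integral>\<^sup>+v. indicator {0<..} (fst v) * ennreal (Ds_weight s (fst v) (snd v)) *
          (indicator ({2*\<delta>..} \<times> UNIV) v * ennreal (norm (on_rhp (\<lambda>z. g (z + of_real \<delta>)) v))) \<partial>lborel)"
    by (rule nn_integral_Ds_measure) measurable
  also have "\<dots> = (\<integral>\<^sup>+a. \<integral>\<^sup>+b. indicator {0<..} a * ennreal (Ds_weight s a b) *
          (indicator ({2*\<delta>..} \<times> UNIV) (a, b) * ennreal (norm (on_rhp (\<lambda>z. g (z + of_real \<delta>)) (a, b)))) \<partial>lborel \<partial>lborel)"
    by (subst nn_integral_lborel_pair[OF m1]) simp
  also have "\<dots> = (\<integral>\<^sup>+a. ?k (\<delta> + 1 * a) \<partial>lborel)"
  proof (intro nn_integral_cong)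
    fix a b :: real
    show "indicator {0<..} a * ennreal (Ds_weight s a b) *
          (indicator ({2*\<delta>..} \<times> UNIV) (a, b) * ennreal (norm (on_rhp (\<lambda>z. g (z + of_real \<delta>)) (a, b)))) =
        indicator {3*\<delta>..} (\<delta> + 1 * a) * ennreal (Ds_weight s (\<delta> + 1 * a - \<delta>) b) * ennreal (norm (on_rhp g (\<delta> + 1 * a, b)))"
      using d on_rhp_shift[of a \<delta> g b] by (auto simp: indicator_def add.commute)
  qed
  also have "\<dots> = (\<integral>\<^sup>+a. ?k a \<partial>lborel)"
    using nn_integral_real_affine[of ?k 1 \<delta>] by simp
  also have "\<dots> = (\<integral>\<^sup>+v. indicator ({3*\<delta>..} \<times> UNIV) v * ennreal (Ds_weight s (fst v - \<delta>) (snd v)) * ennreal (norm (on_rhp g v)) \<partial>lborel)"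
    by (subst nn_integral_lborel_pair[OF m2]) (simp add: indicator_times)
  finally show ?thesis .
qed

section \<open>Density\<close>

lemma norm_inverse_one_add_le_1:
  fixes z :: complex
  assumes "0 \<le> Re z" "0 \<le> \<delta>"
  shows "norm (1 / (1 + of_real \<delta> * z)) \<le> 1"
proof -
  have "1 \<le> Re (1 + of_real \<delta> * z)"
    using assms by simp
  also have "\<dots> \<le> norm (1 + of_real \<delta> * z)"
    by (rule complex_Re_le_cmod)
  finally show ?thesis
    by (simp add: norm_divide divide_le_eq_1)
qed

text \<open>The translation parameter \<delta> runs through 1 / (n + 1), since the convergence
  theorems to be applied concern sequences. For fixed \<open>n\<close> and holomorphic
  \<open>g\<close> the result is holomorphic beyond the imaginary axis, on Re z > -
  \<delta>.\<close>

definition Ds_regularization :: "nat \<Rightarrow> nat \<Rightarrow> (complex \<Rightarrow> complex) \<Rightarrow> complex \<Rightarrow> complex" where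
  "Ds_regularization m n g z =
     g (z + of_real (inverse (real (Suc n)))) * (1 / (1 + of_real (inverse (real (Suc n))) * z)) ^ m"

lemma Ds_regularization_continuous:
  assumes "continuous_on rhp g"
  shows "continuous_on rhp (Ds_regularization m n g)"
proof -
  have "1 + of_real (inverse (real (Suc n))) * z \<noteq> 0" if "z \<in> rhp" for z :: complex
    using that rhp_one_add_nonzero[of "of_real (inverse (real (Suc n))) * z"] by (simp add: rhp_def)
  then show ?thesis
    unfolding Ds_regularization_def
    by (intro continuous_intros continuous_on_compose2[OF assms]) (auto simp: rhp_def add_pos_pos)
qed

text \<open>Dominated convergence: the shifted weights converge pointwise, and the cutoff at 3
  \<delta> keeps them below a fixed multiple of the weight.\<close>

lemma Ds_shift_integral:
  assumes s: "s > -1" and g: "continuous_on rhp g" and int: "integrable (Ds_measure s) (on_rhp g)"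
  shows "(\<lambda>n. \<integral>\<^sup>+v. indicator ({3*inverse (real (Suc n))..} \<times> UNIV) v *
      ennreal (Ds_weight s (fst v - inverse (real (Suc n))) (snd v)) * ennreal (norm (on_rhp g v)) \<partial>lborel)
    \<longlonglongrightarrow> (\<integral>\<^sup>+v. ennreal (norm (on_rhp g v)) \<partial>Ds_measure s)" (is ?lim)
    and "(\<integral>\<^sup>+v. indicator ({3*inverse (real (Suc n))..} \<times> UNIV) v *
      ennreal (Ds_weight s (fst v - inverse (real (Suc n))) (snd v)) * ennreal (norm (on_rhp g v)) \<partial>lborel) < \<infinity>" (is ?fin)
proof -
  define \<delta> where "\<delta> n = inverse (real (Suc n))" for n
  have d0: "0 < \<delta> n" for n by (simp add: \<delta>_def)
  have dlim: "\<delta> \<longlonglongrightarrow> 0"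
    unfolding \<delta>_def by (rule LIMSEQ_inverse_real_of_nat)
  define h where "h v = ennreal (norm (on_rhp g v))" for v
  note [measurable] = on_rhp_measurable[OF g]
  have [measurable]: "h \<in> borel_measurable borel"
    unfolding h_def by measurable
  have [measurable]: "{a..} \<times> (UNIV :: real set) \<in> sets borel" for a :: real
    by (auto intro!: borel_Times)
  define \<kappa> where "\<kappa> = min ((1/2) powr s) ((3/2) powr s) * 2 powr (- (s + 1))"
  have kpos: "0 < \<kappa>" by (simp add: \<kappa>_def)
  let ?w = "\<lambda>v. indicator {0<..} (fst v) * ennreal (Ds_weight s (fst v) (snd v)) * h v"
  have fin: "(\<integral>\<^sup>+v. ?w v \<partial>lborel) < \<infinity>"
  proof -
    have "(\<integral>\<^sup>+v. ?w v \<partial>lborel) = (\<integral>\<^sup>+v. h v \<partial>Ds_measure s)"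
      by (rule nn_integral_Ds_measure[symmetric]) measurable
    also have "\<dots> < \<infinity>"
      using int unfolding integrable_iff_bounded h_def by auto
    finally show ?thesis .
  qed
  have "(\<integral>\<^sup>+v. ennreal (1 / \<kappa>) * ?w v \<partial>lborel) = ennreal (1 / \<kappa>) * (\<integral>\<^sup>+v. ?w v \<partial>lborel)"
    by (rule nn_integral_cmult) measurable
  then have finw: "(\<integral>\<^sup>+v. ennreal (1 / \<kappa>) * ?w v \<partial>lborel) < \<infinity>"
    using fin by (simp add: ennreal_mult_less_top)
  \<comment> \<open>With x = Re v - \<delta> >= 2 \<delta>, the shift \<delta> is at most x / 2, so
    the weights at v - \<delta> and v are comparable.\<close>
  have bound: "indicator ({3*\<delta> n..} \<times> UNIV) v * ennreal (Ds_weight s (fst v - \<delta> n) (snd v)) * h v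
      \<le> ennreal (1 / \<kappa>) * ?w v" for n v
  proof (cases "3 * \<delta> n \<le> fst v")
    case True
    have "\<kappa> * Ds_weight s (fst v - \<delta> n) (snd v) \<le> Ds_weight s (fst v) (snd v)"
      unfolding \<kappa>_def using True d0[of n] s by (intro Ds_weight_comparable) auto
    then have "Ds_weight s (fst v - \<delta> n) (snd v) \<le> 1 / \<kappa> * Ds_weight s (fst v) (snd v)"
      using kpos by (simp add: field_simps)
    then have "ennreal (Ds_weight s (fst v - \<delta> n) (snd v)) \<le> ennreal (1 / \<kappa>) * ennreal (Ds_weight s (fst v) (snd v))"
      using kpos by (subst ennreal_mult[symmetric]) (auto intro: ennreal_leI)
    then have "ennreal (Ds_weight s (fst v - \<delta> n) (snd v)) * h v
        \<le> ennreal (1 / \<kappa>) * ennreal (Ds_weight s (fst v) (snd v)) * h v"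
      by (rule mult_right_mono) simp
    moreover have "0 < fst v" using True d0[of n] by linarith
    ultimately show ?thesis
      using True by (simp add: mult.assoc indicator_def mem_Times_iff)
  qed (simp add: indicator_def mem_Times_iff)
  have "(\<lambda>n. \<integral>\<^sup>+v. indicator ({3*\<delta> n..} \<times> UNIV) v * ennreal (Ds_weight s (fst v - \<delta> n) (snd v)) * h v \<partial>lborel)
      \<longlonglongrightarrow> (\<integral>\<^sup>+v. ?w v \<partial>lborel)"
  proof (rule nn_integral_dominated_convergence)
    show "(\<lambda>v. ennreal (1 / \<kappa>) * ?w v) \<in> borel_measurable lborel"
      by measurable
    show "?w \<in> borel_measurable lborel"
      by measurable
    show "(\<lambda>v. indicator ({3*\<delta> n..} \<times> UNIV) v * ennreal (Ds_weight s (fst v - \<delta> n) (snd v)) * h v)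
        \<in> borel_measurable lborel" for n
      by measurable
    show "(\<integral>\<^sup>+v. ennreal (1 / \<kappa>) * ?w v \<partial>lborel) < \<infinity>" by (rule finw)
    show "AE v in lborel. indicator ({3*\<delta> n..} \<times> UNIV) v * ennreal (Ds_weight s (fst v - \<delta> n) (snd v)) * h v
        \<le> ennreal (1 / \<kappa>) * ?w v" for n
      by (intro AE_I2 bound)
    show "AE v in lborel. (\<lambda>n. indicator ({3*\<delta> n..} \<times> UNIV) v *
        ennreal (Ds_weight s (fst v - \<delta> n) (snd v)) * h v) \<longlonglongrightarrow> ?w v"
    proof (rule AE_I2)
      fix v :: "real \<times> real"
      show "(\<lambda>n. indicator ({3*\<delta> n..} \<times> UNIV) v * ennreal (Ds_weight s (fst v - \<delta> n) (snd v)) * h v) \<longlonglongrightarrow> ?w v"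
      proof (cases "0 < fst v")
        case True
        have "(\<lambda>n. Ds_weight s (fst v - \<delta> n) (snd v)) \<longlonglongrightarrow> Ds_weight s (fst v - 0) (snd v)"
          unfolding Ds_weight_def using True
          by (intro tendsto_intros dlim) (auto simp: sum_power2_eq_zero_iff)
        then have "(\<lambda>n. h v * ennreal (Ds_weight s (fst v - \<delta> n) (snd v))) \<longlonglongrightarrow> h v * ennreal (Ds_weight s (fst v) (snd v))"
          by (intro ennreal_tendsto_cmult tendsto_ennrealI) (auto simp: h_def)
        moreover have "\<forall>\<^sub>F n in sequentially. h v * ennreal (Ds_weight s (fst v - \<delta> n) (snd v)) =
            indicator ({3*\<delta> n..} \<times> UNIV) v * ennreal (Ds_weight s (fst v - \<delta> n) (snd v)) * h v"
        proof -
          have "\<forall>\<^sub>F n in sequentially. \<delta> n < fst v / 3"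
            using True by (intro order_tendstoD(2)[OF dlim]) auto
          then show ?thesis
            by eventually_elim (auto simp: indicator_def mem_Times_iff mult.commute)
        qed
        ultimately have "(\<lambda>n. indicator ({3*\<delta> n..} \<times> UNIV) v * ennreal (Ds_weight s (fst v - \<delta> n) (snd v)) * h v)
            \<longlonglongrightarrow> h v * ennreal (Ds_weight s (fst v) (snd v))"
          by (rule Lim_transform_eventually)
        then show ?thesis
          using True by (simp add: mult.commute)
      next
        case False
        then have "\<not> 3 * \<delta> n \<le> fst v" for n using d0[of n] by linarith
        then show ?thesis
          using False by (simp add: indicator_def mem_Times_iff)
      qed
    qed
  qed
  also have "(\<integral>\<^sup>+v. ?w v \<partial>lborel) = (\<integral>\<^sup>+v. h v \<partial>Ds_measure s)"
    by (rule nn_integral_Ds_measure[symmetric]) measurable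
  finally show ?lim
    unfolding h_def \<delta>_def .
  have "(\<integral>\<^sup>+v. indicator ({3*\<delta> n..} \<times> UNIV) v * ennreal (Ds_weight s (fst v - \<delta> n) (snd v)) * h v \<partial>lborel)
      \<le> (\<integral>\<^sup>+v. ennreal (1 / \<kappa>) * ?w v \<partial>lborel)"
    by (intro nn_integral_mono bound)
  then show ?fin
    using finw unfolding h_def \<delta>_def by (rule le_less_trans)
qed

text \<open>Pointwise convergence is clear, so only the limsup of the norms has to be controlled.
  The damping factor is dropped, as its modulus is at most 1. The part near the axis is bounded by
  \<open>A n\<close>, which tends to 0, and the rest by \<open>B n\<close>, which tends to the norm
  of \<open>g\<close>.\<close>

lemma Ds_regularization_tendsto:
  assumes s: "s > -1" and hol: "g holomorphic_on rhp" and int: "integrable (Ds_measure s) (on_rhp g)"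
  shows "(\<lambda>n. \<integral>\<^sup>+v. norm (on_rhp (Ds_regularization m n g) v - on_rhp g v) \<partial>Ds_measure s) \<longlonglongrightarrow> 0"
proof -
  define \<delta> where "\<delta> n = inverse (real (Suc n))" for n
  have d0: "0 < \<delta> n" for n by (simp add: \<delta>_def)
  have dlim: "\<delta> \<longlonglongrightarrow> 0"
    unfolding \<delta>_def by (rule LIMSEQ_inverse_real_of_nat)
  have reg: "Ds_regularization m n g z = g (z + of_real (\<delta> n)) * (1 / (1 + of_real (\<delta> n) * z)) ^ m" for n z
    by (simp add: Ds_regularization_def \<delta>_def)
  have cont: "continuous_on rhp g" by (intro holomorphic_on_imp_continuous_on hol)
  define h where "h v = ennreal (norm (on_rhp g v))" for v
  note [measurable] = on_rhp_measurable[OF cont] on_rhp_shift_measurable[OF cont less_imp_le[OF d0]]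
  have [measurable]: "h \<in> borel_measurable borel"
    unfolding h_def by measurable
  have fin: "(\<integral>\<^sup>+v. h v \<partial>Ds_measure s) < \<infinity>"
    using int unfolding integrable_iff_bounded h_def by auto
  have [measurable]: "{a..} \<times> (UNIV :: real set) \<in> sets borel" "{..<a} \<times> (UNIV :: real set) \<in> sets borel"
    "{a..b} \<times> (UNIV :: real set) \<in> sets borel" for a b :: real
    by (auto intro!: borel_Times)
  obtain C where C: "0 \<le> C" "\<And>g \<delta>. g holomorphic_on rhp \<Longrightarrow> 0 < \<delta> \<Longrightarrow>
    (\<integral>\<^sup>+v. indicator ({..<2*\<delta>} \<times> UNIV) v * ennreal (norm (on_rhp (\<lambda>z. g (z + of_real \<delta>)) v)) \<partial>Ds_measure s)
    \<le> ennreal C * (\<integral>\<^sup>+v. indicator ({\<delta>/2..5*\<delta>} \<times> UNIV) v * ennreal (norm (on_rhp g v)) \<partial>Ds_measure s)"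
    using Ds_shift_near_boundary[OF s] by blast
  define A where "A n = ennreal C * (\<integral>\<^sup>+v. indicator ({\<delta> n/2..5*\<delta> n} \<times> UNIV) v * h v \<partial>Ds_measure s)" for n
  define B where "B n = (\<integral>\<^sup>+v. indicator ({3*\<delta> n..} \<times> UNIV) v *
      ennreal (Ds_weight s (fst v - \<delta> n) (snd v)) * h v \<partial>lborel)" for n
  \<comment> \<open>Every point of the open half-plane eventually leaves the strips from \<delta>/2
    to 5 \<delta>.\<close>
  have Alim: "A \<longlonglongrightarrow> ennreal C * (\<integral>\<^sup>+v. 0 \<partial>Ds_measure s)"
    unfolding A_def
  proof (intro ennreal_tendsto_cmult nn_integral_dominated_convergence[where w = h])
    show "AE v in Ds_measure s. (\<lambda>n. indicator ({\<delta> n/2..5*\<delta> n} \<times> UNIV) v * h v) \<longlonglongrightarrow> 0"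
    proof (intro AE_I2 tendsto_eventually)
      fix v :: "real \<times> real"
      show "\<forall>\<^sub>F n in sequentially. indicator ({\<delta> n/2..5*\<delta> n} \<times> UNIV) v * h v = 0"
      proof (cases "0 < fst v")
        case True
        then have "\<forall>\<^sub>F n in sequentially. \<delta> n < fst v / 5"
          by (intro order_tendstoD(2)[OF dlim]) auto
        then show ?thesis
          by eventually_elim (auto simp: indicator_def mem_Times_iff)
      qed (simp add: h_def on_rhp_def)
    qed
    show "AE v in Ds_measure s. indicator ({\<delta> n/2..5*\<delta> n} \<times> UNIV) v * h v \<le> h v" for n
      by (intro AE_I2) (simp add: indicator_def)
  qed (use fin in auto)
  have Blim: "B \<longlonglongrightarrow> (\<integral>\<^sup>+v. h v \<partial>Ds_measure s)"
    unfolding B_def h_def \<delta>_def by (rule Ds_shift_integral(1)[OF s cont int])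
  have le: "(\<integral>\<^sup>+v. norm (on_rhp (Ds_regularization m n g) v) \<partial>Ds_measure s) \<le> A n + B n" for n
  proof -
    let ?k = "\<lambda>v. ennreal (norm (on_rhp (\<lambda>z. g (z + of_real (\<delta> n))) v))"
    have "(\<integral>\<^sup>+v. norm (on_rhp (Ds_regularization m n g) v) \<partial>Ds_measure s) \<le>
      (\<integral>\<^sup>+v. indicator ({..<2*\<delta> n} \<times> UNIV) v * ?k v + indicator ({2*\<delta> n..} \<times> UNIV) v * ?k v \<partial>Ds_measure s)"
    proof (rule nn_integral_mono)
      fix v :: "real \<times> real"
      have "norm (on_rhp (Ds_regularization m n g) v) \<le> norm (on_rhp (\<lambda>z. g (z + of_real (\<delta> n))) v)"
      proof (cases "0 < fst v")
        case True
        then have "norm ((1 / (1 + of_real (\<delta> n) * Complex (fst v) (snd v))) ^ m) \<le> 1"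
          unfolding norm_power using d0[of n]
          by (intro power_le_one norm_inverse_one_add_le_1) auto
        then show ?thesis
          using True by (simp add: on_rhp_def reg norm_mult mult_left_le)
      qed (simp add: on_rhp_def)
      then show "ennreal (norm (on_rhp (Ds_regularization m n g) v)) \<le>
          indicator ({..<2*\<delta> n} \<times> UNIV) v * ?k v + indicator ({2*\<delta> n..} \<times> UNIV) v * ?k v"
        by (auto simp: indicator_def mem_Times_iff intro: ennreal_leI)
    qed
    also have "\<dots> = (\<integral>\<^sup>+v. indicator ({..<2*\<delta> n} \<times> UNIV) v * ?k v \<partial>Ds_measure s)
        + (\<integral>\<^sup>+v. indicator ({2*\<delta> n..} \<times> UNIV) v * ?k v \<partial>Ds_measure s)"
      by (rule nn_integral_add) measurable
    also have "\<dots> \<le> A n + B n"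
      using C(2)[OF hol d0] Ds_shift_away_from_boundary[OF cont d0[of n], of s]
      by (intro add_mono) (auto simp: A_def B_def h_def)
    finally show ?thesis .
  qed
  have ABfin: "A n + B n < \<infinity>" for n
  proof -
    have "(\<integral>\<^sup>+v. indicator ({\<delta> n/2..5*\<delta> n} \<times> UNIV) v * h v \<partial>Ds_measure s) \<le> (\<integral>\<^sup>+v. h v \<partial>Ds_measure s)"
      by (intro nn_integral_mono) (simp add: indicator_def)
    then have "A n < \<infinity>"
      unfolding A_def using fin by (simp add: ennreal_mult_less_top le_less_trans)
    moreover have "B n < \<infinity>"
      unfolding B_def h_def \<delta>_def by (rule Ds_shift_integral(2)[OF s cont int])
    ultimately show ?thesis by simp
  qed
  have meas: "on_rhp (Ds_regularization m n g) \<in> borel_measurable borel" for n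
    by (intro on_rhp_measurable Ds_regularization_continuous cont)
  show ?thesis
  proof (rule Scheffe_lemma1)
    show "integrable (Ds_measure s) (on_rhp (Ds_regularization m n g))" for n
      using meas[of n] le_less_trans[OF le ABfin] by (intro integrableI_bounded) auto
    show "AE v in Ds_measure s. (\<lambda>n. on_rhp (Ds_regularization m n g) v) \<longlonglongrightarrow> on_rhp g v"
    proof (rule AE_I2)
      fix v :: "real \<times> real"
      show "(\<lambda>n. on_rhp (Ds_regularization m n g) v) \<longlonglongrightarrow> on_rhp g v"
      proof (cases "0 < fst v")
        case True
        let ?z = "Complex (fst v) (snd v)"
        have z: "?z \<in> rhp" using True by (simp add: rhp_def)
        have "isCont g (?z + of_real 0)"
          using cont z open_rhp by (simp add: continuous_on_eq_continuous_at)
        then have "(\<lambda>n. g (?z + of_real (\<delta> n))) \<longlonglongrightarrow> g (?z + of_real 0)"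
          by (rule isCont_tendsto_compose) (intro tendsto_intros dlim)
        moreover have "(\<lambda>n. (1 / (1 + of_real (\<delta> n) * ?z)) ^ m) \<longlonglongrightarrow> (1 / (1 + of_real 0 * ?z)) ^ m"
          by (intro tendsto_intros dlim) auto
        ultimately have "(\<lambda>n. Ds_regularization m n g ?z) \<longlonglongrightarrow> g (?z + of_real 0) * (1 / (1 + of_real 0 * ?z)) ^ m"
          unfolding reg by (rule tendsto_mult)
        then show ?thesis
          using True by (simp add: on_rhp_def)
      qed (simp add: on_rhp_def)
    qed
    have "limsup (\<lambda>n. \<integral>\<^sup>+v. norm (on_rhp (Ds_regularization m n g) v) \<partial>Ds_measure s) \<le> limsup (\<lambda>n. A n + B n)"
      by (intro Limsup_mono always_eventually allI le)
    also have "limsup (\<lambda>n. A n + B n) = 0 + (\<integral>\<^sup>+v. h v \<partial>Ds_measure s)"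
      using tendsto_add[OF Alim Blim] by (intro lim_imp_Limsup) auto
    finally show "limsup (\<lambda>n. \<integral>\<^sup>+v. norm (on_rhp (Ds_regularization m n g) v) \<partial>Ds_measure s)
        \<le> (\<integral>\<^sup>+v. norm (on_rhp g v) \<partial>Ds_measure s)"
      by (simp add: h_def)
  qed (rule int)
qed

text \<open>With N = |1 + z|, the weighted sub-mean value bound gives growth N^(s+1) for g(z +
  \<delta>), the damping factor is at most (\<delta> N)^-m, and N^(s+1) N^-m N^3 <= 1 exactly when
  the exponent s + 4 - m is nonpositive, as N >= 1 (for N > 1). The constants blow up as \<delta> ->
  0, which is harmless because \<open>n\<close> is fixed.\<close>

lemma Ds_regularization_approximable:
  assumes s: "s > -1" and hol: "g holomorphic_on rhp" and int: "integrable (Ds_measure s) (on_rhp g)"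
    and m: "s + 4 \<le> real m"
  shows "Rtilde_deriv_approximable (Ds_regularization m n g)"
proof -
  define \<delta> where "\<delta> = inverse (real (Suc n))"
  have d: "0 < \<delta>" "\<delta> \<le> 1" by (auto simp: \<delta>_def inverse_le_1_iff)
  have reg: "Ds_regularization m n g = (\<lambda>z. g (z + of_real \<delta>) * (1 / (1 + of_real \<delta> * z)) ^ m)"
    by (simp add: Ds_regularization_def \<delta>_def fun_eq_iff)
  have nz: "1 + of_real \<delta> * z \<noteq> 0" if "0 \<le> Re z" for z
    using that d by (auto simp: complex_eq_iff add_nonneg_eq_0_iff)
  have cont: "continuous_on rhp g" by (intro holomorphic_on_imp_continuous_on hol)
  obtain C where C: "0 \<le> C" "\<And>g x y. g holomorphic_on rhp \<Longrightarrow>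
    integrable (Ds_measure s) (on_rhp g) \<Longrightarrow> 0 < x \<Longrightarrow>
    x\<^sup>2 * Ds_weight s x y * norm (g (Complex x y)) \<le>
      C * (\<integral>v. indicator ({x/2..3*x/2} \<times> UNIV) v * norm (on_rhp g v) \<partial>Ds_measure s)"
    using Ds_weighted_submean[OF s] by blast
  define M where "M = C * Ds_mass s g UNIV"
  have M: "0 \<le> M" unfolding M_def using C Ds_mass_nonneg by simp
  show ?thesis
  proof (rule approximable_of_decay)
    show "continuous_on {z. 0 \<le> Re z} (Ds_regularization m n g)"
      unfolding reg using nz d
      by (intro continuous_intros continuous_on_compose2[OF cont]) (auto simp: rhp_def)
    show "Ds_regularization m n g holomorphic_on rhp"
      unfolding reg using nz d
      by (intro holomorphic_intros holomorphic_on_compose_gen[OF _ hol, unfolded o_def]) (auto simp: rhp_def)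
    fix z :: complex assume z: "0 \<le> Re z"
    define x where "x = Re z + \<delta>"
    define y where "y = Im z"
    define N where "N = norm (1 + z)"
    have x: "0 < x" "\<delta> \<le> x" "x \<le> 1 + Re z" using z d by (auto simp: x_def)
    have zd: "z + of_real \<delta> = Complex x y"
      by (simp add: complex_eq_iff x_def y_def)
    have N: "1 \<le> N"
      using complex_Re_le_cmod[of "1 + z"] z by (simp add: N_def)
    have xy: "x\<^sup>2 + y\<^sup>2 \<le> N\<^sup>2"
      using x power_mono[OF x(3), of 2] by (simp add: N_def cmod_power2 y_def)
    have "x powr s * N powr (- (s + 1)) \<le> Ds_weight s x y"
      using s x xy N by (intro Ds_weight_ge) auto
    then have "x\<^sup>2 * (x powr s * N powr (- (s + 1))) \<le> x\<^sup>2 * Ds_weight s x y"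
      by (rule mult_left_mono) simp
    moreover have "x\<^sup>2 * (x powr s * N powr (- (s + 1))) = x powr (s + 2) * N powr (- (s + 1))"
      using x by (simp add: powr_add)
    moreover have "\<delta> powr (s + 2) * N powr (- (s + 1)) \<le> x powr (s + 2) * N powr (- (s + 1))"
      using x d s by (intro mult_right_mono powr_mono2) auto
    ultimately have "\<delta> powr (s + 2) * N powr (- (s + 1)) \<le> x\<^sup>2 * Ds_weight s x y"
      by linarith
    then have "\<delta> powr (s + 2) * N powr (- (s + 1)) * norm (g (Complex x y)) \<le>
        x\<^sup>2 * Ds_weight s x y * norm (g (Complex x y))"
      by (rule mult_right_mono) simp
    also have "\<dots> \<le> C * Ds_mass s g {x/2..3*x/2}"
      unfolding Ds_mass_def by (intro C hol int x)
    also have "\<dots> \<le> M"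
      unfolding M_def using C by (intro mult_left_mono Ds_mass_mono int) auto
    finally have "norm (g (Complex x y)) \<le> M * (\<delta> powr (- (s + 2)) * N powr (s + 1))"
      unfolding powr_minus_divide using d N by (simp add: field_simps)
    then have gb: "norm (g (z + of_real \<delta>)) \<le> M * \<delta> powr (- (s + 2)) * N powr (s + 1)"
      unfolding zd by (simp add: mult_ac)
    \<comment> \<open>The imaginary parts of \<delta> (1 + z) and 1 + \<delta> z agree, and the real
      parts satisfy \<delta> + \<delta> Re z <= 1 + \<delta> Re z since \<delta> <= 1.\<close>
    have "\<delta> * N \<le> norm (1 + of_real \<delta> * z)"
    proof -
      have "(\<delta> * N)\<^sup>2 = (\<delta> * (1 + Re z))\<^sup>2 + (\<delta> * Im z)\<^sup>2"
        unfolding power_mult_distrib N_def cmod_power2 by (simp add: distrib_left)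
      also have "\<dots> \<le> (1 + \<delta> * Re z)\<^sup>2 + (\<delta> * Im z)\<^sup>2"
        using d z by (intro add_right_mono power_mono) (auto simp: distrib_left)
      also have "\<dots> = (norm (1 + of_real \<delta> * z))\<^sup>2"
        by (simp add: cmod_power2)
      finally show ?thesis
        by (rule power2_le_imp_le) simp
    qed
    then have "norm (1 / (1 + of_real \<delta> * z)) \<le> 1 / (\<delta> * N)"
      using d N by (simp add: norm_divide frac_le)
    then have "norm ((1 / (1 + of_real \<delta> * z)) ^ m) \<le> (1 / (\<delta> * N)) ^ m"
      unfolding norm_power by (rule power_mono) simp
    also have "\<dots> = (1 / \<delta>) ^ m * N powr (- real m)"
      using d N by (simp add: power_divide power_mult_distrib powr_minus_divide powr_realpow)
    finally have pb: "norm ((1 / (1 + of_real \<delta> * z)) ^ m) \<le> (1 / \<delta>) ^ m * N powr (- real m)" .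
    have "norm (Ds_regularization m n g z) * N ^ 3 \<le>
        (M * \<delta> powr (- (s + 2)) * N powr (s + 1)) * ((1 / \<delta>) ^ m * N powr (- real m)) * N ^ 3"
      unfolding reg norm_mult using gb pb M N by (intro mult_right_mono mult_mono) auto
    also have "\<dots> = M * \<delta> powr (- (s + 2)) * (1 / \<delta>) ^ m * (N powr (s + 1) * N powr (- real m) * N powr 3)"
      using N by (simp add: powr_numeral)
    also have "N powr (s + 1) * N powr (- real m) * N powr 3 = N powr (s + 4 - real m)"
      unfolding powr_add[symmetric] by (simp add: algebra_simps)
    also have "M * \<delta> powr (- (s + 2)) * (1 / \<delta>) ^ m * N powr (s + 4 - real m) \<le> M * \<delta> powr (- (s + 2)) * (1 / \<delta>) ^ m * 1"
    proof (rule mult_left_mono)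
      have "N powr (s + 4 - real m) \<le> N powr 0"
        using m N by (intro powr_mono) auto
      then show "N powr (s + 4 - real m) \<le> 1" using N by simp
    qed (use M d in auto)
    finally show "norm (Ds_regularization m n g z) * norm (1 + z) ^ 3 \<le> M * \<delta> powr (- (s + 2)) * (1 / \<delta>) ^ m"
      by (simp add: N_def)
  qed
qed

section \<open>From the derivative back to the norm of the space\<close>

lemma f_inf_eqI:
  assumes "\<And>psi. psi \<in> {0<..<pi/2} \<Longrightarrow> (f \<longlongrightarrow> L) (inf at_infinity (principal (sector psi)))"
  shows "f_inf f = L"
  unfolding f_inf_def
proof (rule the_equality)
  fix L' assume L': "\<forall>psi\<in>{0<..<pi/2}. (f \<longlongrightarrow> L') (inf at_infinity (principal (sector psi)))"
  have psi: "pi / 4 \<in> {0<..<pi/2}" by simp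
  \<comment> \<open>Limits are unique only along a proper filter; the sector contains arbitrarily
    large positive reals, so the filter is proper.\<close>
  have "inf at_infinity (principal (sector (pi / 4))) \<noteq> bot"
  proof
    assume "inf at_infinity (principal (sector (pi / 4))) = bot"
    then have "\<forall>\<^sub>F z in inf at_infinity (principal (sector (pi / 4))). False"
      by simp
    then obtain b where b: "\<And>z. b \<le> norm z \<Longrightarrow> z \<notin> sector (pi / 4)"
      unfolding eventually_inf_principal eventually_at_infinity by auto
    have "of_real (max b 1) \<in> sector (pi / 4)"
      by (simp add: sector_def Arg_of_real)
    then show False
      using b[of "of_real (max b 1)"] by simp
  qed
  then show "L' = L"
    using tendsto_unique[OF _ L'[rule_format, OF psi] assms[OF psi]] by blast
qed (use assms in blast)

lemma Ds_approx_integral: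
  assumes s: "s > -1" and f: "f \<in> Ds s" and e: "0 < \<epsilon>"
  shows "\<exists>r\<in>Rtilde. Ds_integral s (\<lambda>z. f z - r z) < ennreal \<epsilon>"
proof -
  have hol: "f holomorphic_on rhp" using f by (simp add: Ds_def)
  have holg: "deriv f holomorphic_on rhp" by (intro holomorphic_deriv hol open_rhp)
  note int = Ds_integrable[OF f]
  define m where "m = nat \<lceil>s + 4\<rceil>"
  have m: "s + 4 \<le> real m" unfolding m_def by (rule real_nat_ceiling_ge)
  have e2: "0 < ennreal (\<epsilon> / 2)" using e by (simp add: ennreal_zero_less_divide)
  have "\<forall>\<^sub>F n in sequentially. (\<integral>\<^sup>+v. norm (on_rhp (Ds_regularization m n (deriv f)) v - on_rhp (deriv f) v) \<partial>Ds_measure s)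
      < ennreal (\<epsilon> / 2)"
    using order_tendstoD(2)[OF Ds_regularization_tendsto[OF s holg int] e2] .
  then obtain n where n: "(\<integral>\<^sup>+v. norm (on_rhp (Ds_regularization m n (deriv f)) v - on_rhp (deriv f) v) \<partial>Ds_measure s)
      < ennreal (\<epsilon> / 2)"
    by (meson eventually_happens trivial_limit_sequentially)
  define G where "G = Ds_regularization m n (deriv f)"
  define K where "K = (\<integral>\<^sup>+x. ennreal (1 / (norm (1 + Complex (fst x) (snd x)))\<^sup>2) \<partial>Ds_measure s)"
  have K: "K < \<infinity>" unfolding K_def by (rule nn_integral_inverse_square_finite[OF s])
  \<comment> \<open>Chosen so that \<eta> times the integral of |1 + z|^-2 is at most \<epsilon>/2;
    the added 1 keeps the denominator positive. The other \<epsilon>/2 is spent on the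
    regularization.\<close>
  define \<eta> where "\<eta> = \<epsilon> / (2 * (enn2real K + 1))"
  have eta: "0 < \<eta>" using e by (simp add: \<eta>_def add_nonneg_pos)
  have "ennreal \<eta> * K = ennreal (\<eta> * enn2real K)"
    using K eta by (simp add: ennreal_mult less_top)
  also have "\<dots> \<le> ennreal (\<epsilon> / 2)"
  proof (rule ennreal_leI)
    have "\<eta> * enn2real K \<le> \<eta> * (enn2real K + 1)" using eta by simp
    also have "\<dots> = \<epsilon> / 2"
      using enn2real_nonneg[of K] by (simp add: \<eta>_def field_simps add_nonneg_eq_0_iff)
    finally show "\<eta> * enn2real K \<le> \<epsilon> / 2" .
  qed
  finally have etaK: "ennreal \<eta> * K \<le> ennreal (\<epsilon> / 2)" .
  have "Rtilde_deriv_approximable G"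
    unfolding G_def by (rule Ds_regularization_approximable[OF s holg int m])
  then obtain r where r: "r \<in> Rtilde"
    and rb: "\<And>z. z \<in> rhp \<Longrightarrow> norm (G z - deriv r z) * (norm (1 + z))\<^sup>2 \<le> \<eta>"
    unfolding Rtilde_deriv_approximable_def using eta by meson
  have holr: "r holomorphic_on rhp" by (rule Rtilde_holomorphic[OF r])
  have holfr: "(\<lambda>z. f z - r z) holomorphic_on rhp"
    by (intro holomorphic_intros hol holr)
  have contG: "continuous_on rhp G"
    unfolding G_def by (intro Ds_regularization_continuous deriv_continuous_on_rhp hol)
  have contdr: "continuous_on rhp (\<lambda>z. G z - deriv r z)"
    by (intro continuous_intros contG deriv_continuous_on_rhp holr)
  note [measurable] = on_rhp_measurable[OF contdr] on_rhp_measurable[OF contG]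
    on_rhp_measurable[OF deriv_continuous_on_rhp[OF hol]]
  have "Ds_integral s (\<lambda>z. f z - r z) = (\<integral>\<^sup>+v. norm (on_rhp (deriv (\<lambda>z. f z - r z)) v) \<partial>Ds_measure s)"
    by (rule Ds_integral_eq[OF holfr])
  also have "\<dots> \<le> (\<integral>\<^sup>+v. ennreal (norm (on_rhp G v - on_rhp (deriv f) v)) +
      ennreal (norm (on_rhp (\<lambda>z. G z - deriv r z) v)) \<partial>Ds_measure s)"
  proof (rule nn_integral_mono)
    fix v :: "real \<times> real"
    have "norm (on_rhp (deriv (\<lambda>z. f z - r z)) v) \<le>
        norm (on_rhp G v - on_rhp (deriv f) v) + norm (on_rhp (\<lambda>z. G z - deriv r z) v)"
    proof (cases "0 < fst v")
      case True
      define z where "z = Complex (fst v) (snd v)"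
      have z: "z \<in> rhp" using True by (simp add: z_def rhp_def)
      have "deriv (\<lambda>z. f z - r z) z = deriv f z - deriv r z"
        using hol holr z open_rhp by (intro deriv_diff) (auto intro: holomorphic_on_imp_differentiable_at)
      moreover have "norm (deriv f z - deriv r z) \<le> norm (G z - deriv f z) + norm (G z - deriv r z)"
        using norm_triangle_ineq4[of "G z - deriv r z" "G z - deriv f z"] by (simp add: add.commute)
      ultimately show ?thesis
        using True by (simp add: on_rhp_def z_def)
    qed (simp add: on_rhp_def)
    then show "ennreal (norm (on_rhp (deriv (\<lambda>z. f z - r z)) v)) \<le>
        ennreal (norm (on_rhp G v - on_rhp (deriv f) v)) + ennreal (norm (on_rhp (\<lambda>z. G z - deriv r z) v))"
      by (subst ennreal_plus[symmetric]) (simp_all add: ennreal_leI del: ennreal_plus)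
  qed
  also have "\<dots> = (\<integral>\<^sup>+v. norm (on_rhp G v - on_rhp (deriv f) v) \<partial>Ds_measure s) +
      (\<integral>\<^sup>+v. norm (on_rhp (\<lambda>z. G z - deriv r z) v) \<partial>Ds_measure s)"
    by (rule nn_integral_add) measurable
  also have "(\<integral>\<^sup>+v. norm (on_rhp (\<lambda>z. G z - deriv r z) v) \<partial>Ds_measure s) \<le> ennreal (\<epsilon> / 2)"
    using nn_integral_on_rhp_le[OF rb] etaK unfolding K_def by (rule order_trans)
  also have "(\<integral>\<^sup>+v. norm (on_rhp G v - on_rhp (deriv f) v) \<partial>Ds_measure s) + ennreal (\<epsilon> / 2)
      < ennreal (\<epsilon> / 2) + ennreal (\<epsilon> / 2)"
    using n unfolding G_def by (subst (1 2) add.commute) (simp add: ennreal_add_left_cancel_less)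
  also have "ennreal (\<epsilon> / 2) + ennreal (\<epsilon> / 2) = ennreal \<epsilon>"
    using e by (subst ennreal_plus[symmetric]) auto
  finally have "Ds_integral s (\<lambda>z. f z - r z) < ennreal \<epsilon>"
    by (simp only: add_left_mono)
  with r show ?thesis by blast
qed

theorem theorem5p1:
  fixes s :: real
  assumes "s > -1"
  shows "Rtilde \<subseteq> Ds s \<and>
         (\<forall>f\<in>Ds s. \<forall>\<epsilon>>0. \<exists>r\<in>Rtilde. Ds_norm s (\<lambda>z. f z - r z) < \<epsilon>)"
proof (intro conjI ballI allI impI)
  show "Rtilde \<subseteq> Ds s" by (rule Rtilde_subset_Ds[OF assms])
  fix f \<epsilon> assume f: "f \<in> Ds s" and e: "(0::real) < \<epsilon>"
  obtain r0 where r0: "r0 \<in> Rtilde" and small: "Ds_integral s (\<lambda>z. f z - r0 z) < ennreal \<epsilon>"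
    using Ds_approx_integral[OF assms f e] by blast
  have hol: "(\<lambda>z. f z - r0 z) holomorphic_on rhp"
    using f Rtilde_holomorphic[OF r0] by (intro holomorphic_intros) (auto simp: Ds_def)
  have "(\<lambda>z. f z - r0 z) \<in> Ds s"
    using hol order.strict_trans[OF small ennreal_less_top] by (simp add: Ds_def)
  then obtain L where L: "\<And>psi. psi \<in> {0<..<pi/2} \<Longrightarrow>
      ((\<lambda>z. f z - r0 z) \<longlongrightarrow> L) (inf at_infinity (principal (sector psi)))"
    using Ds_limit_exists[OF assms] by blast
  \<comment> \<open>Constants belong to the space and do not affect the seminorm, so adding L makes
    the limit of f - r vanish.\<close>
  define r where "r z = r0 z + L" for z
  have r: "r \<in> Rtilde"
    unfolding r_def by (intro Rtilde_add r0 Rtilde_const)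
  have eq: "(\<lambda>z. f z - r z) = (\<lambda>z. (f z - r0 z) - L)"
    by (simp add: r_def fun_eq_iff)
  have "f_inf (\<lambda>z. f z - r z) = L - L"
    unfolding eq by (intro f_inf_eqI tendsto_diff L tendsto_const)
  moreover have "Ds_integral s (\<lambda>z. f z - r z) = Ds_integral s (\<lambda>z. f z - r0 z)"
  proof -
    have "deriv (\<lambda>z. (f z - r0 z) - L) = deriv (\<lambda>z. f z - r0 z)"
    proof -
      \<comment> \<open>Off the half-plane differentiability is unknown. Both functions have the
        same derivatives D at every point, so \<open>deriv\<close> selects the same value even where
        none exists.\<close>
      have "((\<lambda>z. (f z - r0 z) - L) has_field_derivative D) (at z) \<longleftrightarrow>
          ((\<lambda>z. f z - r0 z) has_field_derivative D) (at z)" for D z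
        using DERIV_add[of "\<lambda>z. (f z - r0 z) - L" D z UNIV "\<lambda>_. L" 0]
          DERIV_diff[of "\<lambda>z. f z - r0 z" D z UNIV "\<lambda>_. L" 0] by auto
      then show ?thesis
        unfolding deriv_def by simp
    qed
    then show ?thesis
      unfolding Ds_integral_def eq by simp
  qed
  ultimately have "Ds_norm s (\<lambda>z. f z - r z) = enn2real (Ds_integral s (\<lambda>z. f z - r0 z))"
    by (simp add: Ds_norm_def Ds0_norm_def)
  also have "\<dots> < \<epsilon>"
    using small e by (cases "Ds_integral s (\<lambda>z. f z - r0 z)") (auto simp: ennreal_less_iff)
  finally show "\<exists>r\<in>Rtilde. Ds_norm s (\<lambda>z. f z - r z) < \<epsilon>"
    using r by blast
qed

end
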